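(* Let $f:\mathbb{R}^d\to\mathbb{R}$ be convex and continuously differentiable with $L$-Lipschitz continuous gradient, let $g:\mathbb{R}^d\to\mathbb{R}\cup\{+\infty\}$ be proper, lower semicontinuous and convex, and assume $\operatorname{argmin}(f+g)\ne\emptyset$. Let $\sigma:\mathbb{R}_+\times\mathbb{R}^d\to\mathbb{R}^{d\times m}$ be measurable with entries satisfying $\sup_{t\ge 0,x\in\mathbb{R}^d}|\sigma_{ik}(t,x)|<\infty$ and $|\sigma_{ik}(t,x')-\sigma_{ik}(t,x)|\le l_0\|x'-x\|$ for some $l_0>0$ and all $t\ge0$, $x,x'\in\mathbb{R}^d$, and suppose $\sigma_\infty\in L^2(\mathbb{R}_+)$. Let $\theta>0$, $F_\theta:=f+g_\theta$ with $g_\theta$ the Moreau envelope of $g$, and assume $\mathcal{S}_\theta:=\operatorname{argmin}F_\theta\ne\emptyset$. Let $X_0\in\mathbb{R}^d$ and let $X_\theta\in S_d^2$ be the solution of $$dX(t)=-\nabla F_\theta(X(t))\,dt+\sigma(t,X(t))\,dW(t),\quad t\ge0,\qquad X(0)=X_0.$$ Then there exists an $\mathcal{S}_\theta$-valued random variable $x_\theta^\star$ such that $\lim_{t\to\infty}X_\theta(t)=x_\theta^\star$ almost surely.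
   Context: The Moreau envelope of $g$ with parameter $\theta>0$ is $g_\theta(x):=\inf_{y\in\mathbb{R}^d}\left(g(y)+\frac1{2\theta}\|x-y\|^2\right)$; it is convex and $C^1$ with $\frac1\theta$-Lipschitz gradient. $(\Omega,\mathcal{F},\{\mathcal{F}_t\}_{t\ge0},\mathbb{P})$ is a filtered probability space and $W$ is an $\mathcal{F}_t$-adapted $m$-dimensional Brownian motion on it. $\sigma_\infty(t):=\sup_{x\in\mathbb{R}^d}\|\sigma(t,x)\|_F$, with $\|\cdot\|_F$ the Frobenius norm. Two processes $X,Y:\Omega\times[0,T]\to\mathbb{R}^d$ are identified if almost surely $X(t)=Y(t)$ for all $t\in[0,T]$. $S_d^0[0,T]$ is the set (modulo this identification) of progressively measurable continuous processes $X:\Omega\times[0,T]\to\mathbb{R}^d$; $S_d^2[0,T]$ is the set of $X\in S_d^0[0,T]$ with $\mathbb{E}(\sup_{t\in[0,T]}\|X(t)\|^2)<+\infty$, and $S_d^2:=\bigcap_{T\ge0}S_d^2[0,T]$. The SDE has a unique solution in $S_d^2$ under the stated hypotheses. *)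

theory Defs
  imports "HOL-Probability.Probability"
begin

section \<open>Convex analysis\<close>

definition argmin :: "('a \<Rightarrow> 'b::ord) \<Rightarrow> 'a set" where
  "argmin \<phi> = {x. is_arg_min \<phi> (\<lambda>_. True) x}"

definition grad :: "('a::real_inner \<Rightarrow> real) \<Rightarrow> 'a \<Rightarrow> 'a" where
  "grad \<phi> x = (THE D. GDERIV \<phi> x :> D)"

definition proper_fun :: "('a \<Rightarrow> ereal) \<Rightarrow> bool" where
  "proper_fun g \<longleftrightarrow> (\<forall>x. g x \<noteq> -\<infinity>) \<and> (\<exists>x. g x \<noteq> \<infinity>)"

definition lsc_fun :: "('a::topological_space \<Rightarrow> ereal) \<Rightarrow> bool" where
  "lsc_fun g \<longleftrightarrow> (\<forall>x. g x \<le> Liminf (at x) g)"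

text \<open>In \<open>ereal\<close>, \<open>0 * \<infinity> = 0\<close>, so the endpoint cases are harmless.\<close>

definition convex_fun :: "('a::real_vector \<Rightarrow> ereal) \<Rightarrow> bool" where
  "convex_fun g \<longleftrightarrow>
    (\<forall>x y u v. 0 \<le> u \<longrightarrow> 0 \<le> v \<longrightarrow> u + v = 1 \<longrightarrow>
      g (u *\<^sub>R x + v *\<^sub>R y) \<le> ereal u * g x + ereal v * g y)"

text \<open>The infimum is taken in \<open>ereal\<close>; it is finite when \<open>g\<close> is proper, lower semicontinuous and
  convex and \<open>\<theta> > 0\<close>, so the conversion to \<open>real\<close> loses nothing there.\<close>

definition moreau_env :: "('a::real_normed_vector \<Rightarrow> ereal) \<Rightarrow> real \<Rightarrow> 'a \<Rightarrow> real" where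
  "moreau_env g \<theta> x =
    real_of_ereal (INF y. g y + ereal (1 / (2 * \<theta>) * (norm (x - y))\<^sup>2))"

definition smoothed_objective ::
    "('a::real_normed_vector \<Rightarrow> real) \<Rightarrow> ('a \<Rightarrow> ereal) \<Rightarrow> real \<Rightarrow> 'a \<Rightarrow> real" where
  "smoothed_objective f g \<theta> x = f x + moreau_env g \<theta> x"

section \<open>Filtered probability spaces and processes\<close>

text \<open>Time is \<open>real\<close>, but only times \<open>t \<ge> 0\<close> matter. The reparametrisation \<open>max 0 t\<close> allows the use
  of the library's \<open>filtration\<close> without constraining \<open>F t\<close> for \<open>t < 0\<close>. Neither completeness
  nor right-continuity is required.\<close>

locale filtered_prob_space = prob_space M
  for M :: "'a measure" +
  fixes F :: "real \<Rightarrow> 'a measure"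
  assumes filtration_F: "filtration (space M) (\<lambda>t. F (max 0 t))"
    and sets_F_subset: "\<And>t. 0 \<le> t \<Longrightarrow> sets (F t) \<subseteq> sets M"

text \<open>Processes are functions of time and outcome; they stand for their classes up to
  indistinguishability.\<close>

definition progressive_on :: "(real \<Rightarrow> 'a measure) \<Rightarrow> real set \<Rightarrow>
    (real \<Rightarrow> 'a \<Rightarrow> 'b::topological_space) \<Rightarrow> bool" where
  "progressive_on F I X \<longleftrightarrow>
    (\<forall>t\<in>I. (\<lambda>(s, \<omega>). X s \<omega>) \<in> borel_measurable (restrict_space borel {0..t} \<Otimes>\<^sub>M F t))"

definition S0_upto :: "'a measure \<Rightarrow> (real \<Rightarrow> 'a measure) \<Rightarrow> real \<Rightarrow>
    (real \<Rightarrow> 'a \<Rightarrow> 'b::real_normed_vector) set" where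
  "S0_upto M F T = {X. progressive_on F {0..T} X \<and>
    (\<forall>\<omega>\<in>space M. continuous_on {0..T} (\<lambda>t. X t \<omega>))}"

definition S2_upto :: "'a measure \<Rightarrow> (real \<Rightarrow> 'a measure) \<Rightarrow> real \<Rightarrow>
    (real \<Rightarrow> 'a \<Rightarrow> 'b::real_normed_vector) set" where
  "S2_upto M F T = {X \<in> S0_upto M F T.
    (\<integral>\<^sup>+ \<omega>. (SUP t\<in>{0..T}. ennreal ((norm (X t \<omega>))\<^sup>2)) \<partial>M) < \<infinity>}"

definition S2 :: "'a measure \<Rightarrow> (real \<Rightarrow> 'a measure) \<Rightarrow>
    (real \<Rightarrow> 'a \<Rightarrow> 'b::real_normed_vector) set" where
  "S2 M F = (\<Inter>T\<in>{0..}. S2_upto M F T)"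

section \<open>Brownian motion\<close>

text \<open>A standard Brownian motion relative to the filtration: increments after time \<open>s\<close> are
  independent of \<open>F s\<close>, and \<open>W t - W s\<close> has law \<open>N(0, (t - s) Id)\<close>, stated as independence of the
  components together with their one-dimensional laws.\<close>

locale brownian_motion = filtered_prob_space M F
  for M :: "'a measure" and F :: "real \<Rightarrow> 'a measure" +
  fixes W :: "real \<Rightarrow> 'a \<Rightarrow> real ^ 'm"
  assumes adapted_W: "\<And>t. 0 \<le> t \<Longrightarrow> W t \<in> borel_measurable (F t)"
    and W_0: "AE \<omega> in M. W 0 \<omega> = 0"
    and continuous_W: "AE \<omega> in M. continuous_on {0..} (\<lambda>t. W t \<omega>)"
    and indep_increment: "\<And>s t. 0 \<le> s \<Longrightarrow> s < t \<Longrightarrow>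
      indep_set (sets (F s)) {(\<lambda>\<omega>. W t \<omega> - W s \<omega>) -` A \<inter> space M | A. A \<in> sets borel}"
    and indep_components: "\<And>s t. 0 \<le> s \<Longrightarrow> s < t \<Longrightarrow>
      indep_vars (\<lambda>_. borel) (\<lambda>k \<omega>. (W t \<omega> - W s \<omega>) $ k) UNIV"
    and normal_increment: "\<And>s t k. 0 \<le> s \<Longrightarrow> s < t \<Longrightarrow>
      distributed M lborel (\<lambda>\<omega>. (W t \<omega> - W s \<omega>) $ k) (normal_density 0 (sqrt (t - s)))"

section \<open>It\^o integral and stochastic differential equations\<close>

text \<open>\<open>simple_ito_integral M F W H J\<close>: the integrand \<open>H\<close> is a bounded step process and \<open>J\<close> is
  its elementary stochastic integral.\<close>

definition simple_ito_integral :: "'a measure \<Rightarrow> (real \<Rightarrow> 'a measure) \<Rightarrow> (real \<Rightarrow> 'a \<Rightarrow> real ^ 'm) \<Rightarrow>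
    (real \<Rightarrow> 'a \<Rightarrow> real ^ 'm ^ 'd) \<Rightarrow> (real \<Rightarrow> 'a \<Rightarrow> real ^ 'd) \<Rightarrow> bool" where
  "simple_ito_integral M F W H J \<longleftrightarrow>
    (\<exists>(n::nat) (\<tau> :: nat \<Rightarrow> real) (\<xi> :: nat \<Rightarrow> 'a \<Rightarrow> real ^ 'm ^ 'd).
      0 \<le> \<tau> 0 \<and> (\<forall>i<n. \<tau> i \<le> \<tau> (Suc i)) \<and>
      (\<forall>i<n. \<xi> i \<in> borel_measurable (F (\<tau> i)) \<and> bounded (\<xi> i ` space M)) \<and>
      H = (\<lambda>s \<omega>. \<Sum>i<n. indicator {\<tau> i <.. \<tau> (Suc i)} s *\<^sub>R \<xi> i \<omega>) \<and>
      J = (\<lambda>t \<omega>. \<Sum>i<n. \<xi> i \<omega> *v (W (min t (\<tau> (Suc i))) \<omega> - W (min t (\<tau> i)) \<omega>)))"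

text \<open>\<open>ito_integral M F W H I\<close>: the continuous adapted process \<open>I\<close> is the It\^o integral
  \<open>\<integral>\<^sub>0\<^sup>t H s dW s\<close> of a progressively measurable, locally square-integrable integrand, that is, an
  \<open>L\<^sup>2\<close>-limit of integrals of step processes approximating \<open>H\<close>. By the It\^o isometry this
  determines each \<open>I T\<close> almost surely, hence \<open>I\<close> up to indistinguishability. On \<open>real^'m^'d\<close>,
  \<open>norm\<close> is the Frobenius norm.\<close>

definition ito_integral :: "'a measure \<Rightarrow> (real \<Rightarrow> 'a measure) \<Rightarrow> (real \<Rightarrow> 'a \<Rightarrow> real ^ 'm) \<Rightarrow>
    (real \<Rightarrow> 'a \<Rightarrow> real ^ 'm ^ 'd) \<Rightarrow> (real \<Rightarrow> 'a \<Rightarrow> real ^ 'd) \<Rightarrow> bool" where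
  "ito_integral M F W H I \<longleftrightarrow>
    progressive_on F {0..} H \<and>
    (\<forall>T\<ge>0. (\<integral>\<^sup>+ \<omega>. (\<integral>\<^sup>+ s\<in>{0..T}. ennreal ((norm (H s \<omega>))\<^sup>2) \<partial>lborel) \<partial>M) < \<infinity>) \<and>
    (\<forall>t\<ge>0. I t \<in> borel_measurable (F t)) \<and>
    (\<forall>\<omega>\<in>space M. continuous_on {0..} (\<lambda>t. I t \<omega>)) \<and>
    (\<forall>T\<ge>0. \<exists>Hn Jn.
      (\<forall>n. simple_ito_integral M F W (Hn n) (Jn n)) \<and>
      (\<lambda>n. \<integral>\<^sup>+ \<omega>. (\<integral>\<^sup>+ s\<in>{0..T}. ennreal ((norm (Hn n s \<omega> - H s \<omega>))\<^sup>2) \<partial>lborel) \<partial>M)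
        \<longlonglongrightarrow> 0 \<and>
      (\<lambda>n. \<integral>\<^sup>+ \<omega>. ennreal ((norm (Jn n T \<omega> - I T \<omega>))\<^sup>2) \<partial>M) \<longlonglongrightarrow> 0)"

text \<open>\<open>X\<close> solves \<open>dX t = b (X t) dt + \<sigma> t (X t) dW t\<close> for \<open>t \<ge> 0\<close>, with \<open>X 0 = x0\<close>. The initial
  condition is the case \<open>t = 0\<close> of the integral equation, as \<open>I 0 = 0\<close> almost surely.\<close>

definition sde_solution :: "'a measure \<Rightarrow> (real \<Rightarrow> 'a measure) \<Rightarrow> (real \<Rightarrow> 'a \<Rightarrow> real ^ 'm) \<Rightarrow>
    (real ^ 'd \<Rightarrow> real ^ 'd) \<Rightarrow> (real \<Rightarrow> real ^ 'd \<Rightarrow> real ^ 'm ^ 'd) \<Rightarrow> real ^ 'd \<Rightarrow>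
    (real \<Rightarrow> 'a \<Rightarrow> real ^ 'd) \<Rightarrow> bool" where
  "sde_solution M F W b \<sigma> x0 X \<longleftrightarrow>
    (\<exists>I. ito_integral M F W (\<lambda>t \<omega>. \<sigma> t (X t \<omega>)) I \<and>
      (AE \<omega> in M. \<forall>t\<ge>0. set_integrable lborel {0..t} (\<lambda>s. b (X s \<omega>)) \<and>
        X t \<omega> = x0 + (LINT s:{0..t}|lborel. b (X s \<omega>)) + I t \<omega>))"

definition sigma_inf :: "(real \<Rightarrow> real ^ 'd \<Rightarrow> real ^ 'm ^ 'd) \<Rightarrow> real \<Rightarrow> real" where
  "sigma_inf \<sigma> t = (SUP x. norm (\<sigma> t x))"

end

theory Submission
  imports Defs
begin

text \<open>The noise \<open>I\<close>, the integral of \<open>\<sigma> t (X t)\<close> with respect to \<open>W\<close>, is a square-integrable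
  martingale with \<open>E \<parallel>I t - I s\<parallel>\<^sup>2 \<le> tail s - tail t\<close>, where \<open>tail s\<close> is the integral of \<open>sigma_inf\<^sup>2\<close> over
  \<open>(s, \<infinity>)\<close>. For a minimizer \<open>y\<close> of \<open>\<Phi> = F\<^sub>\<theta>\<close>, expanding \<open>\<parallel>X t - y\<parallel>\<^sup>2\<close> and using convexity shows that
  \<open>\<parallel>X t - y\<parallel>\<^sup>2 + tail t\<close> is a nonnegative supermartingale, even when \<open>y\<close> is random and known at the
  initial time, and that the expectation of \<open>\<Phi> (X t) - min \<Phi>\<close> is integrable in time. Hence almost
  surely the paths are bounded and \<open>X (s k)\<close> approaches the set of minimizers along some \<open>s k \<rightarrow> \<infinity>\<close>.
  The maximal inequality, restarted at time \<open>s k\<close> with \<open>y\<close> the projection of \<open>X (s k)\<close> onto the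
  minimizers, bounds the probability that \<open>X\<close> ever leaves a small ball around \<open>y\<close> after \<open>s k\<close>,
  so almost every path is Cauchy.\<close>

section \<open>Convex functions and the Moreau envelope\<close>

text \<open>Comparison with one fixed minimizer controls only the distance to that point, not the
  position of the path. The centre of the comparison must therefore be picked along the path, and
  this is why the estimates are stated for a random \<open>Y\<close> known at the starting time and
  are tested against events of that time.

  Two features of the setting shape the rest. The integral \<open>I\<close> is given only as an L2
  limit, separately for each time, so its isometry and martingale property are proved for elementary
  integrands and carried over by inequalities whose constants tend to 1. The integrated equation
  contains the noise as an additive term, so the squared distance can be expanded pathwise by
  ordinary calculus on the drift part.

  In the last step the paths come close to the minimizers almost surely but without a rate, so no
  fixed \<open>k\<close> comes with a probability of being close. What is used is that closeness
  holds for all large \<open>k\<close>, whereas a later escape, being improbable at each such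
  \<open>k\<close>, cannot occur for all large \<open>k\<close> at once except on an event of small
  probability.\<close>

lemma convex_on_subgradient:
  fixes \<phi> :: "'a::euclidean_space \<Rightarrow> real"
  assumes "convex_on UNIV \<phi>"
  shows "\<exists>p. \<forall>y. \<phi> x + p \<bullet> (y - x) \<le> \<phi> y"
proof -
  \<comment> \<open>The strict epigraph is separated from the point \<open>(x, \<phi> x)\<close> of
    the graph: in finite dimension disjointness of convex sets suffices for this, and strictness
    makes the two disjoint.\<close>
  define S where "S = {z :: 'a \<times> real. \<phi> (fst z) < snd z}"
  have "convex S"
  proof (rule convexI)
    fix z z' u v assume zz: "z \<in> S" "z' \<in> S" and uv: "0 \<le> (u::real)" "0 \<le> v" "u + v = 1"
    have "\<phi> (u *\<^sub>R fst z + v *\<^sub>R fst z') \<le> u * \<phi> (fst z) + v * \<phi> (fst z')"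
      using assms uv unfolding convex_on_def by auto
    also have "\<dots> < u * snd z + v * snd z'"
    proof (cases "u = 0")
      case True then show ?thesis using zz uv by (simp add: S_def)
    next
      case False
      then have "u * \<phi> (fst z) < u * snd z" using zz uv by (simp add: S_def)
      moreover have "v * \<phi> (fst z') \<le> v * snd z'"
        using zz uv by (intro mult_left_mono) (auto simp: S_def)
      ultimately show ?thesis by linarith
    qed
    finally show "u *\<^sub>R z + v *\<^sub>R z' \<in> S" by (simp add: S_def)
  qed
  moreover have "(x, \<phi> x + 1) \<in> S" by (simp add: S_def)
  moreover have "S \<inter> {(x, \<phi> x)} = {}" by (simp add: S_def)
  ultimately have "\<exists>a b. a \<noteq> 0 \<and> (\<forall>z\<in>S. a \<bullet> z \<le> b) \<and> (\<forall>z\<in>{(x, \<phi> x)}. a \<bullet> z \<ge> b)"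
    by (intro separating_hyperplane_sets) auto
  then obtain a b where a: "a \<noteq> 0" "\<forall>z\<in>S. a \<bullet> z \<le> b" "a \<bullet> (x, \<phi> x) \<ge> b"
    by blast
  obtain w c where ac: "a = (w, c)" by fastforce
  have sep: "w \<bullet> y + c * r \<le> w \<bullet> x + c * \<phi> x" if "\<phi> y < r" for y r
  proof -
    have "a \<bullet> (y, r) \<le> b" using a(2) that by (simp add: S_def)
    then show ?thesis using a(3) by (simp add: ac)
  qed
  have "c \<le> 0" using sep[of x "\<phi> x + 1"] by (simp add: algebra_simps)
  \<comment> \<open>A vertical hyperplane is impossible because \<phi> is finite everywhere:
    stepping from \<open>x\<close> along the normal \<open>w\<close> would leave the half-space
    unless \<open>w = 0\<close>.\<close>
  have "c \<noteq> 0"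
  proof
    assume c: "c = 0"
    have "w \<bullet> (x + w) \<le> w \<bullet> x" using sep[of "x + w" "\<phi> (x + w) + 1"] by (simp add: c)
    then have "w \<bullet> w = 0" by (intro antisym) (auto simp: inner_add_right)
    then have "w = 0" by simp
    then show False using a(1) ac c by (simp add: zero_prod_def)
  qed
  with \<open>c \<le> 0\<close> have c: "c < 0" by simp
  \<comment> \<open>The subgradient is the normal rescaled to last component -1. Points of the graph
    are only limits of points of the strict epigraph, hence the slack \<open>e\<close>.\<close>
  have "\<phi> x + ((-1 / c) *\<^sub>R w) \<bullet> (y - x) \<le> \<phi> y" for y
  proof (rule field_le_epsilon)
    fix e :: real assume "0 < e"
    then have "w \<bullet> y + c * (\<phi> y + e) \<le> w \<bullet> x + c * \<phi> x" by (intro sep) simp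
    then have "w \<bullet> (y - x) \<le> (- c) * (\<phi> y + e - \<phi> x)" by (simp add: inner_diff_right algebra_simps)
    then have "w \<bullet> (y - x) / (- c) \<le> \<phi> y + e - \<phi> x"
      using c by (subst pos_divide_le_eq) (simp_all add: mult.commute)
    then show "\<phi> x + ((-1 / c) *\<^sub>R w) \<bullet> (y - x) \<le> \<phi> y + e" by simp
  qed
  then show ?thesis by blast
qed

lemma grad_eqI:
  assumes "GDERIV \<phi> x :> D"
  shows "grad \<phi> x = D"
  unfolding grad_def
proof (rule the_equality)
  show "GDERIV \<phi> x :> D" by (rule assms)
next
  fix D' assume "GDERIV \<phi> x :> D'"
  then have "(\<lambda>h. h \<bullet> D') = (\<lambda>h. h \<bullet> D)"
    using assms unfolding gderiv_def by (rule has_derivative_unique)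
  then show "D' = D"
    by (metis inner_commute vector_eq_rdot)
qed

lemma GDERIV_grad:
  fixes \<phi> :: "'a::euclidean_space \<Rightarrow> real"
  assumes "\<phi> differentiable (at x)"
  shows "GDERIV \<phi> x :> grad \<phi> x"
proof -
  obtain D where D: "(\<phi> has_derivative D) (at x)"
    using assms by (auto simp: differentiable_def)
  interpret D: linear D using D by (rule has_derivative_linear)
  have "D h = h \<bullet> (\<Sum>b\<in>Basis. D b *\<^sub>R b)" for h
  proof -
    have "D h = D (\<Sum>b\<in>Basis. (h \<bullet> b) *\<^sub>R b)" by (simp add: euclidean_representation)
    also have "\<dots> = (\<Sum>b\<in>Basis. (h \<bullet> b) * D b)" by (simp add: D.sum D.scale)
    finally show ?thesis by (simp add: inner_sum_right mult.commute)
  qed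
  then have "D = (\<lambda>h. h \<bullet> (\<Sum>b\<in>Basis. D b *\<^sub>R b))" by (rule ext)
  then have "GDERIV \<phi> x :> (\<Sum>b\<in>Basis. D b *\<^sub>R b)"
    using D unfolding gderiv_def by simp
  then show ?thesis using grad_eqI by metis
qed

text \<open>Subtracting the linear function with slope \<open>p\<close> leaves a function with a
  minimum at \<open>x\<close>, so its derivative vanishes there; testing this derivative on
  \<open>D - p\<close> gives the equality.\<close>

lemma subgradient_eq_gderiv:
  fixes \<phi> :: "'a::euclidean_space \<Rightarrow> real"
  assumes D: "GDERIV \<phi> x :> D" and p: "\<And>y. \<phi> x + p \<bullet> (y - x) \<le> \<phi> y"
  shows "p = D"
proof -
  have "((\<lambda>y. \<phi> y - p \<bullet> y) has_derivative (\<lambda>h. h \<bullet> D - p \<bullet> h)) (at x)"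
    using D unfolding gderiv_def by (auto intro!: derivative_eq_intros)
  moreover have "\<phi> x - p \<bullet> x \<le> \<phi> y - p \<bullet> y" for y
    using p[of y] by (simp add: inner_diff_right)
  ultimately have "(\<lambda>h. h \<bullet> D - p \<bullet> h) = (\<lambda>h. 0)"
    using differential_zero_maxmin[of x UNIV] by blast
  then have "(D - p) \<bullet> D - p \<bullet> (D - p) = 0" by metis
  then have "(D - p) \<bullet> (D - p) = 0" by (simp add: inner_diff inner_commute)
  then show ?thesis by simp
qed

text \<open>A convex function that lies below a paraboloid of fixed curvature through each of its points
  is \<open>C\<^sup>1\<close> with Lipschitz gradient: the linear part of the paraboloid must be the subgradient.\<close>

locale quadratically_bounded_convex =
  fixes \<phi> :: "'a::euclidean_space \<Rightarrow> real" and c :: real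
  assumes convex: "convex_on UNIV \<phi>"
    and c_nonneg: "0 \<le> c"
    and upper: "\<And>x. \<exists>q. \<forall>y. \<phi> y \<le> \<phi> x + q \<bullet> (y - x) + c * (norm (y - x))\<^sup>2"
begin

text \<open>The affine minorant and the paraboloid both touch \<phi> at \<open>x\<close>. A step of
  size \<open>t\<close> along \<open>p - q\<close> separates them by a term linear in
  \<open>t\<close> that only a quadratic term can compensate, so small \<open>t\<close> forces the
  slopes to agree.\<close>

lemma ex_gradient:
  "\<exists>p. (\<forall>y. \<phi> x + p \<bullet> (y - x) \<le> \<phi> y) \<and> (\<forall>y. \<phi> y \<le> \<phi> x + p \<bullet> (y - x) + c * (norm (y - x))\<^sup>2)"
proof -
  obtain p where p: "\<And>y. \<phi> x + p \<bullet> (y - x) \<le> \<phi> y"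
    using convex_on_subgradient[OF convex] by metis
  obtain q where q: "\<And>y. \<phi> y \<le> \<phi> x + q \<bullet> (y - x) + c * (norm (y - x))\<^sup>2"
    using upper by metis
  have "(p - q) \<bullet> (p - q) \<le> 0"
  proof (rule field_le_epsilon)
    fix e :: real assume e: "0 < e"
    define n where "n = (norm (p - q))\<^sup>2"
    \<comment> \<open>Chosen so that \<open>t * (c * n) \<le> e\<close>; the summand 1 keeps the
      denominator positive when \<open>c * n = 0\<close>.\<close>
    define t where "t = e / (c * n + 1)"
    have n: "0 \<le> c * n" using c_nonneg by (simp add: n_def)
    then have t: "0 < t" using e by (simp add: t_def)
    have "p \<bullet> (t *\<^sub>R (p - q)) \<le> q \<bullet> (t *\<^sub>R (p - q)) + c * (norm (t *\<^sub>R (p - q)))\<^sup>2"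
      using p[of "x + t *\<^sub>R (p - q)"] q[of "x + t *\<^sub>R (p - q)"] by simp
    then have "t * ((p - q) \<bullet> (p - q)) \<le> c * (norm (t *\<^sub>R (p - q)))\<^sup>2"
      by (simp add: inner_diff_left algebra_simps)
    also have "\<dots> = t * (t * (c * n))"
      by (simp only: n_def norm_scaleR power_mult_distrib) (simp add: power2_eq_square)
    finally have "(p - q) \<bullet> (p - q) \<le> t * (c * n)" using t by simp
    also have "\<dots> \<le> e" using n e by (simp add: t_def divide_simps)
    finally show "(p - q) \<bullet> (p - q) \<le> 0 + e" by simp
  qed
  then have "(p - q) \<bullet> (p - q) = 0" by (intro antisym) auto
  then have "p = q" by simp
  with p q show ?thesis by blast
qed

lemma gderiv: "GDERIV \<phi> x :> grad \<phi> x"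
proof -
  obtain p where p: "\<And>y. \<phi> x + p \<bullet> (y - x) \<le> \<phi> y"
      "\<And>y. \<phi> y \<le> \<phi> x + p \<bullet> (y - x) + c * (norm (y - x))\<^sup>2"
    using ex_gradient by metis
  have "GDERIV \<phi> x :> p"
    unfolding gderiv_def
  proof (rule has_derivativeI)
    show "bounded_linear (\<lambda>h. h \<bullet> p)" by (rule bounded_linear_inner_left)
    have bound: "norm ((\<phi> y - \<phi> x - (y - x) \<bullet> p) /\<^sub>R norm (y - x)) \<le> c * norm (y - x)" if "y \<noteq> x" for y
    proof -
      have "\<bar>\<phi> y - \<phi> x - (y - x) \<bullet> p\<bar> \<le> c * (norm (y - x))\<^sup>2"
        using p(1)[of y] p(2)[of y] by (simp add: inner_commute)
      then show ?thesis using that by (simp add: field_simps power2_eq_square)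
    qed
    show "((\<lambda>y. (\<phi> y - \<phi> x - (y - x) \<bullet> p) /\<^sub>R norm (y - x)) \<longlongrightarrow> 0) (at x)"
    proof (rule Lim_null_comparison)
      show "\<forall>\<^sub>F y in at x. norm ((\<phi> y - \<phi> x - (y - x) \<bullet> p) /\<^sub>R norm (y - x)) \<le> c * norm (y - x)"
        using bound by (auto simp: eventually_at_filter)
      show "((\<lambda>y. c * norm (y - x)) \<longlongrightarrow> 0) (at x)"
        by (auto intro!: tendsto_eq_intros)
    qed
  qed
  then show ?thesis using grad_eqI by metis
qed

lemma gradient_inequality: "\<phi> x + grad \<phi> x \<bullet> (y - x) \<le> \<phi> y"
  using ex_gradient[of x] subgradient_eq_gderiv[OF gderiv, of x] by metis

lemma descent: "\<phi> y \<le> \<phi> x + grad \<phi> x \<bullet> (y - x) + c * (norm (y - x))\<^sup>2"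
  using ex_gradient[of x] subgradient_eq_gderiv[OF gderiv, of x] by metis

text \<open>The lower bound from \<open>y\<close> and the upper bound from \<open>x\<close> are
  compared at the auxiliary point \<open>y + h\<close>. Taking \<open>h\<close> of length
  \<open>r = norm (x - y)\<close> along the gradient difference isolates the norm of that
  difference, and squaring \<open>norm (y + h - x) \<le> 2 * r\<close> is the source of the factor
  4.\<close>

lemma grad_lipschitz: "norm (grad \<phi> x - grad \<phi> y) \<le> 4 * c * norm (x - y)"
proof (cases "grad \<phi> x = grad \<phi> y \<or> x = y")
  case True then show ?thesis using c_nonneg by auto
next
  case False
  define r where "r = norm (x - y)"
  define d where "d = grad \<phi> y - grad \<phi> x"
  have r: "0 < r" and d: "0 < norm d" using False by (auto simp: r_def d_def)
  define h where "h = (r / norm d) *\<^sub>R d"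
  have h: "norm h = r" using r d by (simp add: h_def)
  have "grad \<phi> y \<bullet> h \<le> grad \<phi> x \<bullet> h + c * (norm (y + h - x))\<^sup>2"
    using gradient_inequality[of y "y + h"] descent[of "y + h" x] gradient_inequality[of x y]
    by (simp add: inner_diff_right inner_add_right)
  then have "d \<bullet> h \<le> c * (norm (y + h - x))\<^sup>2"
    by (simp add: d_def inner_diff_left)
  also have "\<dots> \<le> c * (2 * r)\<^sup>2"
  proof (intro mult_left_mono power_mono c_nonneg)
    show "norm (y + h - x) \<le> 2 * r"
      using norm_triangle_ineq[of "y - x" h] h
      by (simp add: r_def norm_minus_commute algebra_simps)
  qed auto
  finally have "d \<bullet> h \<le> 4 * c * r * r" by (simp add: power2_eq_square)
  moreover have "d \<bullet> h = norm d * r"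
    using d by (simp add: h_def power2_norm_eq_inner[symmetric] power2_eq_square)
  ultimately have "norm d \<le> 4 * c * r" using r by simp
  then show ?thesis by (simp add: d_def r_def norm_minus_commute)
qed

lemma continuous_grad: "continuous_on A (grad \<phi>)"
proof -
  have "(4 * c)-lipschitz_on UNIV (grad \<phi>)"
    using grad_lipschitz c_nonneg by (auto simp: lipschitz_on_def dist_norm)
  then show ?thesis
    using lipschitz_on_continuous_on continuous_on_subset by blast
qed

lemma continuous: "continuous_on A \<phi>"
  by (metis continuous_at_imp_continuous_on gderiv gderiv_def has_derivative_continuous)

lemma closed_argmin: "closed (argmin \<phi>)"
proof -
  have "argmin \<phi> = (\<Inter>y. {x. \<phi> x \<le> \<phi> y})"
    by (auto simp: argmin_def is_arg_min_def not_less)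
  moreover have "closed {x. \<phi> x \<le> \<phi> y}" for y
    using continuous[of UNIV] by (intro closed_Collect_le continuous_on_const)
  ultimately show ?thesis by auto
qed

lemma convex_argmin: "convex (argmin \<phi>)"
proof (rule convexI)
  fix x y u v assume xy: "x \<in> argmin \<phi>" "y \<in> argmin \<phi>" and uv: "0 \<le> (u::real)" "0 \<le> v" "u + v = 1"
  have "\<phi> (u *\<^sub>R x + v *\<^sub>R y) \<le> \<phi> z" for z
  proof -
    have "\<phi> (u *\<^sub>R x + v *\<^sub>R y) \<le> u * \<phi> x + v * \<phi> y"
      using convex uv by (simp add: convex_on_def)
    also have "\<dots> \<le> u * \<phi> z + v * \<phi> z"
      using xy uv by (intro add_mono mult_left_mono) (auto simp: argmin_def is_arg_min_def not_less)
    also have "\<dots> = \<phi> z" using uv by (simp flip: distrib_right)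
    finally show ?thesis .
  qed
  then show "u *\<^sub>R x + v *\<^sub>R y \<in> argmin \<phi>"
    by (auto simp: argmin_def is_arg_min_def not_less)
qed

end

text \<open>First-order optimality: \<open>- grad f x\<close> is a subgradient of \<open>g\<close>
  at \<open>x\<close>. Between \<open>x\<close> and \<open>y\<close> convexity bounds the increase
  of \<open>g\<close> linearly in the step \<open>t\<close>, so minimality bounds the difference
  quotient of \<open>f\<close> from below, and \<open>t\<close> tends to 0 from the right.\<close>

lemma argmin_sum_subgradient:
  fixes f :: "'a::euclidean_space \<Rightarrow> real" and g :: "'a \<Rightarrow> ereal"
  assumes g: "proper_fun g" "convex_fun g"
    and f: "f differentiable (at x)" and x: "x \<in> argmin (\<lambda>x. ereal (f x) + g x)"
    and y: "g y = ereal r"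
  shows "\<exists>r0. g x = ereal r0 \<and> r0 - grad f x \<bullet> (y - x) \<le> r"
proof -
  have le: "ereal (f x) + g x \<le> ereal (f z) + g z" for z
    using x by (auto simp: argmin_def is_arg_min_def not_less)
  have "g x \<noteq> \<infinity>" using le[of y] y by (cases "g x") auto
  moreover have "g x \<noteq> -\<infinity>" using g(1) by (simp add: proper_fun_def)
  ultimately obtain r0 where r0: "g x = ereal r0" by (cases "g x") auto
  define h where "h t = f (x + t *\<^sub>R (y - x))" for t :: real
  have "((\<lambda>t. h t) has_derivative (\<lambda>t. (t *\<^sub>R (y - x)) \<bullet> grad f x)) (at 0)"
    unfolding h_def
  proof (rule has_derivative_compose[of "\<lambda>t. x + t *\<^sub>R (y - x)" "\<lambda>t. t *\<^sub>R (y - x)"])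
    show "((\<lambda>t. x + t *\<^sub>R (y - x)) has_derivative (\<lambda>t. t *\<^sub>R (y - x))) (at 0)"
      by (auto intro!: derivative_eq_intros)
    show "(f has_derivative (\<lambda>h. h \<bullet> grad f x)) (at (x + 0 *\<^sub>R (y - x)))"
      using GDERIV_grad[OF f] by (simp add: gderiv_def)
  qed
  then have "(h has_real_derivative ((y - x) \<bullet> grad f x)) (at 0)"
    by (simp add: has_field_derivative_def mult_commute_abs)
  then have "((\<lambda>t. (h t - h 0) / t) \<longlongrightarrow> (y - x) \<bullet> grad f x) (at_right 0)"
    by (simp add: has_field_derivative_iff filterlim_at_split)
  moreover have "\<forall>\<^sub>F t in at_right 0. r0 - r \<le> (h t - h 0) / t"
  proof -
    have "r0 - r \<le> (h t - h 0) / t" if t: "0 < t" "t < 1" for t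
    proof -
      have "x + t *\<^sub>R (y - x) = (1 - t) *\<^sub>R x + t *\<^sub>R y" by (simp add: algebra_simps)
      then have "g (x + t *\<^sub>R (y - x)) \<le> ereal (1 - t) * g x + ereal t * g y"
        using g(2) t unfolding convex_fun_def by (metis add.commute diff_add_cancel diff_ge_0_iff_ge less_imp_le)
      then have "g (x + t *\<^sub>R (y - x)) \<le> ereal ((1 - t) * r0 + t * r)"
        by (simp add: r0 y)
      then have "ereal (f x) + g x \<le> ereal (f (x + t *\<^sub>R (y - x))) + ereal ((1 - t) * r0 + t * r)"
        using le[of "x + t *\<^sub>R (y - x)"] by (meson add_left_mono order_trans)
      then have "t * (r0 - r) \<le> h t - h 0" by (simp add: r0 h_def algebra_simps)
      then show ?thesis using t by (simp add: pos_le_divide_eq mult.commute)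
    qed
    then show ?thesis unfolding eventually_at_right_field by (metis zero_less_one)
  qed
  ultimately have "r0 - r \<le> (y - x) \<bullet> grad f x"
    by (intro tendsto_lowerbound[where F = "at_right (0::real)"]) auto
  then show ?thesis using r0 by (auto simp: inner_commute)
qed

section \<open>Moreau envelopes: finiteness, convexity and the paraboloid bound\<close>

locale finite_moreau_env =
  fixes g :: "'a::euclidean_space \<Rightarrow> ereal" and \<theta> r0 :: real and p x0 :: 'a
  assumes proper: "proper_fun g" and convex_g: "convex_fun g" and \<theta>_pos: "0 < \<theta>"
    and minorant: "\<And>y r. g y = ereal r \<Longrightarrow> r0 + p \<bullet> (y - x0) \<le> r"
begin

text \<open>The finite part of the graph of \<open>g\<close>; it lets the arguments about the
  infimum run over real pairs rather than extended values.\<close>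

definition attained :: "('a \<times> real) set" where
  "attained = {(z, r). g z = ereal r}"

lemma attained_nonempty: "\<exists>z r. (z, r) \<in> attained"
proof -
  obtain z where "g z \<noteq> \<infinity>" "g z \<noteq> -\<infinity>" using proper by (auto simp: proper_fun_def)
  then show ?thesis by (cases "g z") (auto simp: attained_def)
qed

text \<open>Young's inequality, by completing the square in
  \<open>\<theta> *\<^sub>R p - (x - z)\<close>: the linear term of the minorant is absorbed by the
  quadratic term of the envelope.\<close>

lemma quadratic_lower_bound:
  assumes "(z, r) \<in> attained"
  shows "r0 + p \<bullet> (x - x0) - \<theta> / 2 * (norm p)\<^sup>2 \<le> r + 1 / (2 * \<theta>) * (norm (x - z))\<^sup>2"
proof -
  have "0 \<le> 1 / (2 * \<theta>) * (norm (\<theta> *\<^sub>R p - (x - z)))\<^sup>2" using \<theta>_pos by simp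
  also have "\<dots> = \<theta> / 2 * (norm p)\<^sup>2 - p \<bullet> (x - z) + 1 / (2 * \<theta>) * (norm (x - z))\<^sup>2"
  proof -
    define d where "d = x - z"
    have "(norm (\<theta> *\<^sub>R p - d))\<^sup>2 = \<theta> * (\<theta> * (norm p)\<^sup>2) - 2 * \<theta> * (p \<bullet> d) + (norm d)\<^sup>2"
      by (simp add: power2_norm_eq_inner inner_diff inner_commute[of d p] algebra_simps)
    then show ?thesis using \<theta>_pos unfolding d_def[symmetric] by (simp add: field_simps)
  qed
  finally show ?thesis
    using minorant[of z r] assms by (simp add: attained_def inner_diff_right)
qed

text \<open>A pair in \<open>attained\<close> bounds the infimum above and the affine minorant
  bounds it below, so the conversion \<open>real_of_ereal\<close> in the definition does not hide an
  infinite value.\<close>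

lemma moreau_env_INF:
  "ereal (moreau_env g \<theta> x) = (INF y. g y + ereal (1 / (2 * \<theta>) * (norm (x - y))\<^sup>2))"
proof -
  let ?I = "INF y. g y + ereal (1 / (2 * \<theta>) * (norm (x - y))\<^sup>2)"
  obtain z r where zr: "(z, r) \<in> attained" using attained_nonempty by blast
  have "?I \<le> g z + ereal (1 / (2 * \<theta>) * (norm (x - z))\<^sup>2)" by (rule INF_lower) simp
  then have "?I \<noteq> \<infinity>" using zr by (auto simp: attained_def)
  moreover have "ereal (r0 + p \<bullet> (x - x0) - \<theta> / 2 * (norm p)\<^sup>2) \<le> ?I"
  proof (rule INF_greatest)
    fix y
    show "ereal (r0 + p \<bullet> (x - x0) - \<theta> / 2 * (norm p)\<^sup>2)
        \<le> g y + ereal (1 / (2 * \<theta>) * (norm (x - y))\<^sup>2)"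
      using quadratic_lower_bound[of y _ x] proper
      by (cases "g y") (auto simp: attained_def proper_fun_def)
  qed
  ultimately show ?thesis
    unfolding moreau_env_def by (cases ?I) auto
qed

lemma moreau_env_le:
  assumes "(z, r) \<in> attained"
  shows "moreau_env g \<theta> x \<le> r + 1 / (2 * \<theta>) * (norm (x - z))\<^sup>2"
proof -
  have "ereal (moreau_env g \<theta> x) \<le> g z + ereal (1 / (2 * \<theta>) * (norm (x - z))\<^sup>2)"
    unfolding moreau_env_INF by (rule INF_lower) simp
  then show ?thesis using assms by (simp add: attained_def)
qed

lemma moreau_env_greatest:
  assumes "\<And>z r. (z, r) \<in> attained \<Longrightarrow> k \<le> r + 1 / (2 * \<theta>) * (norm (x - z))\<^sup>2"
  shows "k \<le> moreau_env g \<theta> x"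
proof -
  have "ereal k \<le> (INF y. g y + ereal (1 / (2 * \<theta>) * (norm (x - y))\<^sup>2))"
  proof (rule INF_greatest)
    fix y
    show "ereal k \<le> g y + ereal (1 / (2 * \<theta>) * (norm (x - y))\<^sup>2)"
      using assms[of y] proper by (cases "g y") (auto simp: attained_def proper_fun_def)
  qed
  then show ?thesis by (metis moreau_env_INF ereal_less_eq(3))
qed

text \<open>Near-minimizers with slack \<open>e\<close> take the role of the proximal point.\<close>

lemma moreau_env_approx:
  assumes "0 < e"
  shows "\<exists>z r. (z, r) \<in> attained \<and> r + 1 / (2 * \<theta>) * (norm (x - z))\<^sup>2 < moreau_env g \<theta> x + e"
  using moreau_env_greatest[of "moreau_env g \<theta> x + e" x] assms by force

text \<open>The function under the infimum is jointly convex in the base point and the competitor.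
  Hence the convex combination of near-minimizers for two base points is a competitor at the
  combined base point.\<close>

lemma convex_on_moreau_env: "convex_on UNIV (moreau_env g \<theta>)"
proof (rule convex_onI)
  fix t :: real and x y :: 'a assume t: "0 < t" "t < 1"
  define e where "e = moreau_env g \<theta>"
  show "e ((1 - t) *\<^sub>R x + t *\<^sub>R y) \<le> (1 - t) * e x + t * e y"
  proof (rule field_le_epsilon)
    fix k :: real assume "0 < k"
    obtain z r where z: "(z, r) \<in> attained" "r + 1 / (2 * \<theta>) * (norm (x - z))\<^sup>2 < e x + k"
      using moreau_env_approx[OF \<open>0 < k\<close>] e_def by blast
    obtain z' r' where z': "(z', r') \<in> attained" "r' + 1 / (2 * \<theta>) * (norm (y - z'))\<^sup>2 < e y + k"
      using moreau_env_approx[OF \<open>0 < k\<close>] e_def by blast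
    let ?z = "(1 - t) *\<^sub>R z + t *\<^sub>R z'"
    have gz: "g z = ereal r" "g z' = ereal r'" using z(1) z'(1) by (auto simp: attained_def)
    have "g ?z \<le> ereal (1 - t) * g z + ereal t * g z'"
      using convex_g t unfolding convex_fun_def
      by (metis add.commute diff_add_cancel diff_ge_0_iff_ge less_imp_le)
    then have "g ?z \<le> ereal ((1 - t) * r + t * r')" by (simp add: gz)
    moreover have "g ?z \<noteq> -\<infinity>" using proper by (simp add: proper_fun_def)
    ultimately obtain r'' where r'': "(?z, r'') \<in> attained" "r'' \<le> (1 - t) * r + t * r'"
      by (cases "g ?z") (auto simp: attained_def)
    define u v where "u = x - z" and "v = y - z'"
    have "(norm ((1 - t) *\<^sub>R u + t *\<^sub>R v))\<^sup>2
        = (1 - t) * (norm u)\<^sup>2 + t * (norm v)\<^sup>2 - t * (1 - t) * (norm (u - v))\<^sup>2"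
      by (simp add: power2_norm_eq_inner inner_diff inner_add inner_commute algebra_simps)
    also have "\<dots> \<le> (1 - t) * (norm u)\<^sup>2 + t * (norm v)\<^sup>2" using t by simp
    finally have uv: "1 / (2 * \<theta>) * (norm ((1 - t) *\<^sub>R u + t *\<^sub>R v))\<^sup>2
        \<le> 1 / (2 * \<theta>) * ((1 - t) * (norm u)\<^sup>2 + t * (norm v)\<^sup>2)"
      using \<theta>_pos by (intro mult_left_mono) auto
    have "e ((1 - t) *\<^sub>R x + t *\<^sub>R y) \<le> r'' + 1 / (2 * \<theta>) * (norm ((1 - t) *\<^sub>R x + t *\<^sub>R y - ?z))\<^sup>2"
      unfolding e_def by (rule moreau_env_le[OF r''(1)])
    also have "(1 - t) *\<^sub>R x + t *\<^sub>R y - ?z = (1 - t) *\<^sub>R u + t *\<^sub>R v"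
      by (simp add: u_def v_def algebra_simps)
    also have "r'' + 1 / (2 * \<theta>) * (norm ((1 - t) *\<^sub>R u + t *\<^sub>R v))\<^sup>2
        \<le> ((1 - t) * r + t * r') + 1 / (2 * \<theta>) * ((1 - t) * (norm u)\<^sup>2 + t * (norm v)\<^sup>2)"
      using r''(2) uv by (rule add_mono)
    also have "\<dots> = (1 - t) * (r + 1 / (2 * \<theta>) * (norm u)\<^sup>2) + t * (r' + 1 / (2 * \<theta>) * (norm v)\<^sup>2)"
      using \<theta>_pos by (simp add: field_simps)
    also have "\<dots> \<le> (1 - t) * (e x + k) + t * (e y + k)"
      unfolding u_def v_def
      using less_imp_le[OF z(2)] less_imp_le[OF z'(2)] t by (intro add_mono[OF mult_left_mono mult_left_mono]) auto
    also have "\<dots> = (1 - t) * e x + t * e y + k" by (simp add: algebra_simps)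
    finally show "e ((1 - t) *\<^sub>R x + t *\<^sub>R y) \<le> (1 - t) * e x + t * e y + k" .
  qed
qed auto

text \<open>The envelope minus \<open>\<parallel>x\<parallel>\<^sup>2 / (2 \<theta>)\<close> is an infimum of affine functions, hence concave.\<close>

lemma convex_on_quadratic_minus_moreau_env:
  "convex_on UNIV (\<lambda>x. 1 / (2 * \<theta>) * (norm x)\<^sup>2 - moreau_env g \<theta> x)"
proof (rule convex_onI)
  fix t :: real and x y :: 'a assume t: "0 < t" "t < 1"
  define e where "e = moreau_env g \<theta>"
  define a where "a = 1 / (2 * \<theta>)"
  let ?w = "(1 - t) *\<^sub>R x + t *\<^sub>R y"
  have "(1 - t) * (e x - a * (norm x)\<^sup>2) + t * (e y - a * (norm y)\<^sup>2) + a * (norm ?w)\<^sup>2 \<le> e ?w"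
    unfolding e_def
  proof (rule moreau_env_greatest, fold e_def a_def)
    fix z r assume zr: "(z, r) \<in> attained"
    have "(1 - t) * (e x - a * (norm x)\<^sup>2) + t * (e y - a * (norm y)\<^sup>2)
      \<le> (1 - t) * (r + a * (norm (x - z))\<^sup>2 - a * (norm x)\<^sup>2) + t * (r + a * (norm (y - z))\<^sup>2 - a * (norm y)\<^sup>2)"
      using moreau_env_le[OF zr, of x] moreau_env_le[OF zr, of y] t
      by (intro add_mono mult_left_mono) (auto simp: e_def a_def)
    also have "\<dots> = r + a * (norm (?w - z))\<^sup>2 - a * (norm ?w)\<^sup>2"
      by (simp add: power2_norm_eq_inner inner_diff inner_add inner_commute algebra_simps)
    finally show "(1 - t) * (e x - a * (norm x)\<^sup>2) + t * (e y - a * (norm y)\<^sup>2) + a * (norm ?w)\<^sup>2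
      \<le> r + a * (norm (?w - z))\<^sup>2" by simp
  qed
  then show "1 / (2 * \<theta>) * (norm ?w)\<^sup>2 - moreau_env g \<theta> ?w
    \<le> (1 - t) * (1 / (2 * \<theta>) * (norm x)\<^sup>2 - moreau_env g \<theta> x)
      + t * (1 / (2 * \<theta>) * (norm y)\<^sup>2 - moreau_env g \<theta> y)"
    unfolding e_def a_def by (simp add: algebra_simps)
qed auto

text \<open>A subgradient at \<open>x\<close> of the convex function from the preceding lemma, moved
  to the other side, becomes an upper bound for the envelope; expanding
  \<open>a * (norm y)\<^sup>2\<close> about \<open>x\<close> leaves exactly the curvature
  \<open>a = 1 / (2 * \<theta>)\<close>.\<close>

lemma moreau_env_upper:
  "\<exists>q. \<forall>y. moreau_env g \<theta> y \<le> moreau_env g \<theta> x + q \<bullet> (y - x) + 1 / (2 * \<theta>) * (norm (y - x))\<^sup>2"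
proof -
  define a where "a = 1 / (2 * \<theta>)"
  obtain p' where p': "\<And>y. a * (norm x)\<^sup>2 - moreau_env g \<theta> x + p' \<bullet> (y - x)
      \<le> a * (norm y)\<^sup>2 - moreau_env g \<theta> y"
    using convex_on_subgradient[OF convex_on_quadratic_minus_moreau_env] unfolding a_def by metis
  have "a * (norm y)\<^sup>2 - a * (norm x)\<^sup>2 = (2 * a) *\<^sub>R x \<bullet> (y - x) + a * (norm (y - x))\<^sup>2" for y
    by (simp add: power2_norm_eq_inner inner_diff inner_commute algebra_simps)
  then have "moreau_env g \<theta> y
      \<le> moreau_env g \<theta> x + ((2 * a) *\<^sub>R x - p') \<bullet> (y - x) + a * (norm (y - x))\<^sup>2" for y
    using p'[of y] by (simp add: inner_diff_left) (smt (verit))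
  then show ?thesis unfolding a_def by blast
qed

end

text \<open>A minimizer \<open>x0\<close> of the sum supplies the affine minorant of
  \<open>g\<close>, with slope \<open>- grad f x0\<close>, that makes the envelope finite. The
  curvatures then add up: \<open>L\<close> from \<open>f\<close> and
  \<open>1 / (2 * \<theta>)\<close> from the envelope.\<close>

lemma smoothed_objective_quadratically_bounded_convex:
  fixes f :: "'a::euclidean_space \<Rightarrow> real"
  assumes f: "convex_on UNIV f" "\<And>x. f differentiable (at x)" "L-lipschitz_on UNIV (grad f)"
    and g: "proper_fun g" "convex_fun g" "argmin (\<lambda>x. ereal (f x) + g x) \<noteq> {}"
    and \<theta>: "0 < \<theta>"
  shows "quadratically_bounded_convex (smoothed_objective f g \<theta>) (L + 1 / (2 * \<theta>))"
proof -
  obtain x0 where x0: "x0 \<in> argmin (\<lambda>x. ereal (f x) + g x)" using g(3) by blast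
  obtain y r where "g y = ereal r"
  proof -
    obtain z where "g z \<noteq> \<infinity>" "g z \<noteq> -\<infinity>" using g(1) by (auto simp: proper_fun_def)
    then show ?thesis using that by (cases "g z") auto
  qed
  then obtain r0 where r0: "g x0 = ereal r0"
    using argmin_sum_subgradient[OF g(1,2) f(2) x0] by blast
  interpret finite_moreau_env g \<theta> r0 "- grad f x0" x0
  proof
    fix y r assume "g y = ereal r"
    then show "r0 + - grad f x0 \<bullet> (y - x0) \<le> r"
      using argmin_sum_subgradient[OF g(1,2) f(2) x0, of y r] r0 by auto
  qed (use g \<theta> in auto)
  have L: "0 \<le> L" using f(3) by (rule lipschitz_on_nonneg)
  have sub: "f x + grad f x \<bullet> (y - x) \<le> f y" for x y
    using convex_on_subgradient[OF f(1), of x] subgradient_eq_gderiv[OF GDERIV_grad[OF f(2)], of x]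
    by metis
  show ?thesis
  proof
    show "convex_on UNIV (smoothed_objective f g \<theta>)"
      unfolding smoothed_objective_def using f(1) convex_on_moreau_env by (rule convex_on_add)
    show "0 \<le> L + 1 / (2 * \<theta>)" using L \<theta> by simp
    fix x
    obtain q where q: "\<And>y. moreau_env g \<theta> y
        \<le> moreau_env g \<theta> x + q \<bullet> (y - x) + 1 / (2 * \<theta>) * (norm (y - x))\<^sup>2"
      using moreau_env_upper by metis
    \<comment> \<open>Convexity at \<open>y\<close> followed by Cauchy-Schwarz gives the constant
      \<open>L\<close>. Integrating the gradient along the segment would give half of it, but any
      finite curvature serves here.\<close>
    have "f y \<le> f x + grad f x \<bullet> (y - x) + L * (norm (y - x))\<^sup>2" for y
    proof -
      have "f y \<le> f x + grad f y \<bullet> (y - x)" using sub[of y x] by (simp add: inner_diff_right)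
      moreover have "(grad f y - grad f x) \<bullet> (y - x) \<le> norm (grad f y - grad f x) * norm (y - x)"
        by (rule norm_cauchy_schwarz)
      moreover have "\<dots> \<le> (L * norm (y - x)) * norm (y - x)"
        using lipschitz_onD[OF f(3), of y x] by (intro mult_right_mono) (auto simp: dist_norm)
      ultimately show ?thesis by (simp add: inner_diff_left power2_eq_square)
    qed
    then have "smoothed_objective f g \<theta> y \<le> smoothed_objective f g \<theta> x + (grad f x + q) \<bullet> (y - x)
        + (L + 1 / (2 * \<theta>)) * (norm (y - x))\<^sup>2" for y
      using add_mono[OF _ q, of "f y" _ y] unfolding smoothed_objective_def
      by (simp add: inner_add_left distrib_right)
        (smt (verit, best))
    then show "\<exists>q. \<forall>y. smoothed_objective f g \<theta> y \<le> smoothed_objective f g \<theta> x + q \<bullet> (y - x)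
        + (L + 1 / (2 * \<theta>)) * (norm (y - x))\<^sup>2"
      by blast
  qed
qed

section \<open>Square-integrable functions\<close>

lemma norm_diff_sq_le:
  fixes a b :: "'a::real_normed_vector"
  shows "(norm (a - b))\<^sup>2 \<le> 2 * (norm a)\<^sup>2 + 2 * (norm b)\<^sup>2"
proof -
  have "(norm (a - b))\<^sup>2 \<le> (norm a + norm b)\<^sup>2"
    by (intro power_mono norm_triangle_ineq4) simp
  also have "\<dots> \<le> 2 * (norm a)\<^sup>2 + 2 * (norm b)\<^sup>2"
    using sum_squares_bound[of "norm a" "norm b"] by (simp add: power2_sum)
  finally show ?thesis .
qed

abbreviation sq_integral :: "'a measure \<Rightarrow> ('a \<Rightarrow> 'b::real_normed_vector) \<Rightarrow> ennreal" where
  "sq_integral N f \<equiv> (\<integral>\<^sup>+x. ennreal ((norm (f x))\<^sup>2) \<partial>N)"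

text \<open>A weighted Young inequality under the integral. The factor in front of \<open>g\<close>
  tends to 1 with \<open>e\<close>, so constants remain sharp when they are passed through L2
  approximations.\<close>

lemma nn_integral_norm_sq_perturb:
  fixes f g :: "'a \<Rightarrow> 'b::{second_countable_topology, real_inner}"
  assumes [measurable]: "f \<in> borel_measurable N" "g \<in> borel_measurable N" and e: "0 < (e::real)"
  shows "sq_integral N f
    \<le> ennreal (1 + e) * sq_integral N g
      + ennreal (1 + 1 / e) * sq_integral N (\<lambda>x. f x - g x)"
proof -
  have *: "(norm (f x))\<^sup>2 \<le> (1 + e) * (norm (g x))\<^sup>2 + (1 + 1 / e) * (norm (f x - g x))\<^sup>2" for x
  proof -
    define u v where "u = g x" and "v = f x - g x"
    have "0 \<le> (norm (e *\<^sub>R u - v))\<^sup>2 / e" using e by simp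
    also have "(norm (e *\<^sub>R u - v))\<^sup>2 / e = e * (norm u)\<^sup>2 - 2 * (u \<bullet> v) + (norm v)\<^sup>2 / e"
      using e by (simp add: power2_norm_eq_inner inner_diff inner_commute field_simps)
    finally have "2 * (u \<bullet> v) \<le> e * (norm u)\<^sup>2 + (norm v)\<^sup>2 / e" by simp
    moreover have "(norm (u + v))\<^sup>2 = (norm u)\<^sup>2 + 2 * (u \<bullet> v) + (norm v)\<^sup>2"
      by (simp add: power2_norm_eq_inner inner_add inner_commute)
    ultimately have "(norm (u + v))\<^sup>2 \<le> (1 + e) * (norm u)\<^sup>2 + (1 + 1 / e) * (norm v)\<^sup>2"
      by (simp add: distrib_right)
    then show ?thesis by (simp add: u_def v_def)
  qed
  have "sq_integral N f
    \<le> (\<integral>\<^sup>+x. ennreal (1 + e) * ennreal ((norm (g x))\<^sup>2)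
        + ennreal (1 + 1 / e) * ennreal ((norm (f x - g x))\<^sup>2) \<partial>N)"
  proof (rule nn_integral_mono)
    fix x
    have "ennreal ((norm (f x))\<^sup>2) \<le> ennreal ((1 + e) * (norm (g x))\<^sup>2 + (1 + 1 / e) * (norm (f x - g x))\<^sup>2)"
      by (rule ennreal_leI[OF *])
    also have "\<dots> = ennreal ((1 + e) * (norm (g x))\<^sup>2) + ennreal ((1 + 1 / e) * (norm (f x - g x))\<^sup>2)"
      using e by (intro ennreal_plus) auto
    also have "\<dots> = ennreal (1 + e) * ennreal ((norm (g x))\<^sup>2)
        + ennreal (1 + 1 / e) * ennreal ((norm (f x - g x))\<^sup>2)"
      using e by (intro arg_cong2[where f = "(+)"] ennreal_mult) auto
    finally show "ennreal ((norm (f x))\<^sup>2) \<le> ennreal (1 + e) * ennreal ((norm (g x))\<^sup>2)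
        + ennreal (1 + 1 / e) * ennreal ((norm (f x - g x))\<^sup>2)" .
  qed
  also have "\<dots> = ennreal (1 + e) * sq_integral N g
      + ennreal (1 + 1 / e) * sq_integral N (\<lambda>x. f x - g x)"
    by (subst nn_integral_add) (simp_all add: nn_integral_cmult del: ennreal_plus)
  finally show ?thesis .
qed

lemma nn_integral_norm_sq_triangle:
  fixes f g h :: "'a \<Rightarrow> 'b::{second_countable_topology, real_inner}"
  assumes [measurable]: "f \<in> borel_measurable N" "g \<in> borel_measurable N" "h \<in> borel_measurable N"
  shows "sq_integral N (\<lambda>x. f x - h x)
    \<le> 2 * sq_integral N (\<lambda>x. f x - g x)
      + 2 * sq_integral N (\<lambda>x. g x - h x)"
  using nn_integral_norm_sq_perturb[of "\<lambda>x. f x - h x" N "\<lambda>x. f x - g x" 1] by simp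

lemma integrable_inner_of_square_integrable:
  fixes f g :: "'a \<Rightarrow> 'b::euclidean_space"
  assumes [measurable]: "f \<in> borel_measurable N" "g \<in> borel_measurable N"
    and "integrable N (\<lambda>x. (norm (f x))\<^sup>2)" "integrable N (\<lambda>x. (norm (g x))\<^sup>2)"
  shows "integrable N (\<lambda>x. f x \<bullet> g x)"
proof (rule Bochner_Integration.integrable_bound)
  show "integrable N (\<lambda>x. (norm (f x))\<^sup>2 + (norm (g x))\<^sup>2)" using assms by simp
  have "\<bar>f x \<bullet> g x\<bar> \<le> (norm (f x))\<^sup>2 + (norm (g x))\<^sup>2" for x
  proof -
    have "\<bar>f x \<bullet> g x\<bar> \<le> norm (f x) * norm (g x)" by (rule Cauchy_Schwarz_ineq2)
    also have "\<dots> \<le> 2 * norm (f x) * norm (g x)" by simp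
    also have "\<dots> \<le> (norm (f x))\<^sup>2 + (norm (g x))\<^sup>2" by (rule sum_squares_bound)
    finally show ?thesis .
  qed
  then show "AE x in N. norm (f x \<bullet> g x) \<le> norm ((norm (f x))\<^sup>2 + (norm (g x))\<^sup>2)" by simp
qed simp

section \<open>It\^o integrals\<close>

context filtered_prob_space
begin

lemma space_F: "0 \<le> t \<Longrightarrow> space (F t) = space M"
  using filtration.space_F[OF filtration_F, of t] by simp

lemma sets_F_mono: "0 \<le> s \<Longrightarrow> s \<le> t \<Longrightarrow> sets (F s) \<subseteq> sets (F t)"
  using filtration.sets_F_mono[OF filtration_F, of s t] by (simp add: max_def)

lemma subalgebra_F: "0 \<le> t \<Longrightarrow> subalgebra M (F t)"
  using space_F sets_F_subset by (simp add: subalgebra_def)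

lemma measurable_F_mono:
  "f \<in> measurable (F s) N \<Longrightarrow> 0 \<le> s \<Longrightarrow> s \<le> t \<Longrightarrow> f \<in> measurable (F t) N"
  by (rule measurable_from_subalg[of "F t" "F s"]) (auto simp: subalgebra_def space_F sets_F_mono)

lemma measurable_F_M: "f \<in> measurable (F s) N \<Longrightarrow> 0 \<le> s \<Longrightarrow> f \<in> measurable M N"
  by (rule measurable_from_subalg[OF subalgebra_F])

lemma progressive_jointly_measurable:
  fixes H :: "real \<Rightarrow> 'a \<Rightarrow> 'b::{second_countable_topology, real_normed_vector}"
  assumes "progressive_on F {0..} H" "0 \<le> t"
  shows "(\<lambda>(\<omega>, s). indicator {0..t} s *\<^sub>R H s \<omega>) \<in> borel_measurable (M \<Otimes>\<^sub>M lborel)"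
proof -
  \<comment> \<open>Clamping the time to \<open>{0..t}\<close> transports measurability from the
    restricted space to the whole line; where clamping changes the time, the indicator is
    zero.\<close>
  define cl where "cl s = max 0 (min t s)" for s :: real
  have H: "(\<lambda>(s, \<omega>). H s \<omega>) \<in> borel_measurable (restrict_space borel {0..t} \<Otimes>\<^sub>M F t)"
    using assms by (auto simp: progressive_on_def)
  have [measurable]: "(\<lambda>\<omega>. \<omega>) \<in> M \<rightarrow>\<^sub>M F t"
    using subalgebra_F[OF assms(2)] by (intro measurable_ident_sets measurable_from_subalg[of M "F t"]) auto
  have [measurable]: "cl \<in> lborel \<rightarrow>\<^sub>M restrict_space borel {0..t}"
    using assms(2) unfolding cl_def by (intro measurable_restrict_space2) auto
  have "(\<lambda>z. (cl (snd z), fst z)) \<in> M \<Otimes>\<^sub>M lborel \<rightarrow>\<^sub>M restrict_space borel {0..t} \<Otimes>\<^sub>M F t"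
    by measurable
  from measurable_compose[OF this H]
  have [measurable]: "(\<lambda>z. H (cl (snd z)) (fst z)) \<in> borel_measurable (M \<Otimes>\<^sub>M lborel)" by simp
  have "(\<lambda>(\<omega>, s). indicator {0..t} s *\<^sub>R H s \<omega>)
      = (\<lambda>z. indicator {0..t} (snd z) *\<^sub>R H (cl (snd z)) (fst z))"
    by (auto simp: cl_def fun_eq_iff split: split_indicator)
  also have "\<dots> \<in> borel_measurable (M \<Otimes>\<^sub>M lborel)" by measurable
  finally show ?thesis .
qed

end

section \<open>Brownian increments weighted by the past\<close>

context brownian_motion
begin

lemma W_measurable: "0 \<le> s \<Longrightarrow> s \<le> t \<Longrightarrow> W s \<in> borel_measurable (F t)"
  using adapted_W measurable_F_mono by blast

lemma W_measurable_M [measurable]: "0 \<le> s \<Longrightarrow> W s \<in> borel_measurable M"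
  using adapted_W measurable_F_M by blast

text \<open>With \<phi> a coordinate or a product of two coordinates, this is the independence
  behind the first and second moments of increments weighted by the past.\<close>

lemma indep_var_increment:
  fixes \<eta> :: "'a \<Rightarrow> real" and \<phi> :: "real ^ 'm \<Rightarrow> real"
  assumes s: "0 \<le> s" "s < t" and \<eta>: "\<eta> \<in> borel_measurable (F s)" and [measurable]: "\<phi> \<in> borel_measurable borel"
  shows "indep_var borel \<eta> borel (\<lambda>\<omega>. \<phi> (W t \<omega> - W s \<omega>))"
proof -
  let ?D = "\<lambda>\<omega>. W t \<omega> - W s \<omega>"
  have [measurable]: "W t \<in> borel_measurable M" "W s \<in> borel_measurable M" using s by auto
  have \<eta>M: "\<eta> \<in> borel_measurable M" using \<eta> s(1) by (rule measurable_F_M)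
  have \<phi>M: "(\<lambda>\<omega>. \<phi> (?D \<omega>)) \<in> borel_measurable M" by measurable
  have 1: "sigma_sets (space M) {\<eta> -` A \<inter> space M | A. A \<in> sets borel} \<subseteq> sets (F s)"
    using \<eta> s space_F[of s] sets.sigma_sets_subset[of "{\<eta> -` A \<inter> space M | A. A \<in> sets borel}" "F s"]
    by (auto simp: measurable_def)
  have 2: "sigma_sets (space M) {(\<lambda>\<omega>. \<phi> (?D \<omega>)) -` A \<inter> space M | A. A \<in> sets borel}
      \<subseteq> {?D -` A \<inter> space M | A. A \<in> sets borel}"
  proof -
    have V: "{?D -` A \<inter> space M | A. A \<in> sets borel} = sets (vimage_algebra (space M) ?D borel)"
      by (rule sets_vimage_algebra2[symmetric]) auto
    have "(\<lambda>\<omega>. \<phi> (?D \<omega>)) -` A \<inter> space M \<in> {?D -` A \<inter> space M | A. A \<in> sets borel}"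
      if "A \<in> sets borel" for A
      using measurable_sets[OF \<open>\<phi> \<in> borel_measurable borel\<close> that] by (auto simp: vimage_def)
    then have "{(\<lambda>\<omega>. \<phi> (?D \<omega>)) -` A \<inter> space M | A. A \<in> sets borel}
        \<subseteq> sets (vimage_algebra (space M) ?D borel)"
      unfolding V by blast
    from sets.sigma_sets_subset[OF this] show ?thesis unfolding V by simp
  qed
  have "indep_set (sets (F s)) {?D -` A \<inter> space M | A. A \<in> sets borel}"
    using s by (rule indep_increment)
  then show ?thesis
    unfolding indep_var_eq indep_sets2_eq
    using \<eta>M \<phi>M 1 2 by (meson order_trans subsetD)
qed

lemma increment_moments:
  assumes "0 \<le> s" "s < t"
  shows "integrable M (\<lambda>\<omega>. (W t \<omega> - W s \<omega>) $ k)"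
    and "expectation (\<lambda>\<omega>. (W t \<omega> - W s \<omega>) $ k) = 0"
    and "integrable M (\<lambda>\<omega>. (W t \<omega> - W s \<omega>) $ k * (W t \<omega> - W s \<omega>) $ l)"
    and "expectation (\<lambda>\<omega>. (W t \<omega> - W s \<omega>) $ k * (W t \<omega> - W s \<omega>) $ l) = (if k = l then t - s else 0)"
proof -
  define D where "D k \<omega> = (W t \<omega> - W s \<omega>) $ k" for k \<omega>
  have \<sigma>: "0 < sqrt (t - s)" using assms by simp
  have dist: "distributed M lborel (D k) (normal_density 0 (sqrt (t - s)))" for k
    unfolding D_def using assms by (rule normal_increment)
  have i1: "integrable M (D k)" for k
    using integrable_normal_moment[OF \<sigma>, of 0 1] distributed_integrable[OF dist, of "\<lambda>x. x"] by simp
  have i2: "integrable M (\<lambda>\<omega>. (D k \<omega>)\<^sup>2)" for k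
    using integrable_normal_moment[OF \<sigma>, of 0 2] distributed_integrable[OF dist, of "\<lambda>x. x\<^sup>2"] by simp
  have e1: "expectation (D k) = 0" for k
    using normal_distributed_expectation[OF \<sigma> dist] .
  have e2: "expectation (\<lambda>\<omega>. (D k \<omega>)\<^sup>2) = t - s" for k
    using normal_distributed_variance[OF \<sigma> dist, of k] assms by (simp add: e1)
  have ind: "indep_var borel (D k) borel (D l)" if "k \<noteq> l" for k l
  proof -
    have "indep_vars (\<lambda>_. borel) D UNIV"
      using indep_components[OF assms] unfolding D_def .
    then have "indep_var (PiM {k} (\<lambda>_. borel)) (\<lambda>\<omega>. restrict (\<lambda>i. D i \<omega>) {k})
        (PiM {l} (\<lambda>_. borel)) (\<lambda>\<omega>. restrict (\<lambda>i. D i \<omega>) {l})"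
      by (rule indep_var_restrict) (use that in auto)
    then have "indep_var borel ((\<lambda>f. f k) \<circ> (\<lambda>\<omega>. restrict (\<lambda>i. D i \<omega>) {k}))
        borel ((\<lambda>f. f l) \<circ> (\<lambda>\<omega>. restrict (\<lambda>i. D i \<omega>) {l}))"
      by (rule indep_var_compose) (intro measurable_component_singleton, simp)+
    then show ?thesis by (simp add: comp_def)
  qed
  show "integrable M (\<lambda>\<omega>. (W t \<omega> - W s \<omega>) $ k)" "expectation (\<lambda>\<omega>. (W t \<omega> - W s \<omega>) $ k) = 0"
    using i1 e1 unfolding D_def by auto
  have "integrable M (\<lambda>\<omega>. D k \<omega> * D l \<omega>)"
  proof (cases "k = l")
    case True
    then show ?thesis using i2[of k] by (simp add: power2_eq_square)
  next
    case False
    then show ?thesis by (rule indep_var_integrable[OF ind i1 i1])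
  qed
  then show "integrable M (\<lambda>\<omega>. (W t \<omega> - W s \<omega>) $ k * (W t \<omega> - W s \<omega>) $ l)" unfolding D_def .
  have "expectation (\<lambda>\<omega>. D k \<omega> * D l \<omega>) = (if k = l then t - s else 0)"
  proof (cases "k = l")
    case True
    then show ?thesis using e2[of k] by (simp add: power2_eq_square)
  next
    case False
    then show ?thesis using indep_var_lebesgue_integral[OF ind[OF False] i1 i1] e1 by simp
  qed
  then show "expectation (\<lambda>\<omega>. (W t \<omega> - W s \<omega>) $ k * (W t \<omega> - W s \<omega>) $ l) = (if k = l then t - s else 0)"
    unfolding D_def .
qed

lemma integral_mult_increment:
  fixes \<eta> :: "'a \<Rightarrow> real"
  assumes s: "0 \<le> s" "s < t" and \<eta>: "\<eta> \<in> borel_measurable (F s)" "integrable M \<eta>"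
  shows "integrable M (\<lambda>\<omega>. \<eta> \<omega> * (W t \<omega> - W s \<omega>) $ k)"
    and "expectation (\<lambda>\<omega>. \<eta> \<omega> * (W t \<omega> - W s \<omega>) $ k) = 0"
    and "integrable M (\<lambda>\<omega>. \<eta> \<omega> * ((W t \<omega> - W s \<omega>) $ k * (W t \<omega> - W s \<omega>) $ l))"
    and "expectation (\<lambda>\<omega>. \<eta> \<omega> * ((W t \<omega> - W s \<omega>) $ k * (W t \<omega> - W s \<omega>) $ l))
      = expectation \<eta> * (if k = l then t - s else 0)"
proof -
  have 1: "indep_var borel \<eta> borel (\<lambda>\<omega>. (W t \<omega> - W s \<omega>) $ k)"
    using indep_var_increment[OF s \<eta>(1), of "\<lambda>w. w $ k"] by simp
  have 2: "indep_var borel \<eta> borel (\<lambda>\<omega>. (W t \<omega> - W s \<omega>) $ k * (W t \<omega> - W s \<omega>) $ l)"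
    using indep_var_increment[OF s \<eta>(1), of "\<lambda>w. w $ k * w $ l"] by simp
  note m = increment_moments[OF s]
  show "integrable M (\<lambda>\<omega>. \<eta> \<omega> * (W t \<omega> - W s \<omega>) $ k)"
    by (rule indep_var_integrable[OF 1 \<eta>(2) m(1)])
  show "expectation (\<lambda>\<omega>. \<eta> \<omega> * (W t \<omega> - W s \<omega>) $ k) = 0"
    using indep_var_lebesgue_integral[OF 1 \<eta>(2) m(1)] m(2) by simp
  show "integrable M (\<lambda>\<omega>. \<eta> \<omega> * ((W t \<omega> - W s \<omega>) $ k * (W t \<omega> - W s \<omega>) $ l))"
    by (rule indep_var_integrable[OF 2 \<eta>(2) m(3)])
  show "expectation (\<lambda>\<omega>. \<eta> \<omega> * ((W t \<omega> - W s \<omega>) $ k * (W t \<omega> - W s \<omega>) $ l))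
      = expectation \<eta> * (if k = l then t - s else 0)"
    using indep_var_lebesgue_integral[OF 2 \<eta>(2) m(3)] m(4) by simp
qed

lemma borel_measurable_vec_nth:
  fixes Z :: "'x \<Rightarrow> real ^ 'b"
  assumes "Z \<in> borel_measurable N"
  shows "(\<lambda>\<omega>. Z \<omega> $ i) \<in> borel_measurable N"
  by (rule measurable_compose[OF assms]) (intro borel_measurable_continuous_onI continuous_intros)

lemma borel_measurable_nth_nth:
  fixes \<xi> :: "'x \<Rightarrow> real ^ 'b ^ 'c"
  assumes "\<xi> \<in> borel_measurable N"
  shows "(\<lambda>\<omega>. \<xi> \<omega> $ i $ k) \<in> borel_measurable N"
  by (rule measurable_compose[OF assms]) (intro borel_measurable_continuous_onI continuous_intros)

text \<open>In coordinates this is a sum of components of the increment, each with a weight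
  \<open>Z \<omega> $ i * \<xi> \<omega> $ i $ k\<close> that is known at time \<open>s\<close> and
  integrable because \<xi> is bounded; the components are centred and independent of the
  weights.\<close>

lemma martingale_difference:
  fixes \<xi> :: "'a \<Rightarrow> real ^ 'm ^ 'd" and Z :: "'a \<Rightarrow> real ^ 'd"
  assumes s: "0 \<le> s" "s \<le> t" and \<xi>: "\<xi> \<in> borel_measurable (F s)" "\<And>\<omega>. \<omega> \<in> space M \<Longrightarrow> norm (\<xi> \<omega>) \<le> C"
    and Z: "Z \<in> borel_measurable (F s)" "integrable M Z"
  shows "integrable M (\<lambda>\<omega>. Z \<omega> \<bullet> (\<xi> \<omega> *v (W t \<omega> - W s \<omega>)))
    \<and> expectation (\<lambda>\<omega>. Z \<omega> \<bullet> (\<xi> \<omega> *v (W t \<omega> - W s \<omega>))) = 0"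
proof (cases "s = t")
  case False
  then have st: "s < t" using s by simp
  have eq: "(\<lambda>\<omega>. Z \<omega> \<bullet> (\<xi> \<omega> *v (W t \<omega> - W s \<omega>)))
    = (\<lambda>\<omega>. \<Sum>i\<in>UNIV. \<Sum>k\<in>UNIV. (Z \<omega> $ i * \<xi> \<omega> $ i $ k) * (W t \<omega> - W s \<omega>) $ k)"
    unfolding inner_vec_def matrix_vector_mult_def
    by (intro ext, simp only: vec_lambda_beta inner_real_def sum_distrib_left, intro sum.cong refl)
      (simp only: ac_simps)
  have mF: "(\<lambda>\<omega>. Z \<omega> $ i * \<xi> \<omega> $ i $ k) \<in> borel_measurable (F s)" for i k
    by (intro borel_measurable_times borel_measurable_nth_nth borel_measurable_vec_nth \<xi>(1) Z(1))
  have int: "integrable M (\<lambda>\<omega>. Z \<omega> $ i * \<xi> \<omega> $ i $ k)" for i k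
  proof (rule Bochner_Integration.integrable_bound)
    show "integrable M (\<lambda>\<omega>. C *\<^sub>R Z \<omega>)" using Z(2) by simp
    show "(\<lambda>\<omega>. Z \<omega> $ i * \<xi> \<omega> $ i $ k) \<in> borel_measurable M"
      using mF s(1) by (rule measurable_F_M)
    have "norm (Z \<omega> $ i * \<xi> \<omega> $ i $ k) \<le> norm (C *\<^sub>R Z \<omega>)" if "\<omega> \<in> space M" for \<omega>
    proof -
      have "\<bar>\<xi> \<omega> $ i $ k\<bar> \<le> norm (\<xi> \<omega>)"
        by (meson Finite_Cartesian_Product.norm_nth_le component_le_norm_cart order_trans)
      then have "\<bar>\<xi> \<omega> $ i $ k\<bar> \<le> \<bar>C\<bar>" using \<xi>(2)[OF that] by simp
      moreover have "\<bar>Z \<omega> $ i\<bar> \<le> norm (Z \<omega>)" by (rule component_le_norm_cart)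
      ultimately show ?thesis
        by (auto simp: abs_mult mult.commute[of _ "\<bar>\<xi> \<omega> $ i $ k\<bar>"] intro!: mult_mono)
    qed
    then show "AE \<omega> in M. norm (Z \<omega> $ i * \<xi> \<omega> $ i $ k) \<le> norm (C *\<^sub>R Z \<omega>)" by auto
  qed
  show ?thesis
    unfolding eq
    using integral_mult_increment(1,2)[OF s(1) st mF int]
    by (simp add: Bochner_Integration.integral_sum)
qed simp

text \<open>In coordinates, products of two components of the increment average to
  \<open>t - s\<close> on the diagonal and to zero off it, which contracts the coefficients to the
  Frobenius inner product of the two matrices.\<close>

lemma increment_covariance:
  fixes \<xi> \<xi>' :: "'a \<Rightarrow> real ^ 'm ^ 'd"
  assumes s: "0 \<le> s" "s \<le> t"
    and \<xi>: "\<xi> \<in> borel_measurable (F s)" "\<And>\<omega>. \<omega> \<in> space M \<Longrightarrow> norm (\<xi> \<omega>) \<le> C"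
    and \<xi>': "\<xi>' \<in> borel_measurable (F s)" "\<And>\<omega>. \<omega> \<in> space M \<Longrightarrow> norm (\<xi>' \<omega>) \<le> C'"
  shows "integrable M (\<lambda>\<omega>. (\<xi> \<omega> *v (W t \<omega> - W s \<omega>)) \<bullet> (\<xi>' \<omega> *v (W t \<omega> - W s \<omega>)))
    \<and> expectation (\<lambda>\<omega>. (\<xi> \<omega> *v (W t \<omega> - W s \<omega>)) \<bullet> (\<xi>' \<omega> *v (W t \<omega> - W s \<omega>)))
      = (t - s) * expectation (\<lambda>\<omega>. \<xi> \<omega> \<bullet> \<xi>' \<omega>)"
proof (cases "s = t")
  case False
  then have st: "s < t" using s by simp
  have eq: "(\<lambda>\<omega>. (\<xi> \<omega> *v (W t \<omega> - W s \<omega>)) \<bullet> (\<xi>' \<omega> *v (W t \<omega> - W s \<omega>)))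
    = (\<lambda>\<omega>. \<Sum>i\<in>UNIV. \<Sum>k\<in>UNIV. \<Sum>l\<in>UNIV.
        (\<xi> \<omega> $ i $ k * \<xi>' \<omega> $ i $ l) * ((W t \<omega> - W s \<omega>) $ k * (W t \<omega> - W s \<omega>) $ l))"
    unfolding inner_vec_def matrix_vector_mult_def
    by (intro ext, simp only: vec_lambda_beta inner_real_def sum_product, intro sum.cong refl)
      (simp only: mult.assoc mult.left_commute)
  have mF: "(\<lambda>\<omega>. \<xi> \<omega> $ i $ k * \<xi>' \<omega> $ i $ l) \<in> borel_measurable (F s)" for i k l
    using borel_measurable_nth_nth[OF \<xi>(1)] borel_measurable_nth_nth[OF \<xi>'(1)] by simp
  have int: "integrable M (\<lambda>\<omega>. \<xi> \<omega> $ i $ k * \<xi>' \<omega> $ i $ l)" for i k l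
  proof (rule integrable_const_bound)
    show "(\<lambda>\<omega>. \<xi> \<omega> $ i $ k * \<xi>' \<omega> $ i $ l) \<in> borel_measurable M"
      using mF s(1) by (rule measurable_F_M)
    have "norm (\<xi> \<omega> $ i $ k * \<xi>' \<omega> $ i $ l) \<le> \<bar>C\<bar> * \<bar>C'\<bar>" if "\<omega> \<in> space M" for \<omega>
    proof -
      have "\<bar>\<xi> \<omega> $ i $ k\<bar> \<le> norm (\<xi> \<omega>)" "\<bar>\<xi>' \<omega> $ i $ l\<bar> \<le> norm (\<xi>' \<omega>)"
        by (meson Finite_Cartesian_Product.norm_nth_le component_le_norm_cart order_trans)+
      then show ?thesis using \<xi>(2)[OF that] \<xi>'(2)[OF that]
        unfolding real_norm_def abs_mult by (intro mult_mono) auto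
    qed
    then show "AE \<omega> in M. norm (\<xi> \<omega> $ i $ k * \<xi>' \<omega> $ i $ l) \<le> \<bar>C\<bar> * \<bar>C'\<bar>" by auto
  qed
  have "expectation (\<lambda>\<omega>. \<xi> \<omega> \<bullet> \<xi>' \<omega>)
    = (\<Sum>i\<in>UNIV. \<Sum>k\<in>UNIV. expectation (\<lambda>\<omega>. \<xi> \<omega> $ i $ k * \<xi>' \<omega> $ i $ k))"
    unfolding inner_vec_def inner_real_def
    by (simp only: Bochner_Integration.integral_sum Bochner_Integration.integrable_sum int)
  then have "(t - s) * expectation (\<lambda>\<omega>. \<xi> \<omega> \<bullet> \<xi>' \<omega>)
    = (\<Sum>i\<in>UNIV. \<Sum>k\<in>UNIV. expectation (\<lambda>\<omega>. \<xi> \<omega> $ i $ k * \<xi>' \<omega> $ i $ k)) * (t - s)"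
    by (simp only: mult.commute)
  also have "\<dots> = (\<Sum>i\<in>UNIV. \<Sum>k\<in>UNIV. expectation (\<lambda>\<omega>. \<xi> \<omega> $ i $ k * \<xi>' \<omega> $ i $ k) * (t - s))"
    unfolding sum_distrib_right ..
  also have "\<dots> = (\<Sum>i\<in>UNIV. \<Sum>k\<in>UNIV. \<Sum>l\<in>UNIV.
      expectation (\<lambda>\<omega>. \<xi> \<omega> $ i $ k * \<xi>' \<omega> $ i $ l) * (if k = l then t - s else 0))"
    by (simp add: mult_delta_right)
  finally have rhs: "(t - s) * expectation (\<lambda>\<omega>. \<xi> \<omega> \<bullet> \<xi>' \<omega>) = (\<Sum>i\<in>UNIV. \<Sum>k\<in>UNIV. \<Sum>l\<in>UNIV.
      expectation (\<lambda>\<omega>. \<xi> \<omega> $ i $ k * \<xi>' \<omega> $ i $ l) * (if k = l then t - s else 0))" .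
  note m = integral_mult_increment(3,4)[OF s(1) st mF int]
  show ?thesis
    unfolding eq rhs
    by (simp only: Bochner_Integration.integral_sum Bochner_Integration.integrable_sum m)
qed simp

end

text \<open>The covariance of two half-line integrands equals a constant \<open>c\<close> after the
  later starting time \<open>b\<close> and is zero before; this is its time integral.\<close>

lemma set_lebesgue_integral_indicator_greaterThan:
  fixes t b c :: real
  assumes "0 \<le> b"
  shows "set_integrable lborel {0..t} (\<lambda>s. indicator {b<..} s * c)"
    and "(LINT s:{0..t}|lborel. indicator {b<..} s * c) = max 0 (t - b) * c"
proof -
  have eq: "indicator {0..t} s *\<^sub>R (indicator {b<..} s * c) = indicator {b<..t} s * c" for s
    using assms by (auto split: split_indicator)
  show "set_integrable lborel {0..t} (\<lambda>s. indicator {b<..} s * c)"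
    unfolding set_integrable_def eq
    by (intro integrable_mult_left integrable_real_indicator) (cases "b \<le> t"; simp)+
  show "(LINT s:{0..t}|lborel. indicator {b<..} s * c) = max 0 (t - b) * c"
    unfolding set_lebesgue_integral_def eq by (cases "b \<le> t") auto
qed

section \<open>Elementary stochastic integrals: algebra, isometry, orthogonality to the past\<close>

context brownian_motion
begin

text \<open>Elementary integrands are sums of processes \<open>1\<^bsub>(a,\<infinity>)\<^esub> \<xi>\<close> with \<open>\<xi>\<close> being \<open>F a\<close>-measurable; the
  half-infinite intervals make the class closed under sums without refining partitions.\<close>

inductive elementary :: "(real \<Rightarrow> 'a \<Rightarrow> real ^ 'm ^ 'd) \<Rightarrow> (real \<Rightarrow> 'a \<Rightarrow> real ^ 'd) \<Rightarrow> bool" where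
  zero: "elementary (\<lambda>_ _. 0) (\<lambda>_ _. 0)"
| add: "elementary H J \<Longrightarrow> 0 \<le> a \<Longrightarrow> \<xi> \<in> borel_measurable (F a) \<Longrightarrow> bounded (\<xi> ` space M) \<Longrightarrow>
    elementary (\<lambda>s \<omega>. H s \<omega> + indicator {a<..} s *\<^sub>R \<xi> \<omega>)
      (\<lambda>t \<omega>. J t \<omega> + \<xi> \<omega> *v (W t \<omega> - W (min a t) \<omega>))"

lemma elementary_plus:
  assumes "elementary H J" "elementary H' J'"
  shows "elementary (\<lambda>s \<omega>. H s \<omega> + H' s \<omega>) (\<lambda>t \<omega>. J t \<omega> + J' t \<omega>)"
  using assms(2)
proof induction
  case zero
  then show ?case using assms(1) by simp
next
  case (add H' J' a \<xi>)
  from elementary.add[OF add(5,2,3,4)] show ?case by (simp add: add.assoc)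
qed

lemma bounded_image_uminus:
  fixes \<xi> :: "'x \<Rightarrow> 'y::real_normed_vector"
  shows "bounded (\<xi> ` S) \<Longrightarrow> bounded ((\<lambda>\<omega>. - \<xi> \<omega>) ` S)"
  by (simp add: bounded_iff)

lemma elementary_uminus:
  assumes "elementary H J"
  shows "elementary (\<lambda>s \<omega>. - H s \<omega>) (\<lambda>t \<omega>. - J t \<omega>)"
  using assms
proof induction
  case zero
  then show ?case using elementary.zero by simp
next
  case (add H J a \<xi>)
  have "(\<lambda>\<omega>. - \<xi> \<omega>) \<in> borel_measurable (F a)" using add(3) by simp
  from elementary.add[OF add(5,2) this bounded_image_uminus[OF add(4)]]
  show ?case
    by (simp add: matrix_vector_mult_diff_rdistrib[of 0, simplified])
qed

lemma elementary_diff: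
  assumes "elementary H J" "elementary H' J'"
  shows "elementary (\<lambda>s \<omega>. H s \<omega> - H' s \<omega>) (\<lambda>t \<omega>. J t \<omega> - J' t \<omega>)"
  using elementary_plus[OF assms(1) elementary_uminus[OF assms(2)]] by simp

text \<open>After time \<open>s\<close>, a step that begins at \<open>a\<close> begins at
  \<open>max s a\<close>, where both \<open>A\<close> and \<xi> are known. This localizes the
  isometry to events of time \<open>s\<close>.\<close>

lemma elementary_restrict:
  assumes "elementary H J" and s: "0 \<le> s" and A: "A \<in> sets (F s)"
  shows "elementary (\<lambda>r \<omega>. (indicator A \<omega> * indicator {s<..} r) *\<^sub>R H r \<omega>)
    (\<lambda>t \<omega>. indicator A \<omega> *\<^sub>R (J t \<omega> - J (min s t) \<omega>))"
  using assms(1)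
proof induction
  case zero
  then show ?case using elementary.zero by simp
next
  case (add H J a \<xi>)
  let ?\<xi> = "\<lambda>\<omega>. indicator A \<omega> *\<^sub>R \<xi> \<omega>"
  have "A \<in> sets (F (max s a))" using sets_F_mono[OF s max.cobounded1] A by (rule subsetD)
  moreover have "\<xi> \<in> borel_measurable (F (max s a))"
    by (rule measurable_F_mono[OF add(3,2) max.cobounded2])
  ultimately have m: "?\<xi> \<in> borel_measurable (F (max s a))"
    by (intro borel_measurable_scaleR borel_measurable_indicator)
  have b: "bounded (?\<xi> ` space M)"
  proof -
    obtain C where C: "\<And>\<omega>. \<omega> \<in> space M \<Longrightarrow> norm (\<xi> \<omega>) \<le> C"
      using add(4) unfolding bounded_iff by blast
    then have "norm (?\<xi> \<omega>) \<le> max C 0" if "\<omega> \<in> space M" for \<omega>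
      using that by (auto split: split_indicator simp: le_max_iff_disj)
    then show ?thesis unfolding bounded_iff by blast
  qed
  have eq1: "(indicator A \<omega> * indicator {s<..} r) *\<^sub>R (H r \<omega> + indicator {a<..} r *\<^sub>R \<xi> \<omega>)
      = (indicator A \<omega> * indicator {s<..} r) *\<^sub>R H r \<omega> + indicator {max s a<..} r *\<^sub>R ?\<xi> \<omega>" for r \<omega>
    by (cases "\<omega> \<in> A"; cases "s < r"; cases "a < r") simp_all
  have eq2: "indicator A \<omega> *\<^sub>R (J t \<omega> + \<xi> \<omega> *v (W t \<omega> - W (min a t) \<omega>)
        - (J (min s t) \<omega> + \<xi> \<omega> *v (W (min s t) \<omega> - W (min a (min s t)) \<omega>)))
      = indicator A \<omega> *\<^sub>R (J t \<omega> - J (min s t) \<omega>) + ?\<xi> \<omega> *v (W t \<omega> - W (min (max s a) t) \<omega>)" for t \<omega>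
  proof -
    have "W t \<omega> - W (min (max s a) t) \<omega>
        = (W t \<omega> - W (min a t) \<omega>) - (W (min s t) \<omega> - W (min a (min s t)) \<omega>)"
    proof (cases "a \<le> s")
      case True
      then have "min a (min s t) = min a t" "max s a = s" by auto
      then show ?thesis by simp
    next
      case False
      then have "min a (min s t) = min s t" "max s a = a" by auto
      then show ?thesis by simp
    qed
    then have "\<xi> \<omega> *v (W t \<omega> - W (min (max s a) t) \<omega>)
        = \<xi> \<omega> *v (W t \<omega> - W (min a t) \<omega>) - \<xi> \<omega> *v (W (min s t) \<omega> - W (min a (min s t)) \<omega>)"
      by (simp only: matrix_vector_mult_diff_distrib)
    then show ?thesis by (cases "\<omega> \<in> A") simp_all
  qed
  from elementary.add[OF add(5) _ m b] s show ?case
    unfolding eq1 eq2 by simp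
qed

text \<open>The indicator of a bounded interval is a difference of two half-line indicators; the
  second one enters with \<open>- \<xi> i\<close>, which is still known at the later time
  \<open>\<tau> (Suc i)\<close>.\<close>

lemma simple_ito_integral_elementary:
  assumes "simple_ito_integral M F W H J"
  shows "elementary H J"
proof -
  obtain n \<tau> \<xi> where \<tau>: "0 \<le> \<tau> 0" "\<And>i. i < n \<Longrightarrow> \<tau> i \<le> \<tau> (Suc i)"
    and \<xi>: "\<And>i. i < n \<Longrightarrow> \<xi> i \<in> borel_measurable (F (\<tau> i)) \<and> bounded (\<xi> i ` space M)"
    and H: "H = (\<lambda>s \<omega>. \<Sum>i<n. indicator {\<tau> i <.. \<tau> (Suc i)} s *\<^sub>R \<xi> i \<omega>)"
    and J: "J = (\<lambda>t \<omega>. \<Sum>i<n. \<xi> i \<omega> *v (W (min t (\<tau> (Suc i))) \<omega> - W (min t (\<tau> i)) \<omega>))"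
    using assms unfolding simple_ito_integral_def by blast
  have pos: "0 \<le> \<tau> i" if "i \<le> n" for i
    using that
  proof (induction i)
    case (Suc i)
    then show ?case using \<tau>(2)[of i] by simp
  qed (use \<tau> in simp)
  have "elementary (\<lambda>s \<omega>. \<Sum>i<k. indicator {\<tau> i <.. \<tau> (Suc i)} s *\<^sub>R \<xi> i \<omega>)
      (\<lambda>t \<omega>. \<Sum>i<k. \<xi> i \<omega> *v (W (min t (\<tau> (Suc i))) \<omega> - W (min t (\<tau> i)) \<omega>))" if "k \<le> n" for k
    using that
  proof (induction k)
    case 0
    then show ?case using elementary.zero by simp
  next
    case (Suc k)
    let ?H = "\<lambda>s \<omega>. \<Sum>i<k. indicator {\<tau> i <.. \<tau> (Suc i)} s *\<^sub>R \<xi> i \<omega>"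
    let ?J = "\<lambda>t \<omega>. \<Sum>i<k. \<xi> i \<omega> *v (W (min t (\<tau> (Suc i))) \<omega> - W (min t (\<tau> i)) \<omega>)"
    have E: "elementary ?H ?J" using Suc by simp
    have \<xi>k: "\<xi> k \<in> borel_measurable (F (\<tau> k))" "bounded (\<xi> k ` space M)" using \<xi>[of k] Suc(2) by auto
    have mono: "\<tau> k \<le> \<tau> (Suc k)" using \<tau>(2)[of k] Suc(2) by simp
    have \<xi>k': "(\<lambda>\<omega>. - \<xi> k \<omega>) \<in> borel_measurable (F (\<tau> (Suc k)))"
      using measurable_F_mono[OF \<xi>k(1) _ mono] pos[of k] Suc(2) by simp
    have "elementary
        (\<lambda>s \<omega>. ?H s \<omega> + indicator {\<tau> k<..} s *\<^sub>R \<xi> k \<omega> + indicator {\<tau> (Suc k)<..} s *\<^sub>R (- \<xi> k \<omega>))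
        (\<lambda>t \<omega>. ?J t \<omega> + \<xi> k \<omega> *v (W t \<omega> - W (min (\<tau> k) t) \<omega>)
          + (- \<xi> k \<omega>) *v (W t \<omega> - W (min (\<tau> (Suc k)) t) \<omega>))"
      using pos[of k] pos[of "Suc k"] Suc(2)
      by (intro elementary.add E \<xi>k \<xi>k' bounded_image_uminus) auto
    also have "(\<lambda>s \<omega>. ?H s \<omega> + indicator {\<tau> k<..} s *\<^sub>R \<xi> k \<omega> + indicator {\<tau> (Suc k)<..} s *\<^sub>R (- \<xi> k \<omega>))
        = (\<lambda>s \<omega>. \<Sum>i<Suc k. indicator {\<tau> i <.. \<tau> (Suc i)} s *\<^sub>R \<xi> i \<omega>)"
      using mono by (intro ext) (auto split: split_indicator)
    also have "(\<lambda>t \<omega>. ?J t \<omega> + \<xi> k \<omega> *v (W t \<omega> - W (min (\<tau> k) t) \<omega>)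
          + (- \<xi> k \<omega>) *v (W t \<omega> - W (min (\<tau> (Suc k)) t) \<omega>))
        = (\<lambda>t \<omega>. \<Sum>i<Suc k. \<xi> i \<omega> *v (W (min t (\<tau> (Suc i))) \<omega> - W (min t (\<tau> i)) \<omega>))"
      by (intro ext) (simp add: matrix_vector_mult_diff_rdistrib[of 0, simplified]
          matrix_vector_mult_diff_distrib min.commute)
    finally show ?case .
  qed
  from this[of n] show ?thesis by (simp add: H J)
qed

lemma borel_measurable_matrix_vector_mult:
  fixes \<xi> :: "'x \<Rightarrow> real ^ 'b ^ 'c" and w :: "'x \<Rightarrow> real ^ 'b"
  assumes [measurable]: "\<xi> \<in> borel_measurable N" "w \<in> borel_measurable N"
  shows "(\<lambda>\<omega>. \<xi> \<omega> *v w \<omega>) \<in> borel_measurable N"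
proof -
  have "continuous_on UNIV (\<lambda>z :: (real ^ 'b ^ 'c) \<times> (real ^ 'b). fst z *v snd z)"
    unfolding matrix_vector_mult_def
    by (intro continuous_on_vec_lambda continuous_on_sum continuous_on_mult continuous_on_component
        continuous_on_fst continuous_on_snd continuous_on_id)
  then have "(\<lambda>z :: (real ^ 'b ^ 'c) \<times> (real ^ 'b). fst z *v snd z) \<in> borel_measurable borel"
    by (rule borel_measurable_continuous_onI)
  from measurable_compose[OF borel_measurable_Pair[OF assms] this] show ?thesis by simp
qed

lemma elementary_adapted:
  assumes "elementary H J" "0 \<le> t"
  shows "J t \<in> borel_measurable (F t)"
  using assms
proof induction
  case (add H J a \<xi>)
  have "(\<lambda>\<omega>. \<xi> \<omega> *v (W t \<omega> - W (min a t) \<omega>)) \<in> borel_measurable (F t)"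
  proof (cases "a \<le> t")
    case True
    show ?thesis
      by (rule borel_measurable_matrix_vector_mult[OF measurable_F_mono[OF add(3,2) True]])
        (use True add W_measurable[of t t] W_measurable[of a t] in \<open>auto simp: min_def\<close>)
  qed (simp add: min_def)
  then show ?case using add by auto
qed simp

lemma elementary_adapted_M: "elementary H J \<Longrightarrow> 0 \<le> t \<Longrightarrow> J t \<in> borel_measurable M"
  using elementary_adapted measurable_F_M by blast

lemma elementary_jointly_measurable:
  assumes "elementary H J"
  shows "(\<lambda>z. H (snd z) (fst z)) \<in> borel_measurable (M \<Otimes>\<^sub>M lborel)"
  using assms
proof induction
  case (add H J a \<xi>)
  note [measurable] = measurable_F_M[OF add(3,2)] add(5)
  show ?case by measurable
qed simp

lemma integrable_inner_bounded:
  fixes \<xi> \<xi>' :: "'a \<Rightarrow> 'b::euclidean_space"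
  assumes [measurable]: "\<xi> \<in> borel_measurable M" "\<xi>' \<in> borel_measurable M"
    and b: "bounded (\<xi> ` space M)" "bounded (\<xi>' ` space M)"
  shows "integrable M (\<lambda>\<omega>. \<xi> \<omega> \<bullet> \<xi>' \<omega>)"
proof -
  obtain C C' where C: "\<And>\<omega>. \<omega> \<in> space M \<Longrightarrow> norm (\<xi> \<omega>) \<le> C" "\<And>\<omega>. \<omega> \<in> space M \<Longrightarrow> norm (\<xi>' \<omega>) \<le> C'"
    using b unfolding bounded_iff by blast
  have "norm (\<xi> \<omega> \<bullet> \<xi>' \<omega>) \<le> C * C'" if "\<omega> \<in> space M" for \<omega>
  proof -
    have "norm (\<xi> \<omega> \<bullet> \<xi>' \<omega>) \<le> norm (\<xi> \<omega>) * norm (\<xi>' \<omega>)"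
      using Cauchy_Schwarz_ineq2[of "\<xi> \<omega>" "\<xi>' \<omega>"] by simp
    also have "\<dots> \<le> C * C'"
      using C[OF that] order_trans[OF norm_ge_zero C(1)[OF that]] by (intro mult_mono) auto
    finally show ?thesis .
  qed
  then show ?thesis
    by (intro integrable_const_bound[where B = "C * C'"]) auto
qed

lemma integrable_matrix_increment:
  fixes \<xi> :: "'a \<Rightarrow> real ^ 'm ^ 'd"
  assumes s: "0 \<le> s" "s \<le> t" and \<xi>: "\<xi> \<in> borel_measurable (F s)" "bounded (\<xi> ` space M)"
  shows "integrable M (\<lambda>\<omega>. \<xi> \<omega> *v (W t \<omega> - W s \<omega>))"
proof (cases "s = t")
  case False
  then have st: "s < t" using s by simp
  obtain C where C: "\<And>\<omega>. \<omega> \<in> space M \<Longrightarrow> norm (\<xi> \<omega>) \<le> C"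
    using \<xi>(2) unfolding bounded_iff by blast
  have mF: "(\<lambda>\<omega>. \<xi> \<omega> $ i $ k) \<in> borel_measurable (F s)" for i k
    by (rule borel_measurable_nth_nth[OF \<xi>(1)])
  have "integrable M (\<lambda>\<omega>. \<xi> \<omega> $ i $ k)" for i k
  proof (rule integrable_const_bound)
    show "AE \<omega> in M. norm (\<xi> \<omega> $ i $ k) \<le> C"
      using C by (auto intro: order_trans[OF component_le_norm_cart]
          order_trans[OF Finite_Cartesian_Product.norm_nth_le])
    show "(\<lambda>\<omega>. \<xi> \<omega> $ i $ k) \<in> borel_measurable M" using mF s(1) by (rule measurable_F_M)
  qed
  note i = integral_mult_increment(1)[OF s(1) st mF this]
  have "integrable M (\<lambda>\<omega>. \<Sum>i\<in>UNIV. (\<Sum>k\<in>UNIV. \<xi> \<omega> $ i $ k * (W t \<omega> - W s \<omega>) $ k) *\<^sub>R axis i (1::real))"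
    by (intro Bochner_Integration.integrable_sum integrable_scaleR_left i)
  also have "(\<lambda>\<omega>. \<Sum>i\<in>UNIV. (\<Sum>k\<in>UNIV. \<xi> \<omega> $ i $ k * (W t \<omega> - W s \<omega>) $ k) *\<^sub>R axis i (1::real))
      = (\<lambda>\<omega>. \<xi> \<omega> *v (W t \<omega> - W s \<omega>))"
    using basis_expansion[of "\<xi> _ *v (W t _ - W s _)"]
    by (simp add: fun_eq_iff matrix_vector_mult_def scalar_mult_eq_scaleR)
  finally show ?thesis .
qed simp

text \<open>The Ito isometry in polarized form. Unlike the norm identity it is additive in each
  argument, so induction on both integrands reaches it; the integrability clauses travel along
  because additivity of the Bochner integral requires them.\<close>

definition isometric :: "real \<Rightarrow> (real \<Rightarrow> 'a \<Rightarrow> real ^ 'm ^ 'd) \<Rightarrow> (real \<Rightarrow> 'a \<Rightarrow> real ^ 'd) \<Rightarrow>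
    (real \<Rightarrow> 'a \<Rightarrow> real ^ 'm ^ 'd) \<Rightarrow> (real \<Rightarrow> 'a \<Rightarrow> real ^ 'd) \<Rightarrow> bool" where
  "isometric t H J H' J' \<longleftrightarrow>
    (\<forall>s. integrable M (\<lambda>\<omega>. H s \<omega> \<bullet> H' s \<omega>)) \<and>
    set_integrable lborel {0..t} (\<lambda>s. expectation (\<lambda>\<omega>. H s \<omega> \<bullet> H' s \<omega>)) \<and>
    integrable M (\<lambda>\<omega>. J t \<omega> \<bullet> J' t \<omega>) \<and>
    expectation (\<lambda>\<omega>. J t \<omega> \<bullet> J' t \<omega>) = (LINT s:{0..t}|lborel. expectation (\<lambda>\<omega>. H s \<omega> \<bullet> H' s \<omega>))"

lemma isometric_sym: "isometric t H J H' J' \<Longrightarrow> isometric t H' J' H J"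
  unfolding isometric_def by (simp add: inner_commute)

lemma isometric_zero: "isometric t (\<lambda>_ _. 0) (\<lambda>_ _. 0) H' J'"
  unfolding isometric_def by (simp add: set_integrable_def)

lemma isometric_add:
  assumes "isometric t H J H' J'" "isometric t G K H' J'"
  shows "isometric t (\<lambda>s \<omega>. H s \<omega> + G s \<omega>) (\<lambda>t \<omega>. J t \<omega> + K t \<omega>) H' J'"
  using assms unfolding isometric_def by (auto simp: inner_add_left set_integral_add)

text \<open>By symmetry \<open>a \<le> a'\<close>. The first integral is split at \<open>a'\<close>:
  its earlier part is known at that time and orthogonal to the second integral, and the later part
  shares its increment, so the covariance formula applies.\<close>

lemma isometric_elementary_pair:
  fixes \<xi> \<xi>' :: "'a \<Rightarrow> real ^ 'm ^ 'd"
  assumes a: "0 \<le> a" "0 \<le> a'" and \<xi>: "\<xi> \<in> borel_measurable (F a)" "bounded (\<xi> ` space M)"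
    and \<xi>': "\<xi>' \<in> borel_measurable (F a')" "bounded (\<xi>' ` space M)"
  shows "isometric t (\<lambda>s \<omega>. indicator {a<..} s *\<^sub>R \<xi> \<omega>) (\<lambda>t \<omega>. \<xi> \<omega> *v (W t \<omega> - W (min a t) \<omega>))
    (\<lambda>s \<omega>. indicator {a'<..} s *\<^sub>R \<xi>' \<omega>) (\<lambda>t \<omega>. \<xi>' \<omega> *v (W t \<omega> - W (min a' t) \<omega>))"
  using assms
proof (induction a a' arbitrary: \<xi> \<xi>' rule: linorder_wlog)
  case (sym b b')
  show ?case
    by (rule isometric_sym) (use sym in auto)
next
  case (le a a')
  let ?E = "expectation (\<lambda>\<omega>. \<xi> \<omega> \<bullet> \<xi>' \<omega>)"
  have \<xi>a': "\<xi> \<in> borel_measurable (F a')" using le measurable_F_mono by blast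
  have int: "integrable M (\<lambda>\<omega>. \<xi> \<omega> \<bullet> \<xi>' \<omega>)"
    using le measurable_F_M by (intro integrable_inner_bounded) blast+
  have eq: "(\<lambda>\<omega>. (indicator {a<..} s *\<^sub>R \<xi> \<omega>) \<bullet> (indicator {a'<..} s *\<^sub>R \<xi>' \<omega>))
      = (\<lambda>\<omega>. indicator {a'<..} s * (\<xi> \<omega> \<bullet> \<xi>' \<omega>))" for s
    using le(1) by (auto split: split_indicator)
  have J: "integrable M (\<lambda>\<omega>. (\<xi> \<omega> *v (W t \<omega> - W (min a t) \<omega>)) \<bullet> (\<xi>' \<omega> *v (W t \<omega> - W (min a' t) \<omega>)))
    \<and> expectation (\<lambda>\<omega>. (\<xi> \<omega> *v (W t \<omega> - W (min a t) \<omega>)) \<bullet> (\<xi>' \<omega> *v (W t \<omega> - W (min a' t) \<omega>)))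
      = max 0 (t - a') * ?E"
  proof (cases "a' < t")
    case False
    then show ?thesis by (simp add: min_def max_def)
  next
    case True
    obtain C C' where C: "\<And>\<omega>. \<omega> \<in> space M \<Longrightarrow> norm (\<xi> \<omega>) \<le> C"
        "\<And>\<omega>. \<omega> \<in> space M \<Longrightarrow> norm (\<xi>' \<omega>) \<le> C'"
      using le unfolding bounded_iff by blast
    let ?Z = "\<lambda>\<omega>. \<xi> \<omega> *v (W a' \<omega> - W a \<omega>)"
    have Z: "?Z \<in> borel_measurable (F a')" "integrable M ?Z"
      using le \<xi>a' W_measurable[of a a'] W_measurable[of a' a']
      by (auto intro!: borel_measurable_matrix_vector_mult integrable_matrix_increment)
    note 1 = increment_covariance[OF le(3) less_imp_le[OF True] \<xi>a' C(1) le(6) C(2)]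
    note 2 = martingale_difference[OF le(3) less_imp_le[OF True] le(6) C(2) Z]
    have "(\<xi> \<omega> *v (W t \<omega> - W (min a t) \<omega>)) \<bullet> (\<xi>' \<omega> *v (W t \<omega> - W (min a' t) \<omega>))
      = (\<xi> \<omega> *v (W t \<omega> - W a' \<omega>)) \<bullet> (\<xi>' \<omega> *v (W t \<omega> - W a' \<omega>))
        + ?Z \<omega> \<bullet> (\<xi>' \<omega> *v (W t \<omega> - W a' \<omega>))" for \<omega>
      using le(1) True
      by (simp add: min_def inner_add_left[symmetric] matrix_vector_mult_diff_distrib)
    then show ?thesis using 1 2 True by simp
  qed
  have E: "expectation (\<lambda>\<omega>. indicator {a'<..} s * (\<xi> \<omega> \<bullet> \<xi>' \<omega>)) = indicator {a'<..} s * ?E" for s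
    by simp
  note S = set_lebesgue_integral_indicator_greaterThan[OF le(3), of t ?E]
  show ?case
    unfolding isometric_def eq E S(2)
    using J by (intro conjI allI integrable_mult_right int S(1)) auto
qed

lemma elementary_isometric:
  assumes "elementary H J" "elementary H' J'"
  shows "isometric t H J H' J'"
  using assms(1)
proof induction
  case (add H J a \<xi>)
  have "isometric t (\<lambda>s \<omega>. indicator {a<..} s *\<^sub>R \<xi> \<omega>) (\<lambda>t \<omega>. \<xi> \<omega> *v (W t \<omega> - W (min a t) \<omega>)) H' J'"
    using assms(2)
  proof induction
    case zero
    then show ?case by (rule isometric_sym[OF isometric_zero])
  next
    case (add H' J' a' \<xi>')
    show ?case
      by (rule isometric_sym, rule isometric_add)
        (auto intro!: isometric_sym[OF add.IH] isometric_elementary_pair add \<open>0 \<le> a\<close>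
          \<open>\<xi> \<in> borel_measurable (F a)\<close> \<open>bounded (\<xi> ` space M)\<close>)
  qed
  then show ?case by (rule isometric_add[OF add.IH])
qed (rule isometric_zero)

lemma elementary_isometry:
  assumes E: "elementary H J"
  shows "sq_integral M (J t)
    = sq_integral (M \<Otimes>\<^sub>M lborel) (\<lambda>z. indicator {0..t} (snd z) *\<^sub>R H (snd z) (fst z))"
proof -
  interpret pair_sigma_finite M lborel ..
  note [measurable] = elementary_jointly_measurable[OF E]
  have iso: "isometric t H J H J" by (rule elementary_isometric[OF E E])
  have "sq_integral (M \<Otimes>\<^sub>M lborel) (\<lambda>z. indicator {0..t} (snd z) *\<^sub>R H (snd z) (fst z))
    = (\<integral>\<^sup>+s. \<integral>\<^sup>+\<omega>. ennreal ((norm (indicator {0..t} s *\<^sub>R H s \<omega>))\<^sup>2) \<partial>M \<partial>lborel)"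
    by (subst nn_integral_snd[symmetric]) (auto simp: case_prod_beta)
  also have "\<dots> = (\<integral>\<^sup>+s. ennreal (indicator {0..t} s * expectation (\<lambda>\<omega>. H s \<omega> \<bullet> H s \<omega>)) \<partial>lborel)"
  proof (rule nn_integral_cong)
    fix s
    have "sq_integral M (\<lambda>\<omega>. indicator {0..t} s *\<^sub>R H s \<omega>)
      = (\<integral>\<^sup>+\<omega>. ennreal (indicator {0..t} s * (H s \<omega> \<bullet> H s \<omega>)) \<partial>M)"
      by (intro nn_integral_cong) (auto simp: power2_norm_eq_inner split: split_indicator)
    also have "\<dots> = ennreal (indicator {0..t} s * expectation (\<lambda>\<omega>. H s \<omega> \<bullet> H s \<omega>))"
      using iso by (subst nn_integral_eq_integral) (auto simp: isometric_def)
    finally show "sq_integral M (\<lambda>\<omega>. indicator {0..t} s *\<^sub>R H s \<omega>)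
      = ennreal (indicator {0..t} s * expectation (\<lambda>\<omega>. H s \<omega> \<bullet> H s \<omega>))" .
  qed
  also have "\<dots> = ennreal (LINT s:{0..t}|lborel. expectation (\<lambda>\<omega>. H s \<omega> \<bullet> H s \<omega>))"
    using iso unfolding set_lebesgue_integral_def
    by (subst nn_integral_eq_integral) (auto simp: isometric_def set_integrable_def)
  also have "\<dots> = (\<integral>\<^sup>+\<omega>. ennreal (J t \<omega> \<bullet> J t \<omega>) \<partial>M)"
    using iso by (subst nn_integral_eq_integral) (auto simp: isometric_def)
  finally show ?thesis by (simp add: power2_norm_eq_inner)
qed

text \<open>The martingale property, tested against variables known at time \<open>s\<close>. A step
  that begins at \<open>a\<close> contributes to the increment over \<open>{s..t}\<close> only from
  \<open>max s a\<close> on, when both \<xi> and \<open>Z\<close> are known.\<close>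

lemma elementary_orthogonal:
  fixes Z :: "'a \<Rightarrow> real ^ 'd"
  assumes "elementary H J" and s: "0 \<le> s" "s \<le> t"
    and Z: "Z \<in> borel_measurable (F s)" "integrable M Z" "integrable M (\<lambda>\<omega>. (norm (Z \<omega>))\<^sup>2)"
  shows "integrable M (\<lambda>\<omega>. Z \<omega> \<bullet> (J t \<omega> - J s \<omega>)) \<and> expectation (\<lambda>\<omega>. Z \<omega> \<bullet> (J t \<omega> - J s \<omega>)) = 0"
  using assms(1)
proof induction
  case (add H J a \<xi>)
  obtain C where C: "\<And>\<omega>. \<omega> \<in> space M \<Longrightarrow> norm (\<xi> \<omega>) \<le> C"
    using add(4) unfolding bounded_iff by blast
  let ?u = "max s a"
  have *: "integrable M (\<lambda>\<omega>. Z \<omega> \<bullet> (\<xi> \<omega> *v (W t \<omega> - W (min ?u t) \<omega>)))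
    \<and> expectation (\<lambda>\<omega>. Z \<omega> \<bullet> (\<xi> \<omega> *v (W t \<omega> - W (min ?u t) \<omega>))) = 0"
  proof (cases "?u \<le> t")
    case True
    then have u: "0 \<le> ?u" "?u \<le> t" using s by auto
    have "\<xi> \<in> borel_measurable (F ?u)" "Z \<in> borel_measurable (F ?u)"
      using s add(2) by (auto intro: measurable_F_mono[OF add(3)] measurable_F_mono[OF Z(1)])
    from martingale_difference[OF u this(1) C this(2) Z(2)]
    show ?thesis unfolding min_absorb1[OF True] by blast
  next
    case False
    then have "min ?u t = t" by (intro min_absorb2 less_imp_le) (simp only: not_le)
    then show ?thesis by simp
  qed
  have "Z \<omega> \<bullet> (J t \<omega> + \<xi> \<omega> *v (W t \<omega> - W (min a t) \<omega>) - (J s \<omega> + \<xi> \<omega> *v (W s \<omega> - W (min a s) \<omega>)))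
    = Z \<omega> \<bullet> (J t \<omega> - J s \<omega>) + Z \<omega> \<bullet> (\<xi> \<omega> *v (W t \<omega> - W (min ?u t) \<omega>))" for \<omega>
  proof -
    have "W t \<omega> - W (min ?u t) \<omega> = (W t \<omega> - W (min a t) \<omega>) - (W s \<omega> - W (min a s) \<omega>)"
      using s by (cases "a \<le> s") (simp_all add: min_def max_def)
    then have "\<xi> \<omega> *v (W t \<omega> - W (min ?u t) \<omega>)
        = \<xi> \<omega> *v (W t \<omega> - W (min a t) \<omega>) - \<xi> \<omega> *v (W s \<omega> - W (min a s) \<omega>)"
      by (simp only: matrix_vector_mult_diff_distrib)
    then show ?thesis by (simp add: inner_diff_right inner_add_right)
  qed
  then show ?case using * add.IH by simp
qed simp

end

lemma le_of_le_perturbed: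
  fixes l :: real and p :: "real \<Rightarrow> real"
  assumes "\<And>e. 0 < e \<Longrightarrow> l \<le> p e" "(p \<longlongrightarrow> r) (at_right 0)"
  shows "l \<le> r"
  by (rule tendsto_lowerbound[OF assms(2)])
    (use assms(1) in \<open>simp_all add: eventually_at_filter\<close>)

lemma tendsto_zero_ennreal_le:
  fixes f g :: "nat \<Rightarrow> ennreal"
  assumes "\<And>n. f n \<le> g n" "g \<longlonglongrightarrow> 0"
  shows "f \<longlonglongrightarrow> 0"
  by (rule tendsto_sandwich[OF always_eventually always_eventually tendsto_const assms(2)])
    (simp_all add: assms(1))

section \<open>From elementary integrals to the Ito integral\<close>

context brownian_motion
begin

text \<open>The integrand on the product space, outcome first and zero outside
  \<open>{0..T}\<close>; distances between integrands become L2 distances over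
  \<open>M \<Otimes>\<^sub>M lborel\<close>, where the triangle inequalities apply.\<close>

definition cut :: "real \<Rightarrow> (real \<Rightarrow> 'a \<Rightarrow> 'b::real_normed_vector) \<Rightarrow> 'a \<times> real \<Rightarrow> 'b" where
  "cut T H z = indicator {0..T} (snd z) *\<^sub>R H (snd z) (fst z)"

lemma progressive_cut_measurable:
  fixes H :: "real \<Rightarrow> 'a \<Rightarrow> 'b::{second_countable_topology, real_normed_vector}"
  shows "progressive_on F {0..} H \<Longrightarrow> 0 \<le> T \<Longrightarrow> cut T H \<in> borel_measurable (M \<Otimes>\<^sub>M lborel)"
  using progressive_jointly_measurable[of H T] by (simp add: cut_def[abs_def] case_prod_beta')

lemma ito_integral_cut_measurable:
  assumes "ito_integral M F W H I" "0 \<le> T"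
  shows "cut T H \<in> borel_measurable (M \<Otimes>\<^sub>M lborel)"
  using assms by (intro progressive_cut_measurable) (auto simp: ito_integral_def)

lemma elementary_cut_measurable:
  assumes "elementary H J"
  shows "cut T H \<in> borel_measurable (M \<Otimes>\<^sub>M lborel)"
proof -
  note [measurable] = elementary_jointly_measurable[OF assms]
  show ?thesis unfolding cut_def[abs_def] by measurable
qed

lemma nn_integral_cut:
  fixes H G :: "real \<Rightarrow> 'a \<Rightarrow> 'b::euclidean_space"
  assumes [measurable]: "cut T H \<in> borel_measurable (M \<Otimes>\<^sub>M lborel)" "cut T G \<in> borel_measurable (M \<Otimes>\<^sub>M lborel)"
  shows "(\<integral>\<^sup>+ \<omega>. (\<integral>\<^sup>+ s\<in>{0..T}. ennreal ((norm (H s \<omega> - G s \<omega>))\<^sup>2) \<partial>lborel) \<partial>M)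
    = sq_integral (M \<Otimes>\<^sub>M lborel) (\<lambda>z. cut T H z - cut T G z)"
proof -
  interpret pair_sigma_finite M lborel ..
  have "sq_integral (M \<Otimes>\<^sub>M lborel) (\<lambda>z. cut T H z - cut T G z)
    = (\<integral>\<^sup>+\<omega>. \<integral>\<^sup>+s. ennreal ((norm (cut T H (\<omega>, s) - cut T G (\<omega>, s)))\<^sup>2) \<partial>lborel \<partial>M)"
    by (rule lborel.nn_integral_fst[symmetric]) measurable
  also have "\<dots> = (\<integral>\<^sup>+ \<omega>. (\<integral>\<^sup>+ s\<in>{0..T}. ennreal ((norm (H s \<omega> - G s \<omega>))\<^sup>2) \<partial>lborel) \<partial>M)"
    by (intro nn_integral_cong) (auto simp: cut_def split: split_indicator)
  finally show ?thesis ..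
qed

lemma ito_integral_approximation:
  assumes I: "ito_integral M F W H I" and T: "0 \<le> T"
  shows "\<exists>Hn Jn. (\<forall>n. elementary (Hn n) (Jn n)) \<and>
    (\<lambda>n. \<integral>\<^sup>+z. ennreal ((norm (cut T (Hn n) z - cut T H z))\<^sup>2) \<partial>(M \<Otimes>\<^sub>M lborel)) \<longlonglongrightarrow> 0 \<and>
    (\<lambda>n. \<integral>\<^sup>+\<omega>. ennreal ((norm (Jn n T \<omega> - I T \<omega>))\<^sup>2) \<partial>M) \<longlonglongrightarrow> 0"
proof -
  have H: "cut T H \<in> borel_measurable (M \<Otimes>\<^sub>M lborel)"
    using I T by (rule ito_integral_cut_measurable)
  obtain Hn Jn where simple: "\<And>n. simple_ito_integral M F W (Hn n) (Jn n)"
    and 1: "(\<lambda>n. \<integral>\<^sup>+ \<omega>. (\<integral>\<^sup>+ s\<in>{0..T}. ennreal ((norm (Hn n s \<omega> - H s \<omega>))\<^sup>2) \<partial>lborel) \<partial>M) \<longlonglongrightarrow> 0"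
    and 2: "(\<lambda>n. \<integral>\<^sup>+ \<omega>. ennreal ((norm (Jn n T \<omega> - I T \<omega>))\<^sup>2) \<partial>M) \<longlonglongrightarrow> 0"
    using I T unfolding ito_integral_def by blast
  have E: "elementary (Hn n) (Jn n)" for n
    using simple by (rule simple_ito_integral_elementary)
  show ?thesis
    using E 1 2 unfolding nn_integral_cut[OF elementary_cut_measurable[OF E] H] by blast
qed

lemma ito_integral_measurable:
  "ito_integral M F W H I \<Longrightarrow> 0 \<le> t \<Longrightarrow> I t \<in> borel_measurable (F t)"
  by (simp add: ito_integral_def)

lemma ito_integral_measurable_M:
  "ito_integral M F W H I \<Longrightarrow> 0 \<le> t \<Longrightarrow> I t \<in> borel_measurable M"
  using ito_integral_measurable measurable_F_M by blast

text \<open>The approximating integrands for the time horizons \<open>t\<close> and \<open>T\<close> are unrelated in the definition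
  of the integral; the isometry for their difference reconciles them.\<close>

lemma ito_integral_approximation_upto:
  assumes I: "ito_integral M F W H I" and T: "0 \<le> T"
  shows "\<exists>Hn Jn. (\<forall>n. elementary (Hn n) (Jn n)) \<and>
    (\<lambda>n. \<integral>\<^sup>+z. ennreal ((norm (cut T (Hn n) z - cut T H z))\<^sup>2) \<partial>(M \<Otimes>\<^sub>M lborel)) \<longlonglongrightarrow> 0 \<and>
    (\<forall>t\<in>{0..T}. (\<lambda>n. \<integral>\<^sup>+\<omega>. ennreal ((norm (I t \<omega> - Jn n t \<omega>))\<^sup>2) \<partial>M) \<longlonglongrightarrow> 0)"
proof -
  obtain Hn Jn where E: "\<And>n. elementary (Hn n) (Jn n)"
    and H: "(\<lambda>n. \<integral>\<^sup>+z. ennreal ((norm (cut T (Hn n) z - cut T H z))\<^sup>2) \<partial>(M \<Otimes>\<^sub>M lborel)) \<longlonglongrightarrow> 0"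
    using ito_integral_approximation[OF I T] by blast
  have "(\<lambda>n. \<integral>\<^sup>+\<omega>. ennreal ((norm (I t \<omega> - Jn n t \<omega>))\<^sup>2) \<partial>M) \<longlonglongrightarrow> 0" if t: "t \<in> {0..T}" for t
  proof -
    obtain Hn' Jn' where E': "\<And>n. elementary (Hn' n) (Jn' n)"
      and H': "(\<lambda>n. \<integral>\<^sup>+z. ennreal ((norm (cut t (Hn' n) z - cut t H z))\<^sup>2) \<partial>(M \<Otimes>\<^sub>M lborel)) \<longlonglongrightarrow> 0"
      and J': "(\<lambda>n. \<integral>\<^sup>+\<omega>. ennreal ((norm (Jn' n t \<omega> - I t \<omega>))\<^sup>2) \<partial>M) \<longlonglongrightarrow> 0"
      using ito_integral_approximation[OF I, of t] t by auto
    let ?a = "\<lambda>n. \<integral>\<^sup>+z. ennreal ((norm (cut T (Hn n) z - cut T H z))\<^sup>2) \<partial>(M \<Otimes>\<^sub>M lborel)"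
    let ?b = "\<lambda>n. \<integral>\<^sup>+z. ennreal ((norm (cut t (Hn' n) z - cut t H z))\<^sup>2) \<partial>(M \<Otimes>\<^sub>M lborel)"
    let ?c = "\<lambda>n. \<integral>\<^sup>+\<omega>. ennreal ((norm (Jn' n t \<omega> - I t \<omega>))\<^sup>2) \<partial>M"
    have mH: "cut t H \<in> borel_measurable (M \<Otimes>\<^sub>M lborel)"
      using t by (intro ito_integral_cut_measurable[OF I]) auto
    have bound: "sq_integral M (\<lambda>\<omega>. I t \<omega> - Jn n t \<omega>) \<le> 2 * ?c n + 2 * (2 * ?a n + 2 * ?b n)" for n
    proof -
      have mJ: "Jn n t \<in> borel_measurable M" "Jn' n t \<in> borel_measurable M" "I t \<in> borel_measurable M"
        using elementary_adapted_M[OF E] elementary_adapted_M[OF E'] ito_integral_measurable_M[OF I] t by auto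
      have "sq_integral M (\<lambda>\<omega>. Jn' n t \<omega> - Jn n t \<omega>)
        = sq_integral (M \<Otimes>\<^sub>M lborel) (\<lambda>z. cut t (Hn' n) z - cut t (Hn n) z)"
        using elementary_isometry[OF elementary_diff[OF E' E]] by (simp add: cut_def scaleR_diff_right)
      also have "\<dots> \<le> 2 * ?b n
          + 2 * sq_integral (M \<Otimes>\<^sub>M lborel) (\<lambda>z. cut t H z - cut t (Hn n) z)"
        by (rule nn_integral_norm_sq_triangle[OF elementary_cut_measurable[OF E'] mH elementary_cut_measurable[OF E]])
      also have "sq_integral (M \<Otimes>\<^sub>M lborel) (\<lambda>z. cut t H z - cut t (Hn n) z) \<le> ?a n"
        using t by (intro nn_integral_mono) (auto simp: cut_def norm_minus_commute split: split_indicator)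
      finally have 1: "sq_integral M (\<lambda>\<omega>. Jn' n t \<omega> - Jn n t \<omega>) \<le> 2 * ?a n + 2 * ?b n"
        by (simp add: add.commute mult_left_mono add_mono)
      have "sq_integral M (\<lambda>\<omega>. I t \<omega> - Jn n t \<omega>)
        \<le> 2 * sq_integral M (\<lambda>\<omega>. I t \<omega> - Jn' n t \<omega>)
          + 2 * sq_integral M (\<lambda>\<omega>. Jn' n t \<omega> - Jn n t \<omega>)"
        by (rule nn_integral_norm_sq_triangle[OF mJ(3,2,1)])
      also have "\<dots> \<le> 2 * ?c n + 2 * (2 * ?a n + 2 * ?b n)"
        using 1 by (intro add_mono mult_left_mono) (auto simp: norm_minus_commute)
      finally show ?thesis .
    qed
    have "(\<lambda>n. 2 * ?c n + 2 * (2 * ?a n + 2 * ?b n)) \<longlonglongrightarrow> 2 * 0 + 2 * (2 * 0 + 2 * 0)"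
      by (intro tendsto_add ennreal_tendsto_cmult J' H H') auto
    then have "(\<lambda>n. 2 * ?c n + 2 * (2 * ?a n + 2 * ?b n)) \<longlonglongrightarrow> 0" by simp
    then show ?thesis by (rule tendsto_zero_ennreal_le[OF bound])
  qed
  with E H show ?thesis by blast
qed

text \<open>One and the same elementary pair approximates the integrand up to time \<open>t\<close>
  and the increment from \<open>s\<close> to \<open>t\<close>; this is what lets properties pass
  from elementary integrals to limits.\<close>

lemma ito_integral_close_elementary:
  assumes I: "ito_integral M F W H I" and t: "0 \<le> s" "s \<le> t" and e: "0 < (e::real)"
  shows "\<exists>G J. elementary G J \<and>
    sq_integral (M \<Otimes>\<^sub>M lborel) (\<lambda>z. cut t G z - cut t H z) \<le> ennreal e \<and>
    sq_integral M (\<lambda>\<omega>. (I t \<omega> - I s \<omega>) - (J t \<omega> - J s \<omega>)) \<le> ennreal e"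
proof -
  obtain Hn Jn where E: "\<And>n. elementary (Hn n) (Jn n)"
    and H: "(\<lambda>n. \<integral>\<^sup>+z. ennreal ((norm (cut t (Hn n) z - cut t H z))\<^sup>2) \<partial>(M \<Otimes>\<^sub>M lborel)) \<longlonglongrightarrow> 0"
    and J: "\<And>r. r \<in> {0..t} \<Longrightarrow> (\<lambda>n. \<integral>\<^sup>+\<omega>. ennreal ((norm (I r \<omega> - Jn n r \<omega>))\<^sup>2) \<partial>M) \<longlonglongrightarrow> 0"
    using ito_integral_approximation_upto[OF I order_trans[OF t(1) t(2)]] by blast
  \<comment> \<open>The errors at \<open>s\<close> and at \<open>t\<close> each enter with a factor
    2, so a quarter of \<open>e\<close> for each adds up to \<open>e\<close>.\<close>
  have e4: "0 < ennreal (e / 4)" "0 < ennreal e" using e by auto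
  have ts: "t \<in> {0..t}" "s \<in> {0..t}" using t by auto
  have "\<forall>\<^sub>F n in sequentially. elementary (Hn n) (Jn n) \<and>
    sq_integral (M \<Otimes>\<^sub>M lborel) (\<lambda>z. cut t (Hn n) z - cut t H z) \<le> ennreal e \<and>
    sq_integral M (\<lambda>\<omega>. (I t \<omega> - I s \<omega>) - (Jn n t \<omega> - Jn n s \<omega>)) \<le> ennreal e"
    using order_tendstoD(2)[OF H e4(2)] order_tendstoD(2)[OF J[OF ts(1)] e4(1)]
      order_tendstoD(2)[OF J[OF ts(2)] e4(1)]
  proof eventually_elim
    case (elim n)
    have m: "Jn n t \<in> borel_measurable M" "Jn n s \<in> borel_measurable M" "I t \<in> borel_measurable M" "I s \<in> borel_measurable M"
      using elementary_adapted_M[OF E] ito_integral_measurable_M[OF I] t by auto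
    have "sq_integral M (\<lambda>\<omega>. (I t \<omega> - I s \<omega>) - (Jn n t \<omega> - Jn n s \<omega>))
      = sq_integral M (\<lambda>\<omega>. (I t \<omega> - Jn n t \<omega>) - (I s \<omega> - Jn n s \<omega>))"
      by (simp add: algebra_simps)
    also have "\<dots> \<le> 2 * sq_integral M (\<lambda>\<omega>. (I t \<omega> - Jn n t \<omega>) - 0)
        + 2 * sq_integral M (\<lambda>\<omega>. 0 - (I s \<omega> - Jn n s \<omega>))"
      by (rule nn_integral_norm_sq_triangle) (use m in measurable)
    also have "\<dots> \<le> 2 * ennreal (e / 4) + 2 * ennreal (e / 4)"
      using elim(2,3) t by (intro add_mono mult_left_mono) (auto simp: norm_minus_commute)
    also have "\<dots> = ennreal e"
      using e by (simp add: ennreal_plus[symmetric] mult_2 del: ennreal_plus)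
    finally show ?case using E elim(1) by auto
  qed
  from eventually_happens'[OF sequentially_bot this] show ?thesis by blast
qed

text \<open>The isometry on an event of time \<open>s\<close>, in the form of an inequality. The
  approximating process restricted to \<open>A\<close> after time \<open>s\<close> is again
  elementary and has its own isometry; the weights \<open>1 + e\<close> of the two perturbations
  tend to 1, so the constant \<open>c\<close> survives.\<close>

lemma ito_integral_increment_bound:
  assumes I: "ito_integral M F W H I" and s: "0 \<le> s" "s \<le> t" and A: "A \<in> sets (F s)"
    and c: "sq_integral (M \<Otimes>\<^sub>M lborel) (\<lambda>z. (indicator A (fst z) * indicator {s<..} (snd z)) *\<^sub>R cut t H z)
      \<le> ennreal c" "0 \<le> c"
  shows "sq_integral M (\<lambda>\<omega>. indicator A \<omega> *\<^sub>R (I t \<omega> - I s \<omega>)) \<le> ennreal c"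
    (is "?L \<le> _")
proof -
  have AM [measurable]: "A \<in> sets M" using A s(1) sets_F_subset by blast
  let ?w = "\<lambda>z. indicator A (fst z) * indicator {s<..} (snd z) :: real"
  have mH [measurable]: "cut t H \<in> borel_measurable (M \<Otimes>\<^sub>M lborel)"
    using I order_trans[OF s(1) s(2)] by (rule ito_integral_cut_measurable)
  have [measurable]: "I t \<in> borel_measurable M" "I s \<in> borel_measurable M"
    using ito_integral_measurable_M[OF I] s by auto
  \<comment> \<open>The approximation is taken within \<open>e\<^sup>2\<close> because the error
    carries the weight \<open>1 + 1 / e\<close>; the product \<open>e\<^sup>2 + e\<close> still
    vanishes with \<open>e\<close>.\<close>
  have bound: "?L \<le> ennreal ((1 + e) * ((1 + e) * c + (1 + 1 / e) * e\<^sup>2) + (1 + 1 / e) * e\<^sup>2)"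
    if e: "0 < e" for e :: real
  proof -
    obtain G J where E: "elementary G J"
      and G: "sq_integral (M \<Otimes>\<^sub>M lborel) (\<lambda>z. cut t G z - cut t H z) \<le> ennreal (e\<^sup>2)"
      and J: "sq_integral M (\<lambda>\<omega>. (I t \<omega> - I s \<omega>) - (J t \<omega> - J s \<omega>)) \<le> ennreal (e\<^sup>2)"
      using ito_integral_close_elementary[OF I s, of "e\<^sup>2"] e by auto
    have mG [measurable]: "cut t G \<in> borel_measurable (M \<Otimes>\<^sub>M lborel)"
      by (rule elementary_cut_measurable[OF E])
    have [measurable]: "J t \<in> borel_measurable M" "J s \<in> borel_measurable M"
      using elementary_adapted_M[OF E] s by auto
    have "sq_integral M (\<lambda>\<omega>. indicator A \<omega> *\<^sub>R (J t \<omega> - J s \<omega>))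
      = sq_integral (M \<Otimes>\<^sub>M lborel) (\<lambda>z. ?w z *\<^sub>R cut t G z)"
      using elementary_isometry[OF elementary_restrict[OF E s(1) A], of t] s(2)
      by (simp add: cut_def min_def mult.commute mult.left_commute)
    also have "\<dots> \<le> ennreal (1 + e) * sq_integral (M \<Otimes>\<^sub>M lborel) (\<lambda>z. ?w z *\<^sub>R cut t H z)
        + ennreal (1 + 1 / e) * sq_integral (M \<Otimes>\<^sub>M lborel) (\<lambda>z. ?w z *\<^sub>R cut t G z - ?w z *\<^sub>R cut t H z)"
      by (rule nn_integral_norm_sq_perturb[OF _ _ e]) measurable
    also have "\<dots> \<le> ennreal (1 + e) * ennreal c + ennreal (1 + 1 / e) * ennreal (e\<^sup>2)"
    proof (intro add_mono mult_left_mono c(1))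
      have "sq_integral (M \<Otimes>\<^sub>M lborel) (\<lambda>z. ?w z *\<^sub>R cut t G z - ?w z *\<^sub>R cut t H z)
        \<le> sq_integral (M \<Otimes>\<^sub>M lborel) (\<lambda>z. cut t G z - cut t H z)"
        by (intro nn_integral_mono) (auto split: split_indicator)
      also note G
      finally show "sq_integral (M \<Otimes>\<^sub>M lborel) (\<lambda>z. ?w z *\<^sub>R cut t G z - ?w z *\<^sub>R cut t H z)
        \<le> ennreal (e\<^sup>2)" .
    qed auto
    also have "\<dots> = ennreal ((1 + e) * c + (1 + 1 / e) * e\<^sup>2)"
      using e c(2) by (simp add: ennreal_mult[symmetric] ennreal_plus[symmetric] del: ennreal_plus)
    finally have JJ: "sq_integral M (\<lambda>\<omega>. indicator A \<omega> *\<^sub>R (J t \<omega> - J s \<omega>))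
      \<le> ennreal ((1 + e) * c + (1 + 1 / e) * e\<^sup>2)" .
    have "?L \<le> ennreal (1 + e) * sq_integral M (\<lambda>\<omega>. indicator A \<omega> *\<^sub>R (J t \<omega> - J s \<omega>))
      + ennreal (1 + 1 / e) * sq_integral M (\<lambda>\<omega>. indicator A \<omega> *\<^sub>R (I t \<omega> - I s \<omega>)
          - indicator A \<omega> *\<^sub>R (J t \<omega> - J s \<omega>))"
      by (rule nn_integral_norm_sq_perturb[OF _ _ e]) measurable
    also have "\<dots> \<le> ennreal (1 + e) * ennreal ((1 + e) * c + (1 + 1 / e) * e\<^sup>2) + ennreal (1 + 1 / e) * ennreal (e\<^sup>2)"
    proof (intro add_mono mult_left_mono JJ)
      have "sq_integral M (\<lambda>\<omega>. indicator A \<omega> *\<^sub>R (I t \<omega> - I s \<omega>)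
          - indicator A \<omega> *\<^sub>R (J t \<omega> - J s \<omega>))
        \<le> sq_integral M (\<lambda>\<omega>. (I t \<omega> - I s \<omega>) - (J t \<omega> - J s \<omega>))"
        by (intro nn_integral_mono) (auto split: split_indicator)
      also note J
      finally show "sq_integral M (\<lambda>\<omega>. indicator A \<omega> *\<^sub>R (I t \<omega> - I s \<omega>)
          - indicator A \<omega> *\<^sub>R (J t \<omega> - J s \<omega>)) \<le> ennreal (e\<^sup>2)" .
    qed auto
    also have "\<dots> = ennreal ((1 + e) * ((1 + e) * c + (1 + 1 / e) * e\<^sup>2) + (1 + 1 / e) * e\<^sup>2)"
      using e c(2) by (simp add: ennreal_mult[symmetric] ennreal_plus[symmetric] del: ennreal_plus)
    finally show ?thesis .
  qed
  have "?L < \<infinity>" using bound[of 1] by (auto intro: le_less_trans)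
  then obtain l where l: "?L = ennreal l" "0 \<le> l" by (cases ?L) auto
  have "l \<le> c"
  proof (rule le_of_le_perturbed)
    fix e :: real assume e: "0 < e"
    have "0 \<le> (1 + e) * ((1 + e) * c + (1 + 1 / e) * e\<^sup>2) + (1 + 1 / e) * e\<^sup>2"
      using e c(2) by simp
    then have "l \<le> (1 + e) * ((1 + e) * c + (1 + 1 / e) * e\<^sup>2) + (1 + 1 / e) * e\<^sup>2"
      using bound[OF e] unfolding l(1) by simp
    also have "(1 + 1 / e) * e\<^sup>2 = e\<^sup>2 + e" using e by (simp add: field_simps power2_eq_square)
    finally show "l \<le> (1 + e) * ((1 + e) * c + (e\<^sup>2 + e)) + (e\<^sup>2 + e)" .
  next
    show "((\<lambda>e. (1 + e) * ((1 + e) * c + (e\<^sup>2 + e)) + (e\<^sup>2 + e)) \<longlongrightarrow> c) (at_right 0)"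
      by (auto intro!: tendsto_eq_intros)
  qed
  then show ?thesis unfolding l(1) by (rule ennreal_leI)
qed

text \<open>The martingale property in weak form. Elementary increments are exactly orthogonal to
  \<open>Z\<close>, so only the approximation error is left to be estimated against
  \<open>Z\<close>.\<close>

lemma ito_integral_orthogonal:
  fixes Z :: "'a \<Rightarrow> real ^ 'd"
  assumes I: "ito_integral M F W H I" and s: "0 \<le> s" "s \<le> t"
    and Z: "Z \<in> borel_measurable (F s)" "integrable M (\<lambda>\<omega>. (norm (Z \<omega>))\<^sup>2)"
    and D: "integrable M (\<lambda>\<omega>. (norm (I t \<omega> - I s \<omega>))\<^sup>2)"
  shows "integrable M (\<lambda>\<omega>. Z \<omega> \<bullet> (I t \<omega> - I s \<omega>))"
    and "expectation (\<lambda>\<omega>. Z \<omega> \<bullet> (I t \<omega> - I s \<omega>)) = 0"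
proof -
  have ZM [measurable]: "Z \<in> borel_measurable M" using Z(1) s(1) by (rule measurable_F_M)
  have [measurable]: "I t \<in> borel_measurable M" "I s \<in> borel_measurable M"
    using ito_integral_measurable_M[OF I] s by auto
  show int: "integrable M (\<lambda>\<omega>. Z \<omega> \<bullet> (I t \<omega> - I s \<omega>))"
    by (rule integrable_inner_of_square_integrable) (use Z D in auto)
  have Z1: "integrable M Z"
  proof (rule Bochner_Integration.integrable_bound)
    show "integrable M (\<lambda>\<omega>. (norm (Z \<omega>))\<^sup>2 + 1)" using Z(2) by simp
    have "norm (Z \<omega>) \<le> (norm (Z \<omega>))\<^sup>2 + 1" for \<omega>
      using sum_squares_bound[of "norm (Z \<omega>)" 1] norm_ge_zero[of "Z \<omega>"]
      unfolding mult_1_right power_one by linarith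
    then show "AE \<omega> in M. norm (Z \<omega>) \<le> norm ((norm (Z \<omega>))\<^sup>2 + 1)" by simp
  qed simp
  define z where "z = expectation (\<lambda>\<omega>. (norm (Z \<omega>))\<^sup>2)"
  have z: "sq_integral M Z = ennreal z" "0 \<le> z"
    using Z(2) unfolding z_def by (auto intro: nn_integral_eq_integral)
  have "\<bar>expectation (\<lambda>\<omega>. Z \<omega> \<bullet> (I t \<omega> - I s \<omega>))\<bar> \<le> 0"
  proof (rule le_of_le_perturbed)
    fix e :: real assume e: "0 < e"
    obtain G J where E: "elementary G J"
      and J: "sq_integral M (\<lambda>\<omega>. (I t \<omega> - I s \<omega>) - (J t \<omega> - J s \<omega>)) \<le> ennreal (e\<^sup>2)"
      using ito_integral_close_elementary[OF I s, of "e\<^sup>2"] e by auto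
    have [measurable]: "J t \<in> borel_measurable M" "J s \<in> borel_measurable M"
      using elementary_adapted_M[OF E] s by auto
    let ?D = "\<lambda>\<omega>. (I t \<omega> - I s \<omega>) - (J t \<omega> - J s \<omega>)"
    note o = elementary_orthogonal[OF E s Z(1) Z1 Z(2)]
    have "expectation (\<lambda>\<omega>. Z \<omega> \<bullet> (I t \<omega> - I s \<omega>))
        = expectation (\<lambda>\<omega>. Z \<omega> \<bullet> (I t \<omega> - I s \<omega>) - Z \<omega> \<bullet> (J t \<omega> - J s \<omega>))"
      using int o by simp
    also have "\<dots> = expectation (\<lambda>\<omega>. Z \<omega> \<bullet> ?D \<omega>)" by (simp add: inner_diff_right)
    finally have eq: "expectation (\<lambda>\<omega>. Z \<omega> \<bullet> (I t \<omega> - I s \<omega>)) = expectation (\<lambda>\<omega>. Z \<omega> \<bullet> ?D \<omega>)" .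
    have "ennreal \<bar>expectation (\<lambda>\<omega>. Z \<omega> \<bullet> ?D \<omega>)\<bar> \<le> (\<integral>\<^sup>+\<omega>. ennreal (norm (Z \<omega> \<bullet> ?D \<omega>)) \<partial>M)"
      using integral_norm_bound_ennreal[of M "\<lambda>\<omega>. Z \<omega> \<bullet> ?D \<omega>"] int o by (simp add: inner_diff_right)
    also have "\<dots> \<le> (\<integral>\<^sup>+\<omega>. ennreal e * ennreal ((norm (Z \<omega>))\<^sup>2) + ennreal (1 / e) * ennreal ((norm (?D \<omega>))\<^sup>2) \<partial>M)"
    proof (rule nn_integral_mono)
      fix \<omega>
      have "norm (Z \<omega> \<bullet> ?D \<omega>) \<le> norm (Z \<omega>) * norm (?D \<omega>)" by (simp add: Cauchy_Schwarz_ineq2)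
      \<comment> \<open>Young's inequality with weights \<open>e\<close> and \<open>1 / e\<close>;
        as the squared error integrates to at most \<open>e\<^sup>2\<close>, the total is of order
        \<open>e\<close>.\<close>
      also have "\<dots> \<le> e * (norm (Z \<omega>))\<^sup>2 + 1 / e * (norm (?D \<omega>))\<^sup>2"
      proof -
        define a b where "a = norm (Z \<omega>)" and "b = norm (?D \<omega>)"
        have "0 \<le> (e * a - b)\<^sup>2 / e" using e by simp
        also have "\<dots> = e * a\<^sup>2 - 2 * (a * b) + 1 / e * b\<^sup>2" using e by (simp add: power2_eq_square field_simps)
        finally have "2 * (a * b) \<le> e * a\<^sup>2 + 1 / e * b\<^sup>2" by simp
        moreover have "0 \<le> a * b" by (simp add: a_def b_def)
        ultimately show ?thesis unfolding a_def b_def by linarith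
      qed
      finally have "ennreal (norm (Z \<omega> \<bullet> ?D \<omega>)) \<le> ennreal (e * (norm (Z \<omega>))\<^sup>2 + 1 / e * (norm (?D \<omega>))\<^sup>2)"
        by (rule ennreal_leI)
      also have "\<dots> = ennreal (e * (norm (Z \<omega>))\<^sup>2) + ennreal (1 / e * (norm (?D \<omega>))\<^sup>2)"
        using e by (intro ennreal_plus) auto
      also have "\<dots> = ennreal e * ennreal ((norm (Z \<omega>))\<^sup>2) + ennreal (1 / e) * ennreal ((norm (?D \<omega>))\<^sup>2)"
        using e by (intro arg_cong2[where f = "(+)"] ennreal_mult) auto
      finally show "ennreal (norm (Z \<omega> \<bullet> ?D \<omega>))
        \<le> ennreal e * ennreal ((norm (Z \<omega>))\<^sup>2) + ennreal (1 / e) * ennreal ((norm (?D \<omega>))\<^sup>2)" .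
    qed
    also have "\<dots> = ennreal e * ennreal z + ennreal (1 / e) * sq_integral M (\<lambda>\<omega>. ?D \<omega>)"
      by (subst nn_integral_add) (simp_all add: nn_integral_cmult z(1))
    also have "\<dots> \<le> ennreal e * ennreal z + ennreal (1 / e) * ennreal (e\<^sup>2)"
      using J by (intro add_left_mono mult_left_mono) auto
    also have "\<dots> = ennreal (e * z + 1 / e * e\<^sup>2)"
      using e z(2) by (simp add: ennreal_mult[symmetric] ennreal_plus[symmetric] del: ennreal_plus)
    also have "e * z + 1 / e * e\<^sup>2 = e * (z + 1)" using e by (simp add: power2_eq_square field_simps)
    finally show "\<bar>expectation (\<lambda>\<omega>. Z \<omega> \<bullet> (I t \<omega> - I s \<omega>))\<bar> \<le> e * (z + 1)"
      using e z(2) unfolding eq by simp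
  next
    show "((\<lambda>e. e * (z + 1)) \<longlongrightarrow> 0) (at_right 0)" by (auto intro!: tendsto_eq_intros)
  qed
  then show "expectation (\<lambda>\<omega>. Z \<omega> \<bullet> (I t \<omega> - I s \<omega>)) = 0" by simp
qed

end

section \<open>The energy estimate\<close>

text \<open>This replaces It\^o's formula for \<open>\<parallel>x - y\<parallel>\<^sup>2\<close>: apart from the last term, the noise \<open>i\<close> enters only
  through products of its increments with earlier quantities, whose expectations vanish.\<close>

lemma norm_sq_integral_equation:
  fixes x b i :: "real \<Rightarrow> 'b::euclidean_space"
  assumes st: "s \<le> t" and b: "continuous_on {s..t} b" and i: "continuous_on {s..t} i"
    and x: "\<And>r. r \<in> {s..t} \<Longrightarrow> x r = x s + integral {s..r} b + (i r - i s)"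
  shows "(norm (x t - y))\<^sup>2 = (norm (x s - y))\<^sup>2 + 2 * integral {s..t} (\<lambda>r. (x r - y) \<bullet> b r)
    + 2 * integral {s..t} (\<lambda>r. b r \<bullet> (i t - i r)) + 2 * ((x s - y) \<bullet> (i t - i s)) + (norm (i t - i s))\<^sup>2"
proof -
  define B where "B r = integral {s..r} b" for r
  define k where "k = x s - y"
  define D where "D = i t - i s"
  have B: "(B has_vector_derivative b r) (at r within {s..t})" if "r \<in> {s..t}" for r
    unfolding B_def using b that by (rule integral_has_vector_derivative)
  have cB: "continuous_on {s..t} B"
    unfolding B_def by (rule indefinite_integral_continuous_1[OF integrable_continuous_real[OF b]])
  have "((\<lambda>r. (k + B r) \<bullet> (k + B r)) has_vector_derivative 2 * ((k + B r) \<bullet> b r)) (at r within {s..t})"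
    if "r \<in> {s..t}" for r
  proof -
    have "((\<lambda>r. k + B r) has_vector_derivative b r) (at r within {s..t})"
      using B[OF that] by (auto intro!: derivative_eq_intros)
    from bounded_bilinear.has_vector_derivative[OF bounded_bilinear_inner this this]
    show ?thesis by (simp add: inner_commute)
  qed
  then have "((\<lambda>r. 2 * ((k + B r) \<bullet> b r)) has_integral
      (k + B t) \<bullet> (k + B t) - (k + B s) \<bullet> (k + B s)) {s..t}"
    by (rule fundamental_theorem_of_calculus[OF st])
  moreover have "B s = 0" by (simp add: B_def)
  ultimately have "((\<lambda>r. 2 * ((k + B r) \<bullet> b r)) has_integral (k + B t) \<bullet> (k + B t) - k \<bullet> k) {s..t}"
    by simp
  from integral_unique[OF this]
  have N: "2 * integral {s..t} (\<lambda>r. (k + B r) \<bullet> b r) = (k + B t) \<bullet> (k + B t) - k \<bullet> k" by simp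
  have BD: "B t \<bullet> D = integral {s..t} (\<lambda>r. b r \<bullet> D)"
    using integral_linear[OF integrable_continuous_real[OF b] bounded_linear_inner_left[of D]]
    by (simp add: B_def comp_def)
  have xB: "x r - y = k + B r + (i r - i s)" if "r \<in> {s..t}" for r
    using x[OF that] by (simp add: k_def B_def)
  have "integral {s..t} (\<lambda>r. (x r - y) \<bullet> b r) + integral {s..t} (\<lambda>r. b r \<bullet> (i t - i r))
      = integral {s..t} (\<lambda>r. (k + B r + (i r - i s)) \<bullet> b r) + integral {s..t} (\<lambda>r. b r \<bullet> (i t - i r))"
    using xB by (intro arg_cong2[where f = "(+)"] integral_cong) auto
  also have "\<dots> = integral {s..t} (\<lambda>r. (k + B r + (i r - i s)) \<bullet> b r + b r \<bullet> (i t - i r))"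
    using b i cB
    by (intro integral_add[symmetric] integrable_continuous_real continuous_intros)
  \<comment> \<open>The past increment \<open>i r - i s\<close> and the future increment
    \<open>i t - i r\<close> add up to \<open>D\<close>, which does not depend on \<open>r\<close>.
    This is how the drift term evaluated along \<open>x\<close> is traded for a term with future
    noise only.\<close>
  also have "\<dots> = integral {s..t} (\<lambda>r. (k + B r) \<bullet> b r + b r \<bullet> D)"
    by (simp add: D_def inner_add_left inner_diff_left inner_diff_right inner_commute algebra_simps)
  also have "\<dots> = integral {s..t} (\<lambda>r. (k + B r) \<bullet> b r) + integral {s..t} (\<lambda>r. b r \<bullet> D)"
    using b cB by (intro integral_add integrable_continuous_real continuous_intros)
  finally have sum: "integral {s..t} (\<lambda>r. (x r - y) \<bullet> b r) + integral {s..t} (\<lambda>r. b r \<bullet> (i t - i r))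
      = integral {s..t} (\<lambda>r. (k + B r) \<bullet> b r) + B t \<bullet> D"
    by (simp add: BD)
  have "x t - y = (k + B t) + D" using xB[of t] st by (simp add: D_def)
  then have "(norm (x t - y))\<^sup>2 = (k + B t) \<bullet> (k + B t) + 2 * (B t \<bullet> D) + 2 * (k \<bullet> D) + (norm D)\<^sup>2"
    by (simp add: power2_norm_eq_inner inner_add_left inner_add_right inner_commute)
  also have "(k + B t) \<bullet> (k + B t) = k \<bullet> k + 2 * integral {s..t} (\<lambda>r. (k + B r) \<bullet> b r)"
    using N by simp
  finally show ?thesis
    using sum unfolding power2_norm_eq_inner k_def[symmetric] D_def[symmetric] by simp
qed

text \<open>Sampling at the grid point \<open>?a n\<close> just below the time leaves countably many
  values of time, for which measurability is clear; path continuity gives the pointwise limit.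
  Negative times are sent to 0 to obtain a function on the whole line.\<close>

lemma continuous_process_jointly_measurable:
  fixes Z :: "real \<Rightarrow> 'a \<Rightarrow> 'b::{second_countable_topology, metric_space}"
  assumes Z: "\<And>t. 0 \<le> t \<Longrightarrow> Z t \<in> borel_measurable M"
    and cont: "\<And>\<omega>. \<omega> \<in> space M \<Longrightarrow> continuous_on {0..} (\<lambda>t. Z t \<omega>)"
  shows "(\<lambda>z. Z (max 0 (snd z)) (fst z)) \<in> borel_measurable (M \<Otimes>\<^sub>M lborel)"
proof (rule borel_measurable_LIMSEQ_metric)
  let ?k = "\<lambda>n z. nat \<lfloor>real (Suc n) * max 0 (snd z)\<rfloor>"
  let ?a = "\<lambda>n z. real (?k n z) / real (Suc n)"
  show "(\<lambda>z. Z (?a n z) (fst z)) \<in> borel_measurable (M \<Otimes>\<^sub>M lborel)" for n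
  proof (rule measurable_compose_countable[where g = "?k n"
        and f = "\<lambda>i z. Z (real i / real (Suc n)) (fst z)"])
    show "(\<lambda>z. Z (real i / real (Suc n)) (fst z)) \<in> borel_measurable (M \<Otimes>\<^sub>M lborel)" for i
      by (rule measurable_compose[OF measurable_fst Z]) simp
    show "?k n \<in> M \<Otimes>\<^sub>M lborel \<rightarrow>\<^sub>M count_space UNIV" by measurable
  qed
  fix z assume z: "z \<in> space (M \<Otimes>\<^sub>M (lborel :: real measure))"
  let ?r = "max 0 (snd z)"
  have lim: "(\<lambda>n. ?a n z) \<longlonglongrightarrow> ?r"
  proof (rule tendsto_sandwich)
    show "\<forall>\<^sub>F n in sequentially. ?a n z \<le> ?r"
      by (intro always_eventually allI) (simp add: pos_divide_le_eq mult.commute)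
    show "\<forall>\<^sub>F n in sequentially. ?r - 1 / real (Suc n) \<le> ?a n z"
    proof (intro always_eventually allI)
      fix n
      have "real (Suc n) * ?r - 1 \<le> real (?k n z)" by linarith
      then have "(real (Suc n) * ?r - 1) / real (Suc n) \<le> ?a n z" by (intro divide_right_mono) auto
      then show "?r - 1 / real (Suc n) \<le> ?a n z" by (simp add: diff_divide_distrib)
    qed
    show "(\<lambda>n. ?r - 1 / real (Suc n)) \<longlonglongrightarrow> ?r"
      using tendsto_diff[OF tendsto_const[of ?r] LIMSEQ_inverse_real_of_nat] by (simp add: inverse_eq_divide)
  qed simp
  have "fst z \<in> space M" using z by (auto simp: space_pair_measure)
  from cont[OF this] show "(\<lambda>n. Z (?a n z) (fst z)) \<longlonglongrightarrow> Z ?r (fst z)"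
    by (rule continuous_on_tendsto_compose[OF _ lim]) auto
qed

section \<open>The gradient equation: noise, drift and their cross term\<close>

locale gradient_sde = brownian_motion M F W + quadratically_bounded_convex \<Phi> c
  for M :: "'a measure" and F :: "real \<Rightarrow> 'a measure" and W :: "real \<Rightarrow> 'a \<Rightarrow> real ^ 'm"
    and \<Phi> :: "real ^ 'd \<Rightarrow> real" and c :: real +
  fixes \<sigma> :: "real \<Rightarrow> real ^ 'd \<Rightarrow> real ^ 'm ^ 'd" and x0 :: "real ^ 'd"
    and X I :: "real \<Rightarrow> 'a \<Rightarrow> real ^ 'd" and \<rho> :: "real \<Rightarrow> real" and xmin :: "real ^ 'd"
  assumes X_adapted: "\<And>t. 0 \<le> t \<Longrightarrow> X t \<in> borel_measurable (F t)"
    and X_continuous: "\<And>\<omega>. \<omega> \<in> space M \<Longrightarrow> continuous_on {0..} (\<lambda>t. X t \<omega>)"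
    and X_square_bounded: "\<And>T. 0 \<le> T \<Longrightarrow>
      \<exists>C\<ge>0. \<forall>t\<in>{0..T}. sq_integral M (X t) \<le> ennreal C"
    and ito: "ito_integral M F W (\<lambda>t \<omega>. \<sigma> t (X t \<omega>)) I"
    and sde: "AE \<omega> in M. \<forall>t\<ge>0. X t \<omega> = x0 + (LINT s:{0..t}|lborel. - grad \<Phi> (X s \<omega>)) + I t \<omega>"
    and sigma_le: "\<And>t x. 0 \<le> t \<Longrightarrow> (norm (\<sigma> t x))\<^sup>2 \<le> \<rho> t"
    and rho_integrable: "set_integrable lborel {0..} \<rho>"
    and xmin: "xmin \<in> argmin \<Phi>"
begin

lemma xmin_le: "\<Phi> xmin \<le> \<Phi> x"
  using xmin by (auto simp: argmin_def is_arg_min_def not_less)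

lemma argmin_iff: "y \<in> argmin \<Phi> \<longleftrightarrow> \<Phi> y = \<Phi> xmin"
  using xmin_le xmin by (auto simp: argmin_def is_arg_min_def not_less intro: antisym)

lemma X_measurable [measurable]: "0 \<le> t \<Longrightarrow> X t \<in> borel_measurable M"
  using X_adapted measurable_F_M by blast

lemma I_measurable_M [measurable]: "0 \<le> t \<Longrightarrow> I t \<in> borel_measurable M"
  using ito ito_integral_measurable_M by blast

lemma I_continuous: "\<omega> \<in> space M \<Longrightarrow> continuous_on {0..} (\<lambda>t. I t \<omega>)"
  using ito by (auto simp: ito_integral_def)

lemma rho_nonneg: "0 \<le> t \<Longrightarrow> 0 \<le> \<rho> t"
  using sigma_le[of t] by (meson order_trans zero_le_power2)

lemma rho_integrable_subset: "A \<subseteq> {0..} \<Longrightarrow> A \<in> sets borel \<Longrightarrow> set_integrable lborel A \<rho>"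
  using set_integrable_subset[OF rho_integrable] by simp

definition tail :: "real \<Rightarrow> real" where
  "tail s = (LINT r:{s<..}|lborel. \<rho> r)"

lemma tail_nonneg: "0 \<le> s \<Longrightarrow> 0 \<le> tail s"
  unfolding tail_def set_lebesgue_integral_def
  by (intro integral_nonneg_AE AE_I2) (auto simp: rho_nonneg split: split_indicator)

lemma tail_diff:
  assumes "0 \<le> s" "s \<le> t"
  shows "(LINT r:{s<..t}|lborel. \<rho> r) = tail s - tail t"
proof -
  have "(LINT r:{s<..t} \<union> {t<..}|lborel. \<rho> r) = (LINT r:{s<..t}|lborel. \<rho> r) + tail t"
    unfolding tail_def using assms by (intro set_integral_Un rho_integrable_subset) auto
  moreover have "{s<..t} \<union> {t<..} = {s<..}" using assms by auto
  ultimately show ?thesis by (simp add: tail_def)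
qed

lemma tail_antimono: "0 \<le> s \<Longrightarrow> s \<le> t \<Longrightarrow> tail t \<le> tail s"
proof -
  assume st: "0 \<le> s" "s \<le> t"
  have "0 \<le> (LINT r:{s<..t}|lborel. \<rho> r)"
    unfolding set_lebesgue_integral_def using st
    by (intro integral_nonneg_AE AE_I2) (auto simp: rho_nonneg split: split_indicator)
  then show ?thesis using tail_diff[OF st] by simp
qed

lemma tail_tendsto: "(\<lambda>n::nat. tail (real n)) \<longlonglongrightarrow> 0"
proof -
  define f where "f r = indicator {0..} r *\<^sub>R \<rho> r" for r
  have int: "integrable lborel f" using rho_integrable by (simp add: set_integrable_def f_def[abs_def])
  have eq: "indicator {real n<..} r *\<^sub>R \<rho> r = indicator {real n<..} r * f r" for n r
    by (auto simp: f_def split: split_indicator)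
  have "(\<lambda>n::nat. integral\<^sup>L lborel (\<lambda>r. indicator {real n<..} r * f r)) \<longlonglongrightarrow> integral\<^sup>L lborel (\<lambda>r :: real. 0)"
  proof (rule integral_dominated_convergence)
    show "integrable lborel (\<lambda>r. norm (f r))" using int by simp
    have "(\<lambda>n. indicator {real n<..} r * f r) \<longlonglongrightarrow> 0" for r
    proof (rule tendsto_eventually)
      obtain N :: nat where "r \<le> real N" using real_arch_simple by blast
      then show "\<forall>\<^sub>F n in sequentially. indicator {real n<..} r * f r = 0"
        by (auto simp: eventually_sequentially intro!: exI[of _ N])
    qed
    then show "AE r in lborel. (\<lambda>n. indicator {real n<..} r * f r) \<longlonglongrightarrow> 0" by simp
    show "AE r in lborel. norm (indicator {real n<..} r * f r) \<le> norm (f r)" for n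
      by (auto split: split_indicator)
  qed (use int in auto)
  then show ?thesis unfolding tail_def set_lebesgue_integral_def eq by simp
qed

text \<open>The bound \<rho> is deterministic, so the integral over \<open>A\<close> and
  \<open>{s<..t}\<close> factors. Keeping the factor \<open>prob A\<close> is what makes the
  estimate conditional on the past of \<open>s\<close>.\<close>

lemma noise_increment_bound:
  assumes s: "0 \<le> s" "s \<le> t" and A: "A \<in> sets (F s)"
  shows "sq_integral M (\<lambda>\<omega>. indicator A \<omega> *\<^sub>R (I t \<omega> - I s \<omega>))
    \<le> ennreal (prob A * (tail s - tail t))"
proof (rule ito_integral_increment_bound[OF ito s A])
  have [measurable]: "A \<in> sets M" using A s(1) sets_F_subset by blast
  define f where "f r = indicator {s<..t} r *\<^sub>R \<rho> r" for r
  have "{s<..t} \<subseteq> {0..}" using s by auto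
  from rho_integrable_subset[OF this]
  have int: "integrable lborel f" by (simp add: set_integrable_def f_def[abs_def])
  have [measurable]: "f \<in> borel_measurable lborel" using int by (rule borel_measurable_integrable)
  interpret pair_sigma_finite M lborel ..
  have "sq_integral (M \<Otimes>\<^sub>M lborel) (\<lambda>z. (indicator A (fst z) * indicator {s<..} (snd z)) *\<^sub>R
      cut t (\<lambda>t \<omega>. \<sigma> t (X t \<omega>)) z)
    \<le> (\<integral>\<^sup>+z. indicator A (fst z) * ennreal (f (snd z)) \<partial>(M \<Otimes>\<^sub>M lborel))"
    using s sigma_le
    by (intro nn_integral_mono) (auto simp: cut_def f_def split: split_indicator intro!: ennreal_leI)
  also have "\<dots> = (\<integral>\<^sup>+\<omega>. \<integral>\<^sup>+r. indicator A \<omega> * ennreal (f r) \<partial>lborel \<partial>M)"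
    by (subst lborel.nn_integral_fst[symmetric]) auto
  also have "\<dots> = (\<integral>\<^sup>+\<omega>. indicator A \<omega> * (\<integral>\<^sup>+r. ennreal (f r) \<partial>lborel) \<partial>M)"
    by (intro nn_integral_cong nn_integral_cmult) measurable
  also have "\<dots> = emeasure M A * (\<integral>\<^sup>+r. ennreal (f r) \<partial>lborel)"
    by (simp add: nn_integral_multc)
  also have "(\<integral>\<^sup>+r. ennreal (f r) \<partial>lborel) = ennreal (tail s - tail t)"
    unfolding tail_diff[OF s, symmetric] set_lebesgue_integral_def f_def[symmetric] using s
    by (intro nn_integral_eq_integral int AE_I2) (auto simp: f_def rho_nonneg split: split_indicator)
  also have "emeasure M A * ennreal (tail s - tail t) = ennreal (prob A * (tail s - tail t))"
    using tail_antimono[OF s] by (simp add: emeasure_eq_measure ennreal_mult)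
  finally show "sq_integral (M \<Otimes>\<^sub>M lborel) (\<lambda>z. (indicator A (fst z) * indicator {s<..} (snd z)) *\<^sub>R
      cut t (\<lambda>t \<omega>. \<sigma> t (X t \<omega>)) z) \<le> ennreal (prob A * (tail s - tail t))" .
  show "0 \<le> prob A * (tail s - tail t)" using tail_antimono[OF s] by simp
qed

lemma noise_increment_square_integrable:
  assumes s: "0 \<le> s" "s \<le> t"
  shows "integrable M (\<lambda>\<omega>. (norm (I t \<omega> - I s \<omega>))\<^sup>2)"
proof (rule integrableI_bounded)
  have "space M \<in> sets (F s)" using space_F[OF s(1)] sets.top[of "F s"] by simp
  from noise_increment_bound[OF s this]
  have "sq_integral M (\<lambda>\<omega>. indicator (space M) \<omega> *\<^sub>R (I t \<omega> - I s \<omega>)) < \<infinity>"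
    by (auto intro: le_less_trans)
  also have "sq_integral M (\<lambda>\<omega>. indicator (space M) \<omega> *\<^sub>R (I t \<omega> - I s \<omega>))
    = (\<integral>\<^sup>+\<omega>. ennreal (norm ((norm (I t \<omega> - I s \<omega>))\<^sup>2)) \<partial>M)"
    by (intro nn_integral_cong) simp
  finally show "(\<integral>\<^sup>+\<omega>. ennreal (norm ((norm (I t \<omega> - I s \<omega>))\<^sup>2)) \<partial>M) < \<infinity>" .
  show "(\<lambda>\<omega>. (norm (I t \<omega> - I s \<omega>))\<^sup>2) \<in> borel_measurable M"
    using I_measurable_M[of t] I_measurable_M[of s] s by simp
qed

lemma X_square_integrable:
  assumes "0 \<le> t"
  shows "integrable M (\<lambda>\<omega>. (norm (X t \<omega>))\<^sup>2)"
proof (rule integrableI_bounded)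
  obtain C where "0 \<le> C" "\<And>r. r \<in> {0..t} \<Longrightarrow> sq_integral M (X r) \<le> ennreal C"
    using X_square_bounded[OF assms] by blast
  from this(2)[of t] assms show "(\<integral>\<^sup>+\<omega>. ennreal (norm ((norm (X t \<omega>))\<^sup>2)) \<partial>M) < \<infinity>"
    by (auto intro: le_less_trans)
qed (use assms in measurable)

lemma distance_square_integrable:
  assumes "0 \<le> t" and [measurable]: "Y \<in> borel_measurable M" and Y: "integrable M (\<lambda>\<omega>. (norm (Y \<omega>))\<^sup>2)"
  shows "integrable M (\<lambda>\<omega>. (norm (X t \<omega> - Y \<omega>))\<^sup>2)"
proof (rule Bochner_Integration.integrable_bound)
  show "integrable M (\<lambda>\<omega>. 2 * (norm (X t \<omega>))\<^sup>2 + 2 * (norm (Y \<omega>))\<^sup>2)"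
    using X_square_integrable[OF assms(1)] Y by simp
  show "AE \<omega> in M. norm ((norm (X t \<omega> - Y \<omega>))\<^sup>2) \<le> norm (2 * (norm (X t \<omega>))\<^sup>2 + 2 * (norm (Y \<omega>))\<^sup>2)"
    using norm_diff_sq_le by (auto intro!: AE_I2)
  show "(\<lambda>\<omega>. (norm (X t \<omega> - Y \<omega>))\<^sup>2) \<in> borel_measurable M"
    using X_measurable[OF assms(1)] by simp
qed

lemma grad_measurable: "grad \<Phi> \<in> borel_measurable borel"
  using continuous_grad[of UNIV] by (rule borel_measurable_continuous_onI)

lemma grad_square_bound: "(norm (grad \<Phi> x))\<^sup>2 \<le> 2 * (norm (grad \<Phi> 0))\<^sup>2 + 2 * (4 * c)\<^sup>2 * (norm x)\<^sup>2"
proof -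
  have "(norm (grad \<Phi> x - grad \<Phi> 0))\<^sup>2 \<le> (4 * c * norm x)\<^sup>2"
    using grad_lipschitz[of x 0] by (intro power_mono) auto
  then show ?thesis
    using norm_diff_sq_le[of "grad \<Phi> x - grad \<Phi> 0" "- grad \<Phi> 0"] by (simp add: power_mult_distrib)
qed

text \<open>A Lipschitz gradient grows at most linearly, so second moments of \<open>X\<close>
  control it. Uniformity over \<open>{0..T}\<close> is what the joint integrability of the cross
  term rests on.\<close>

lemma drift_square_bounded:
  assumes "0 \<le> T"
  shows "\<exists>C\<ge>0. \<forall>t\<in>{0..T}. sq_integral M (\<lambda>\<omega>. grad \<Phi> (X t \<omega>)) \<le> ennreal C"
proof -
  obtain C where C: "0 \<le> C" "\<And>t. t \<in> {0..T} \<Longrightarrow> sq_integral M (X t) \<le> ennreal C"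
    using X_square_bounded[OF assms] by blast
  define a b where "a = 2 * (norm (grad \<Phi> 0))\<^sup>2" and "b = 2 * (4 * c)\<^sup>2"
  have ab: "0 \<le> a" "0 \<le> b" by (auto simp: a_def b_def)
  have "sq_integral M (\<lambda>\<omega>. grad \<Phi> (X t \<omega>)) \<le> ennreal (a + b * C)" if t: "t \<in> {0..T}" for t
  proof -
    have [measurable]: "X t \<in> borel_measurable M" using t by simp
    have "sq_integral M (\<lambda>\<omega>. grad \<Phi> (X t \<omega>))
      \<le> (\<integral>\<^sup>+\<omega>. ennreal a + ennreal b * ennreal ((norm (X t \<omega>))\<^sup>2) \<partial>M)"
    proof (rule nn_integral_mono)
      fix \<omega>
      have "ennreal ((norm (grad \<Phi> (X t \<omega>)))\<^sup>2) \<le> ennreal (a + b * (norm (X t \<omega>))\<^sup>2)"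
        unfolding a_def b_def by (rule ennreal_leI[OF grad_square_bound])
      also have "\<dots> = ennreal a + ennreal b * ennreal ((norm (X t \<omega>))\<^sup>2)"
        using ab by (simp add: ennreal_mult)
      finally show "ennreal ((norm (grad \<Phi> (X t \<omega>)))\<^sup>2) \<le> ennreal a + ennreal b * ennreal ((norm (X t \<omega>))\<^sup>2)" .
    qed
    also have "\<dots> = ennreal a + ennreal b * sq_integral M (X t)"
      by (subst nn_integral_add) (simp_all add: nn_integral_cmult emeasure_space_1)
    also have "\<dots> \<le> ennreal a + ennreal b * ennreal C"
      using C(2)[OF t] by (intro add_left_mono mult_left_mono) auto
    also have "\<dots> = ennreal (a + b * C)" using ab C(1) by (simp add: ennreal_mult)
    finally show ?thesis .
  qed
  moreover have "0 \<le> a + b * C" using ab C(1) by simp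
  ultimately show ?thesis by blast
qed

lemma drift_square_integrable:
  assumes "0 \<le> t"
  shows "integrable M (\<lambda>\<omega>. (norm (grad \<Phi> (X t \<omega>)))\<^sup>2)"
proof (rule integrableI_bounded)
  obtain C where "0 \<le> C" "\<And>r. r \<in> {0..t} \<Longrightarrow> sq_integral M (\<lambda>\<omega>. grad \<Phi> (X r \<omega>)) \<le> ennreal C"
    using drift_square_bounded[OF assms] by blast
  from this(2)[of t] assms show "(\<integral>\<^sup>+\<omega>. ennreal (norm ((norm (grad \<Phi> (X t \<omega>)))\<^sup>2)) \<partial>M) < \<infinity>"
    by (auto intro: le_less_trans)
  show "(\<lambda>\<omega>. (norm (grad \<Phi> (X t \<omega>)))\<^sup>2) \<in> borel_measurable M"
    using measurable_compose[OF X_measurable[OF assms] grad_measurable] by simp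
qed

text \<open>The integrand pairing drift with future noise in the expansion of the squared distance,
  localized to \<open>A\<close> and written on the product space for Fubini; \<open>max 0\<close>
  gives access to the joint measurability of \<open>X\<close> and \<open>I\<close>.\<close>

definition cross :: "'a set \<Rightarrow> real \<Rightarrow> real \<Rightarrow> 'a \<times> real \<Rightarrow> real" where
  "cross A s t z = indicator A (fst z) * indicator {s..t} (snd z) *
    (- grad \<Phi> (X (max 0 (snd z)) (fst z)) \<bullet> (I t (fst z) - I (max 0 (snd z)) (fst z)))"

lemma cross_integrable:
  assumes s: "0 \<le> s" "s \<le> t" and A: "A \<in> sets M"
  shows "integrable (M \<Otimes>\<^sub>M lborel) (cross A s t)"
proof (rule integrableI_bounded)
  note [measurable] = A grad_measurable
  have t: "0 \<le> t" using s by simp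
  have [measurable]: "I t \<in> borel_measurable M" using t by (rule I_measurable_M)
  have [measurable]: "(\<lambda>z. X (max 0 (snd z)) (fst z)) \<in> borel_measurable (M \<Otimes>\<^sub>M lborel)"
    by (rule continuous_process_jointly_measurable[OF X_measurable X_continuous])
  have [measurable]: "(\<lambda>z. I (max 0 (snd z)) (fst z)) \<in> borel_measurable (M \<Otimes>\<^sub>M lborel)"
    by (rule continuous_process_jointly_measurable[OF I_measurable_M I_continuous])
  show m [measurable]: "cross A s t \<in> borel_measurable (M \<Otimes>\<^sub>M lborel)"
    unfolding cross_def[abs_def] by measurable
  interpret pair_sigma_finite M lborel ..
  obtain C where C: "0 \<le> C" "\<And>r. r \<in> {0..t} \<Longrightarrow> sq_integral M (\<lambda>\<omega>. grad \<Phi> (X r \<omega>)) \<le> ennreal C"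
    using drift_square_bounded[OF t] by blast
  have inner: "(\<integral>\<^sup>+\<omega>. ennreal (norm (cross A s t (\<omega>, r))) \<partial>M) \<le> ennreal (C + tail 0) * indicator {s..t} r" for r
  proof (cases "r \<in> {s..t}")
    case True
    then have r: "0 \<le> r" "r \<le> t" using s by auto
    have [measurable]: "X r \<in> borel_measurable M" "I r \<in> borel_measurable M" using r by auto
    have "(\<integral>\<^sup>+\<omega>. ennreal (norm (cross A s t (\<omega>, r))) \<partial>M)
      \<le> (\<integral>\<^sup>+\<omega>. ennreal ((norm (grad \<Phi> (X r \<omega>)))\<^sup>2) + ennreal ((norm (I t \<omega> - I r \<omega>))\<^sup>2) \<partial>M)"
    proof (rule nn_integral_mono)
      fix \<omega>
      define a b where "a = grad \<Phi> (X r \<omega>)" and "b = I t \<omega> - I r \<omega>"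
      have "norm (cross A s t (\<omega>, r)) \<le> \<bar>a \<bullet> b\<bar>"
        using r by (auto simp: cross_def a_def b_def split: split_indicator)
      also have "\<dots> \<le> norm a * norm b" by (rule Cauchy_Schwarz_ineq2)
      also have "\<dots> \<le> 2 * norm a * norm b" by simp
      also have "\<dots> \<le> (norm a)\<^sup>2 + (norm b)\<^sup>2" by (rule sum_squares_bound)
      finally show "ennreal (norm (cross A s t (\<omega>, r)))
        \<le> ennreal ((norm (grad \<Phi> (X r \<omega>)))\<^sup>2) + ennreal ((norm (I t \<omega> - I r \<omega>))\<^sup>2)"
        unfolding a_def b_def by (simp flip: ennreal_plus)
    qed
    also have "\<dots> = sq_integral M (\<lambda>\<omega>. grad \<Phi> (X r \<omega>)) + sq_integral M (\<lambda>\<omega>. I t \<omega> - I r \<omega>)"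
      by (rule nn_integral_add) measurable
    also have "sq_integral M (\<lambda>\<omega>. I t \<omega> - I r \<omega>) \<le> ennreal (tail 0)"
    proof -
      have "space M \<in> sets (F r)" using space_F[OF r(1)] sets.top[of "F r"] by simp
      from noise_increment_bound[OF r this]
      have "sq_integral M (\<lambda>\<omega>. indicator (space M) \<omega> *\<^sub>R (I t \<omega> - I r \<omega>)) \<le> ennreal (tail r - tail t)"
        by (simp add: prob_space)
      also have "\<dots> \<le> ennreal (tail 0)"
        using tail_antimono[of 0 r] tail_nonneg[of t] r t by (intro ennreal_leI) linarith
      also have "sq_integral M (\<lambda>\<omega>. indicator (space M) \<omega> *\<^sub>R (I t \<omega> - I r \<omega>))
        = sq_integral M (\<lambda>\<omega>. I t \<omega> - I r \<omega>)"
        by (intro nn_integral_cong) simp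
      finally show ?thesis .
    qed
    also have "sq_integral M (\<lambda>\<omega>. grad \<Phi> (X r \<omega>)) \<le> ennreal C" using C(2) r by simp
    also have "ennreal C + ennreal (tail 0) = ennreal (C + tail 0) * indicator {s..t} r"
      using C(1) tail_nonneg[of 0] True by simp
    finally show ?thesis by (simp add: add_mono)
  qed (simp add: cross_def)
  have "(\<integral>\<^sup>+z. ennreal (norm (cross A s t z)) \<partial>(M \<Otimes>\<^sub>M lborel))
    = (\<integral>\<^sup>+r. \<integral>\<^sup>+\<omega>. ennreal (norm (cross A s t (\<omega>, r))) \<partial>M \<partial>lborel)"
    by (subst nn_integral_snd[symmetric]) (auto simp: case_prod_beta)
  also have "\<dots> \<le> (\<integral>\<^sup>+r. ennreal (C + tail 0) * indicator {s..t} r \<partial>lborel)"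
    by (intro nn_integral_mono inner)
  also have "\<dots> < \<infinity>" using s by (simp add: nn_integral_cmult ennreal_mult_less_top)
  finally show "(\<integral>\<^sup>+z. ennreal (norm (cross A s t z)) \<partial>(M \<Otimes>\<^sub>M lborel)) < \<infinity>" .
qed

text \<open>For fixed \<open>r\<close> in \<open>{s..t}\<close> the factor in front of
  \<open>I t - I r\<close> is known at time \<open>r\<close>, hence orthogonal to this increment.
  Fubini carries the vanishing through the time integral.\<close>

lemma cross_expectation:
  assumes s: "0 \<le> s" "s \<le> t" and A: "A \<in> sets (F s)"
  shows "expectation (\<lambda>\<omega>. LINT r|lborel. cross A s t (\<omega>, r)) = 0"
proof -
  interpret pair_sigma_finite M lborel ..
  have AM: "A \<in> sets M" using A s(1) sets_F_subset by blast
  have zero: "expectation (\<lambda>\<omega>. cross A s t (\<omega>, r)) = 0" for r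
  proof (cases "r \<in> {s..t}")
    case True
    then have r: "0 \<le> r" "s \<le> r" "r \<le> t" using s by auto
    define Z where "Z \<omega> = indicator A \<omega> *\<^sub>R (- grad \<Phi> (X r \<omega>))" for \<omega>
    have "A \<in> sets (F r)" using sets_F_mono[OF s(1) r(2)] A by blast
    moreover have "(\<lambda>\<omega>. grad \<Phi> (X r \<omega>)) \<in> borel_measurable (F r)"
      by (rule measurable_compose[OF X_adapted[OF r(1)] grad_measurable])
    ultimately have Z: "Z \<in> borel_measurable (F r)"
      unfolding Z_def by (intro borel_measurable_scaleR borel_measurable_indicator borel_measurable_uminus)
    have "integrable M (\<lambda>\<omega>. (norm (Z \<omega>))\<^sup>2)"
    proof (rule Bochner_Integration.integrable_bound[OF drift_square_integrable[OF r(1)]])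
      show "(\<lambda>\<omega>. (norm (Z \<omega>))\<^sup>2) \<in> borel_measurable M" using measurable_F_M[OF Z r(1)] by simp
    qed (auto simp: Z_def split: split_indicator)
    from ito_integral_orthogonal(2)[OF ito r(1) r(3) Z this noise_increment_square_integrable[OF r(1) r(3)]]
    have "expectation (\<lambda>\<omega>. Z \<omega> \<bullet> (I t \<omega> - I r \<omega>)) = 0" .
    moreover have "cross A s t (\<omega>, r) = Z \<omega> \<bullet> (I t \<omega> - I r \<omega>)" for \<omega>
      using True r by (simp add: cross_def Z_def)
    ultimately show ?thesis by simp
  qed (simp add: cross_def)
  have "expectation (\<lambda>\<omega>. LINT r|lborel. cross A s t (\<omega>, r)) = (LINT r|lborel. expectation (\<lambda>\<omega>. cross A s t (\<omega>, r)))"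
    using integral_fst'[OF cross_integrable[OF s AM]] integral_snd[of "\<lambda>\<omega> r. cross A s t (\<omega>, r)"]
      cross_integrable[OF s AM] by (simp add: case_prod_beta')
  then show ?thesis by (simp add: zero)
qed

end

section \<open>Energy inequality, supermartingale property, integrability of the gap\<close>

context gradient_sde
begin

abbreviation gap :: "real \<Rightarrow> real \<Rightarrow> 'a \<Rightarrow> real" where
  "gap s t \<omega> \<equiv> (LINT r:{s..t}|lborel. \<Phi> (X r \<omega>) - \<Phi> xmin)"

lemma cross_slice:
  assumes "0 \<le> s"
  shows "(LINT r|lborel. cross A s t (\<omega>, r))
    = indicator A \<omega> * (LINT r:{s..t}|lborel. - grad \<Phi> (X r \<omega>) \<bullet> (I t \<omega> - I r \<omega>))"
proof -
  have "cross A s t (\<omega>, r)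
    = indicator A \<omega> * (indicator {s..t} r *\<^sub>R (- grad \<Phi> (X r \<omega>) \<bullet> (I t \<omega> - I r \<omega>)))" for r
    using assms by (auto simp: cross_def split: split_indicator)
  then show ?thesis unfolding set_lebesgue_integral_def by simp
qed

lemma path_continuous_on:
  assumes "\<omega> \<in> space M" "0 \<le> s"
  shows "continuous_on {s..t} (\<lambda>r. X r \<omega>)" "continuous_on {s..t} (\<lambda>r. I r \<omega>)"
    "continuous_on {s..t} (\<lambda>r. - grad \<Phi> (X r \<omega>))" "continuous_on {s..t} (\<lambda>r. \<Phi> (X r \<omega>) - \<Phi> xmin)"
proof -
  have sub: "{s..t} \<subseteq> {0..}" using assms(2) by auto
  show X: "continuous_on {s..t} (\<lambda>r. X r \<omega>)" and "continuous_on {s..t} (\<lambda>r. I r \<omega>)"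
    using continuous_on_subset[OF X_continuous[OF assms(1)] sub]
      continuous_on_subset[OF I_continuous[OF assms(1)] sub] by auto
  show "continuous_on {s..t} (\<lambda>r. - grad \<Phi> (X r \<omega>))"
    by (intro continuous_on_minus continuous_on_compose2[OF continuous_grad[of UNIV] X]) auto
  show "continuous_on {s..t} (\<lambda>r. \<Phi> (X r \<omega>) - \<Phi> xmin)"
    by (intro continuous_on_diff continuous_on_const continuous_on_compose2[OF continuous[of UNIV] X]) auto
qed

lemma set_integral_continuous:
  fixes h :: "real \<Rightarrow> 'b::euclidean_space"
  assumes "continuous_on {s..t} h"
  shows "(LINT r:{s..t}|lborel. h r) = integral {s..t} h"
  by (rule set_borel_integral_eq_integral(2)[OF borel_integrable_atLeastAtMost'[OF assms]])

text \<open>The exceptional null set is that of the integral equation and is common to all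
  \<open>y\<close>; having the quantifier inside \<open>AE\<close> permits a random minimizer to be
  inserted later. Convexity enters through the gradient inequality, which bounds the drift term by
  minus the gap.\<close>

lemma energy_pathwise:
  assumes s: "0 \<le> s" "s \<le> t"
  shows "AE \<omega> in M. \<forall>y\<in>argmin \<Phi>.
    (norm (X t \<omega> - y))\<^sup>2 + 2 * gap s t \<omega>
    \<le> (norm (X s \<omega> - y))\<^sup>2 + 2 * (LINT r:{s..t}|lborel. - grad \<Phi> (X r \<omega>) \<bullet> (I t \<omega> - I r \<omega>))
      + 2 * ((X s \<omega> - y) \<bullet> (I t \<omega> - I s \<omega>)) + (norm (I t \<omega> - I s \<omega>))\<^sup>2"
  using sde AE_space
proof eventually_elim
  case (elim \<omega>)
  define b where "b r = - grad \<Phi> (X r \<omega>)" for r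
  have cb: "continuous_on {r..r'} b" if "0 \<le> r" for r r'
    unfolding b_def using path_continuous_on(3)[OF elim(2) that] .
  note cX = path_continuous_on(1)[OF elim(2) s(1), of t] and cI = path_continuous_on(2)[OF elim(2) s(1), of t]
    and cg = path_continuous_on(4)[OF elim(2) s(1), of t]
  have X: "X r \<omega> = x0 + integral {0..r} b + I r \<omega>" if "0 \<le> r" for r
    using elim(1) that set_integral_continuous[OF cb[of 0 r]] unfolding b_def by simp
  have inc: "X r \<omega> = X s \<omega> + integral {s..r} b + (I r \<omega> - I s \<omega>)" if r: "r \<in> {s..t}" for r
  proof -
    have "integral {0..s} b + integral {s..r} b = integral {0..r} b"
      using r s by (intro Henstock_Kurzweil_Integration.integral_combine integrable_continuous_real cb) auto
    then show ?thesis using X[of r] X[of s] r s by (simp add: algebra_simps)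
  qed
  show ?case
  proof
    fix y assume y: "y \<in> argmin \<Phi>"
    note eq = norm_sq_integral_equation[OF s(2) cb[OF s(1)] cI inc, of y]
    have "integral {s..t} (\<lambda>r. (X r \<omega> - y) \<bullet> b r) \<le> integral {s..t} (\<lambda>r. - (\<Phi> (X r \<omega>) - \<Phi> xmin))"
    proof (rule integral_le)
      show "(\<lambda>r. (X r \<omega> - y) \<bullet> b r) integrable_on {s..t}"
        using cX cb[OF s(1)] by (intro integrable_continuous_real continuous_intros)
      show "(\<lambda>r. - (\<Phi> (X r \<omega>) - \<Phi> xmin)) integrable_on {s..t}"
        using cg by (intro integrable_continuous_real continuous_on_minus)
      fix r
      have "grad \<Phi> (X r \<omega>) \<bullet> (X r \<omega> - y) = - (grad \<Phi> (X r \<omega>) \<bullet> (y - X r \<omega>))"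
        by (simp add: inner_diff_right)
      then show "(X r \<omega> - y) \<bullet> b r \<le> - (\<Phi> (X r \<omega>) - \<Phi> xmin)"
        using gradient_inequality[of "X r \<omega>" y] y unfolding argmin_iff
        by (simp add: b_def inner_commute)
    qed
    also have "\<dots> = - gap s t \<omega>"
      by (simp only: integral_neg set_integral_continuous[OF cg])
    finally have drift: "integral {s..t} (\<lambda>r. (X r \<omega> - y) \<bullet> b r)
      \<le> - gap s t \<omega>" .
    have "continuous_on {s..t} (\<lambda>r. b r \<bullet> (I t \<omega> - I r \<omega>))"
      using cI cb[OF s(1)] by (intro continuous_intros)
    note set_integral_continuous[OF this]
    then show "(norm (X t \<omega> - y))\<^sup>2 + 2 * gap s t \<omega>
      \<le> (norm (X s \<omega> - y))\<^sup>2 + 2 * (LINT r:{s..t}|lborel. - grad \<Phi> (X r \<omega>) \<bullet> (I t \<omega> - I r \<omega>))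
      + 2 * ((X s \<omega> - y) \<bullet> (I t \<omega> - I s \<omega>)) + (norm (I t \<omega> - I s \<omega>))\<^sup>2"
      using eq drift unfolding b_def by simp
  qed
qed

lemma gap_nonneg: "0 \<le> gap s t \<omega>"
  unfolding set_lebesgue_integral_def using xmin_le
  by (intro integral_nonneg_AE AE_I2) (auto split: split_indicator)

text \<open>Of the four terms on the right of the pathwise estimate, \<open>Q\<close> and
  \<open>R\<close> have mean zero, since they pair noise increments with quantities known when those
  increments begin. For \<open>R\<close> this is where \<open>Y\<close> has to be known at time
  \<open>s\<close>.\<close>

lemma energy_inequality:
  assumes s: "0 \<le> s" "s \<le> t" and A: "A \<in> sets (F s)"
    and Y: "Y \<in> borel_measurable (F s)" "\<And>\<omega>. \<omega> \<in> space M \<Longrightarrow> Y \<omega> \<in> argmin \<Phi>"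
      "integrable M (\<lambda>\<omega>. (norm (Y \<omega>))\<^sup>2)"
  shows "(\<integral>\<^sup>+\<omega>. indicator A \<omega> * ennreal ((norm (X t \<omega> - Y \<omega>))\<^sup>2
      + 2 * gap s t \<omega>) \<partial>M)
    \<le> (\<integral>\<^sup>+\<omega>. indicator A \<omega> * ennreal ((norm (X s \<omega> - Y \<omega>))\<^sup>2) \<partial>M) + ennreal (prob A * (tail s - tail t))"
proof -
  interpret pair_sigma_finite M lborel ..
  have AM [measurable]: "A \<in> sets M" using A s(1) sets_F_subset by blast
  have YM [measurable]: "Y \<in> borel_measurable M" using Y(1) s(1) by (rule measurable_F_M)
  have [measurable]: "X s \<in> borel_measurable M" "X t \<in> borel_measurable M"
      "I s \<in> borel_measurable M" "I t \<in> borel_measurable M" using s by auto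
  define P where "P \<omega> = indicator A \<omega> * (norm (X s \<omega> - Y \<omega>))\<^sup>2" for \<omega>
  define Q where "Q \<omega> = (LINT r|lborel. cross A s t (\<omega>, r))" for \<omega>
  define Z where "Z \<omega> = indicator A \<omega> *\<^sub>R (X s \<omega> - Y \<omega>)" for \<omega>
  define R where "R \<omega> = Z \<omega> \<bullet> (I t \<omega> - I s \<omega>)" for \<omega>
  define V where "V \<omega> = (norm (indicator A \<omega> *\<^sub>R (I t \<omega> - I s \<omega>)))\<^sup>2" for \<omega>
  have iP: "integrable M P"
    using integrable_mult_indicator[OF AM distance_square_integrable[OF s(1) YM Y(3)]]
    by (simp add: P_def[abs_def])
  have iQ: "integrable M Q"
    unfolding Q_def[abs_def] by (rule integrable_fst'[OF cross_integrable[OF s AM]])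
  have eQ: "expectation Q = 0"
    unfolding Q_def[abs_def] by (rule cross_expectation[OF s A])
  have mZ: "Z \<in> borel_measurable (F s)"
    unfolding Z_def[abs_def] using A Y(1) X_adapted[OF s(1)] by measurable
  have iZ: "integrable M (\<lambda>\<omega>. (norm (Z \<omega>))\<^sup>2)"
  proof -
    have "(\<lambda>\<omega>. (norm (Z \<omega>))\<^sup>2) = P" by (auto simp: Z_def P_def split: split_indicator)
    then show ?thesis using iP by simp
  qed
  note R = ito_integral_orthogonal[OF ito s mZ iZ noise_increment_square_integrable[OF s], folded R_def]
  have nV: "(\<integral>\<^sup>+\<omega>. ennreal (V \<omega>) \<partial>M) \<le> ennreal (prob A * (tail s - tail t))"
    unfolding V_def by (rule noise_increment_bound[OF s A])
  have iV: "integrable M V"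
  proof (rule integrableI_bounded)
    show "V \<in> borel_measurable M" unfolding V_def[abs_def] by measurable
    show "(\<integral>\<^sup>+\<omega>. ennreal (norm (V \<omega>)) \<partial>M) < \<infinity>"
      using le_less_trans[OF nV] by (simp add: V_def)
  qed
  have "(\<integral>\<^sup>+\<omega>. indicator A \<omega> * ennreal ((norm (X t \<omega> - Y \<omega>))\<^sup>2
      + 2 * gap s t \<omega>) \<partial>M)
    \<le> (\<integral>\<^sup>+\<omega>. ennreal (P \<omega> + 2 * Q \<omega> + 2 * R \<omega> + V \<omega>) \<partial>M)"
  proof (rule nn_integral_mono_AE)
    show "AE \<omega> in M. indicator A \<omega> * ennreal ((norm (X t \<omega> - Y \<omega>))\<^sup>2
        + 2 * gap s t \<omega>)
      \<le> ennreal (P \<omega> + 2 * Q \<omega> + 2 * R \<omega> + V \<omega>)"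
      using energy_pathwise[OF s] AE_space
    proof eventually_elim
      case (elim \<omega>)
      from elim(1)[rule_format, OF Y(2)[OF elim(2)]]
      show ?case
        by (auto simp: P_def Q_def R_def V_def Z_def cross_slice[OF s(1)] split: split_indicator
            intro!: ennreal_leI)
    qed
  qed
  also have "\<dots> = ennreal (expectation (\<lambda>\<omega>. P \<omega> + 2 * Q \<omega> + 2 * R \<omega> + V \<omega>))"
  proof (rule nn_integral_eq_integral)
    show "integrable M (\<lambda>\<omega>. P \<omega> + 2 * Q \<omega> + 2 * R \<omega> + V \<omega>)" using iP iQ R(1) iV by simp
    \<comment> \<open>The terms \<open>Q\<close> and \<open>R\<close> have no sign, but on
      \<open>A\<close> the sum dominates the nonnegative left side of the pathwise estimate, and off
      \<open>A\<close> it is zero.\<close>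
    show "AE \<omega> in M. 0 \<le> P \<omega> + 2 * Q \<omega> + 2 * R \<omega> + V \<omega>"
      using energy_pathwise[OF s] AE_space
    proof eventually_elim
      case (elim \<omega>)
      note elim(1)[rule_format, OF Y(2)[OF elim(2)]]
      moreover have "0 \<le> (norm (X t \<omega> - Y \<omega>))\<^sup>2 + 2 * gap s t \<omega>"
        using gap_nonneg by simp
      ultimately show ?case
        by (auto simp: P_def Q_def R_def V_def Z_def cross_slice[OF s(1)] split: split_indicator)
    qed
  qed
  also have "\<dots> = ennreal (expectation P + expectation V)"
    using iP iQ R iV eQ by simp
  also have "\<dots> = ennreal (expectation P) + ennreal (expectation V)"
    by (intro ennreal_plus integral_nonneg_AE) (auto simp: P_def V_def)
  also have "ennreal (expectation P) = (\<integral>\<^sup>+\<omega>. ennreal (P \<omega>) \<partial>M)"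
    by (rule nn_integral_eq_integral[symmetric, OF iP]) (auto simp: P_def)
  also have "(\<integral>\<^sup>+\<omega>. ennreal (P \<omega>) \<partial>M) = (\<integral>\<^sup>+\<omega>. indicator A \<omega> * ennreal ((norm (X s \<omega> - Y \<omega>))\<^sup>2) \<partial>M)"
    by (intro nn_integral_cong) (auto simp: P_def split: split_indicator)
  also have "ennreal (expectation V) = (\<integral>\<^sup>+\<omega>. ennreal (V \<omega>) \<partial>M)"
    by (rule nn_integral_eq_integral[symmetric, OF iV]) (auto simp: V_def)
  also note nV
  finally show ?thesis by (simp add: add_left_mono)
qed

text \<open>Conditional expectation is expressed by testing against every \<open>A\<close> known at
  time \<open>s\<close>. The gap is dropped, and the noise contribution
  \<open>tail s - tail t\<close> is exactly what the added \<open>tail\<close> loses between the two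
  times.\<close>

lemma supermartingale:
  assumes s: "0 \<le> s" "s \<le> t" and A: "A \<in> sets (F s)"
    and Y: "Y \<in> borel_measurable (F s)" "\<And>\<omega>. \<omega> \<in> space M \<Longrightarrow> Y \<omega> \<in> argmin \<Phi>"
      "integrable M (\<lambda>\<omega>. (norm (Y \<omega>))\<^sup>2)"
  shows "(\<integral>\<^sup>+\<omega>. indicator A \<omega> * ennreal ((norm (X t \<omega> - Y \<omega>))\<^sup>2 + tail t) \<partial>M)
    \<le> (\<integral>\<^sup>+\<omega>. indicator A \<omega> * ennreal ((norm (X s \<omega> - Y \<omega>))\<^sup>2 + tail s) \<partial>M)"
proof -
  have AM [measurable]: "A \<in> sets M" using A s(1) sets_F_subset by blast
  have YM [measurable]: "Y \<in> borel_measurable M" using Y(1) s(1) by (rule measurable_F_M)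
  have [measurable]: "X s \<in> borel_measurable M" "X t \<in> borel_measurable M" using s by auto
  have nn: "0 \<le> tail s" "0 \<le> tail t" "tail t \<le> tail s"
    using tail_nonneg[of s] tail_nonneg[of t] tail_antimono[OF s] s by auto
  have split: "(\<integral>\<^sup>+\<omega>. indicator A \<omega> * ennreal ((norm (X r \<omega> - Y \<omega>))\<^sup>2 + tail r) \<partial>M)
    = (\<integral>\<^sup>+\<omega>. indicator A \<omega> * ennreal ((norm (X r \<omega> - Y \<omega>))\<^sup>2) \<partial>M) + ennreal (prob A * tail r)"
    if r: "0 \<le> r" for r
  proof -
    have [measurable]: "X r \<in> borel_measurable M" using r by simp
    have "(\<integral>\<^sup>+\<omega>. indicator A \<omega> * ennreal ((norm (X r \<omega> - Y \<omega>))\<^sup>2 + tail r) \<partial>M)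
      = (\<integral>\<^sup>+\<omega>. indicator A \<omega> * ennreal ((norm (X r \<omega> - Y \<omega>))\<^sup>2) + ennreal (tail r) * indicator A \<omega> \<partial>M)"
      using tail_nonneg[OF r] by (intro nn_integral_cong) (auto split: split_indicator)
    also have "\<dots> = (\<integral>\<^sup>+\<omega>. indicator A \<omega> * ennreal ((norm (X r \<omega> - Y \<omega>))\<^sup>2) \<partial>M)
        + ennreal (tail r) * emeasure M A"
      by (subst nn_integral_add) (auto simp: nn_integral_cmult_indicator)
    also have "ennreal (tail r) * emeasure M A = ennreal (prob A * tail r)"
      using tail_nonneg[OF r] by (simp add: emeasure_eq_measure ennreal_mult mult.commute)
    finally show ?thesis .
  qed
  have "(\<integral>\<^sup>+\<omega>. indicator A \<omega> * ennreal ((norm (X t \<omega> - Y \<omega>))\<^sup>2) \<partial>M)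
    \<le> (\<integral>\<^sup>+\<omega>. indicator A \<omega> * ennreal ((norm (X t \<omega> - Y \<omega>))\<^sup>2
      + 2 * gap s t \<omega>) \<partial>M)"
    using gap_nonneg by (intro nn_integral_mono mult_left_mono ennreal_leI) auto
  also note energy_inequality[OF s A Y]
  finally have "(\<integral>\<^sup>+\<omega>. indicator A \<omega> * ennreal ((norm (X t \<omega> - Y \<omega>))\<^sup>2) \<partial>M) + ennreal (prob A * tail t)
    \<le> ((\<integral>\<^sup>+\<omega>. indicator A \<omega> * ennreal ((norm (X s \<omega> - Y \<omega>))\<^sup>2) \<partial>M) + ennreal (prob A * (tail s - tail t)))
      + ennreal (prob A * tail t)"
    by (rule add_right_mono)
  also have "\<dots> = (\<integral>\<^sup>+\<omega>. indicator A \<omega> * ennreal ((norm (X s \<omega> - Y \<omega>))\<^sup>2) \<partial>M)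
      + (ennreal (prob A * (tail s - tail t)) + ennreal (prob A * tail t))"
    by (rule add.assoc)
  also have "ennreal (prob A * (tail s - tail t)) + ennreal (prob A * tail t) = ennreal (prob A * tail s)"
    using nn by (subst ennreal_plus[symmetric]) (auto simp: algebra_simps intro: mult_right_mono mult_left_mono)
  finally show ?thesis using split[OF s(1)] split[of t] s by simp
qed

text \<open>The energy inequality from time 0 on the whole space with \<open>Y = xmin\<close>; the
  constant is the expected initial squared distance plus the total noise. Time is made the outer
  integral so that a lower bound valid at all late times can be contradicted.\<close>

lemma expected_gap_integral_bounded:
  "\<exists>C\<ge>0. \<forall>t\<ge>0. (\<integral>\<^sup>+r\<in>{0..t}. (\<integral>\<^sup>+\<omega>. ennreal (\<Phi> (X r \<omega>) - \<Phi> xmin) \<partial>M) \<partial>lborel) \<le> ennreal C"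
proof -
  interpret pair_sigma_finite M lborel ..
  define C where "C = expectation (\<lambda>\<omega>. (norm (X 0 \<omega> - xmin))\<^sup>2) + tail 0"
  have int: "integrable M (\<lambda>\<omega>. (norm (X 0 \<omega> - xmin))\<^sup>2)"
    by (rule distance_square_integrable) auto
  have C: "0 \<le> C" unfolding C_def using tail_nonneg[of 0] by (intro add_nonneg_nonneg integral_nonneg_AE) auto
  have "(\<integral>\<^sup>+r\<in>{0..t}. (\<integral>\<^sup>+\<omega>. ennreal (\<Phi> (X r \<omega>) - \<Phi> xmin) \<partial>M) \<partial>lborel) \<le> ennreal C" if t: "0 \<le> t" for t
  proof -
    have [measurable]: "(\<lambda>z. X (max 0 (snd z)) (fst z)) \<in> borel_measurable (M \<Otimes>\<^sub>M lborel)"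
      by (rule continuous_process_jointly_measurable[OF X_measurable X_continuous])
    have [measurable]: "\<Phi> \<in> borel_measurable borel"
      using continuous[of UNIV] by (rule borel_measurable_continuous_onI)
    define h where "h z = ennreal (\<Phi> (X (max 0 (snd z)) (fst z)) - \<Phi> xmin) * indicator {0..t} (snd z)" for z
    have [measurable]: "h \<in> borel_measurable (M \<Otimes>\<^sub>M lborel)"
      unfolding h_def[abs_def] by measurable
    have "(\<integral>\<^sup>+r\<in>{0..t}. (\<integral>\<^sup>+\<omega>. ennreal (\<Phi> (X r \<omega>) - \<Phi> xmin) \<partial>M) \<partial>lborel)
      = (\<integral>\<^sup>+r. (\<integral>\<^sup>+\<omega>. h (\<omega>, r) \<partial>M) \<partial>lborel)"
      by (intro nn_integral_cong) (auto simp: h_def split: split_indicator)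
    also have "\<dots> = (\<integral>\<^sup>+\<omega>. (\<integral>\<^sup>+r. h (\<omega>, r) \<partial>lborel) \<partial>M)"
      using Fubini[of h] by simp
    also have "\<dots> \<le> (\<integral>\<^sup>+\<omega>. indicator (space M) \<omega> * ennreal ((norm (X t \<omega> - xmin))\<^sup>2
        + 2 * gap 0 t \<omega>) \<partial>M)"
    proof (rule nn_integral_mono)
      fix \<omega> assume \<omega>: "\<omega> \<in> space M"
      have "(\<integral>\<^sup>+r. h (\<omega>, r) \<partial>lborel)
        = (\<integral>\<^sup>+r. ennreal (indicator {0..t} r *\<^sub>R (\<Phi> (X r \<omega>) - \<Phi> xmin)) \<partial>lborel)"
        by (intro nn_integral_cong) (auto simp: h_def split: split_indicator)
      also have "\<dots> = ennreal (gap 0 t \<omega>)"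
        unfolding set_lebesgue_integral_def
        using borel_integrable_atLeastAtMost'[OF path_continuous_on(4)[OF \<omega>, of 0 t]] xmin_le
        by (intro nn_integral_eq_integral AE_I2) (auto simp: set_integrable_def split: split_indicator)
      also have "\<dots> \<le> ennreal ((norm (X t \<omega> - xmin))\<^sup>2 + 2 * gap 0 t \<omega>)"
        using gap_nonneg[of 0 t \<omega>] zero_le_power2[of "norm (X t \<omega> - xmin)"]
        by (intro ennreal_leI) linarith
      finally show "(\<integral>\<^sup>+r. h (\<omega>, r) \<partial>lborel)
        \<le> indicator (space M) \<omega> * ennreal ((norm (X t \<omega> - xmin))\<^sup>2
          + 2 * gap 0 t \<omega>)" using \<omega> by simp
    qed
    also have "\<dots> \<le> (\<integral>\<^sup>+\<omega>. indicator (space M) \<omega> * ennreal ((norm (X 0 \<omega> - xmin))\<^sup>2) \<partial>M)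
        + ennreal (prob (space M) * (tail 0 - tail t))"
      using t space_F[of 0] sets.top[of "F 0"] xmin by (intro energy_inequality) auto
    also have "(\<integral>\<^sup>+\<omega>. indicator (space M) \<omega> * ennreal ((norm (X 0 \<omega> - xmin))\<^sup>2) \<partial>M)
      = ennreal (expectation (\<lambda>\<omega>. (norm (X 0 \<omega> - xmin))\<^sup>2))"
      using nn_integral_eq_integral[OF int] by (simp add: nn_integral_cong[of M "\<lambda>\<omega>. indicator (space M) \<omega> * _ \<omega>"])
    also have "ennreal (expectation (\<lambda>\<omega>. (norm (X 0 \<omega> - xmin))\<^sup>2)) + ennreal (prob (space M) * (tail 0 - tail t))
      \<le> ennreal C"
      using tail_nonneg[OF t] tail_antimono[of 0 t] t
      by (subst ennreal_plus[symmetric]) (auto simp: C_def prob_space intro!: ennreal_leI)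
    finally show ?thesis .
  qed
  with C show ?thesis by blast
qed

lemma expected_gap_small:
  assumes e: "0 < e" and N: "0 \<le> N"
  shows "\<exists>s\<ge>N. (\<integral>\<^sup>+\<omega>. ennreal (\<Phi> (X s \<omega>) - \<Phi> xmin) \<partial>M) \<le> ennreal e"
proof (rule ccontr)
  assume "\<not> ?thesis"
  then have gt: "ennreal e \<le> (\<integral>\<^sup>+\<omega>. ennreal (\<Phi> (X s \<omega>) - \<Phi> xmin) \<partial>M)" if "N \<le> s" for s
    using that by (meson linear)
  obtain C where C: "0 \<le> C" "\<And>t. 0 \<le> t \<Longrightarrow>
      (\<integral>\<^sup>+r\<in>{0..t}. (\<integral>\<^sup>+\<omega>. ennreal (\<Phi> (X r \<omega>) - \<Phi> xmin) \<partial>M) \<partial>lborel) \<le> ennreal C"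
    using expected_gap_integral_bounded by blast
  \<comment> \<open>Chosen so that \<open>e * (t - N) = C + 1\<close>, which exceeds the bound
    \<open>C\<close>.\<close>
  define t where "t = N + (C + 1) / e"
  have t: "N \<le> t" "0 \<le> t" using e N C(1) by (auto simp: t_def)
  have "ennreal (C + 1) = ennreal e * ennreal (t - N)"
    using e t by (simp add: ennreal_mult[symmetric] t_def)
  also have "\<dots> = (\<integral>\<^sup>+r. ennreal e * indicator {N..t} r \<partial>lborel)"
    using t by (simp add: nn_integral_cmult_indicator)
  also have "\<dots> \<le> (\<integral>\<^sup>+r\<in>{0..t}. (\<integral>\<^sup>+\<omega>. ennreal (\<Phi> (X r \<omega>) - \<Phi> xmin) \<partial>M) \<partial>lborel)"
    using gt N by (intro nn_integral_mono) (auto split: split_indicator)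
  also have "\<dots> \<le> ennreal C" using C(2) t by blast
  finally show False using C(1) by simp
qed

end

section \<open>Almost sure convergence\<close>

context filtered_prob_space
begin

text \<open>\<open>B n\<close> is the part of \<open>A\<close> where the level has not been reached
  before step \<open>n\<close>. The quantity \<kappa> times the probability of having reached it,
  plus the mean of \<open>V n\<close> over \<open>B n\<close>, does not increase with
  \<open>n\<close>; this is a stopped supermartingale in explicit form.\<close>

lemma maximal_inequality:
  fixes V :: "nat \<Rightarrow> 'a \<Rightarrow> ennreal" and \<tau> :: "nat \<Rightarrow> real"
  assumes \<tau>: "0 \<le> \<tau> 0" "mono \<tau>"
    and V: "\<And>i. V i \<in> borel_measurable (F (\<tau> i))"
    and super: "\<And>i A. A \<in> sets (F (\<tau> i)) \<Longrightarrow>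
      (\<integral>\<^sup>+\<omega>. indicator A \<omega> * V (Suc i) \<omega> \<partial>M) \<le> (\<integral>\<^sup>+\<omega>. indicator A \<omega> * V i \<omega> \<partial>M)"
    and A: "A \<in> sets (F (\<tau> 0))"
  shows "\<kappa> * emeasure M {\<omega>\<in>A. \<exists>i. \<kappa> \<le> V i \<omega>} \<le> (\<integral>\<^sup>+\<omega>. indicator A \<omega> * V 0 \<omega> \<partial>M)"
proof -
  define B where "B n = {\<omega>\<in>A. \<forall>i<n. V i \<omega> < \<kappa>}" for n :: nat
  have \<tau>_mono: "\<tau> i \<le> \<tau> j" if "i \<le> j" for i j using \<tau>(2) that by (rule monoD)
  have \<tau>_pos: "0 \<le> \<tau> i" for i using \<tau>(1) \<tau>_mono[of 0 i] by simp
  have V_M [measurable]: "V i \<in> borel_measurable M" for i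
    using V \<tau>_pos by (rule measurable_F_M)
  \<comment> \<open>Only \<open>V 0\<close> up to \<open>V n\<close> enter \<open>B (Suc n)\<close>,
    so it is known at time \<open>\<tau> n\<close> and the step from \<open>V n\<close> to
    \<open>V (Suc n)\<close> may be tested on it.\<close>
  have B_F: "B (Suc n) \<in> sets (F (\<tau> n))" for n
  proof -
    have [measurable]: "V i \<in> borel_measurable (F (\<tau> n))" if "i < Suc n" for i
      using V \<tau>_pos \<tau>_mono that by (intro measurable_F_mono[OF V]) auto
    have AF: "A \<in> sets (F (\<tau> n))" using A sets_F_mono[OF \<tau>(1) \<tau>_mono[of 0 n]] by auto
    then have "B (Suc n) = A \<inter> (\<Inter>i\<in>{..<Suc n}. {\<omega>\<in>space (F (\<tau> n)). V i \<omega> < \<kappa>})"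
      using sets.sets_into_space[OF AF] by (auto simp: B_def)
    also have "\<dots> \<in> sets (F (\<tau> n))"
      by (intro sets.Int AF sets.finite_INT) (auto simp: lessThan_empty_iff)
    finally show ?thesis .
  qed
  have AM [measurable]: "A \<in> sets M" using A \<tau>(1) sets_F_subset by blast
  have BM [measurable]: "B n \<in> sets M" for n
  proof (cases n)
    case 0
    then show ?thesis using AM by (simp add: B_def)
  next
    case (Suc k)
    then show ?thesis using subsetD[OF sets_F_subset[OF \<tau>_pos] B_F] by simp
  qed
  have claim: "\<kappa> * emeasure M (A - B n) + (\<integral>\<^sup>+\<omega>. indicator (B n) \<omega> * V n \<omega> \<partial>M)
      \<le> (\<integral>\<^sup>+\<omega>. indicator A \<omega> * V 0 \<omega> \<partial>M)" for n
  proof (induction n)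
    case 0
    then show ?case by (simp add: B_def)
  next
    case (Suc n)
    have sub: "B (Suc n) \<subseteq> B n" by (auto simp: B_def)
    have "A - B (Suc n) = (A - B n) \<union> (B n - B (Suc n))" using sub by (auto simp: B_def)
    also have "emeasure M \<dots> = emeasure M (A - B n) + emeasure M (B n - B (Suc n))"
      by (rule plus_emeasure[symmetric]) auto
    finally have "\<kappa> * emeasure M (A - B (Suc n)) + (\<integral>\<^sup>+\<omega>. indicator (B (Suc n)) \<omega> * V (Suc n) \<omega> \<partial>M)
      \<le> (\<kappa> * emeasure M (A - B n) + \<kappa> * emeasure M (B n - B (Suc n)))
        + (\<integral>\<^sup>+\<omega>. indicator (B (Suc n)) \<omega> * V n \<omega> \<partial>M)"
      using super[OF B_F[of n]] by (simp add: distrib_left add_left_mono)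
    also have "\<dots> = \<kappa> * emeasure M (A - B n)
        + (\<integral>\<^sup>+\<omega>. \<kappa> * indicator (B n - B (Suc n)) \<omega> + indicator (B (Suc n)) \<omega> * V n \<omega> \<partial>M)"
      by (subst nn_integral_add) (auto simp: nn_integral_cmult_indicator add.assoc)
    also have "\<dots> \<le> \<kappa> * emeasure M (A - B n) + (\<integral>\<^sup>+\<omega>. indicator (B n) \<omega> * V n \<omega> \<partial>M)"
    proof (intro add_left_mono nn_integral_mono)
      fix \<omega>
      \<comment> \<open>Where the level is first reached at step \<open>n\<close>, \<kappa> is at
        most \<open>V n\<close>; elsewhere both sides agree.\<close>
      show "\<kappa> * indicator (B n - B (Suc n)) \<omega> + indicator (B (Suc n)) \<omega> * V n \<omega> \<le> indicator (B n) \<omega> * V n \<omega>"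
        using sub by (auto simp: B_def less_Suc_eq not_less split: split_indicator)
    qed
    also note Suc.IH
    finally show ?case .
  qed
  have "\<kappa> * emeasure M {\<omega>\<in>A. \<exists>i. \<kappa> \<le> V i \<omega>} = \<kappa> * (SUP n. emeasure M (A - B n))"
  proof -
    have "(\<exists>i. \<kappa> \<le> V i \<omega>) \<longleftrightarrow> (\<exists>n. \<not> (\<forall>i<n. V i \<omega> < \<kappa>))" for \<omega>
      by (meson lessI not_less)
    then have "{\<omega>\<in>A. \<exists>i. \<kappa> \<le> V i \<omega>} = (\<Union>n. A - B n)"
      by (auto simp: B_def)
    also have "emeasure M \<dots> = (SUP n. emeasure M (A - B n))"
      by (intro SUP_emeasure_incseq[symmetric]) (auto simp: incseq_def B_def)
    finally show ?thesis by simp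
  qed
  also have "\<dots> = (SUP n. \<kappa> * emeasure M (A - B n))" by (rule SUP_mult_left_ennreal)
  also have "\<dots> \<le> (\<integral>\<^sup>+\<omega>. indicator A \<omega> * V 0 \<omega> \<partial>M)"
    by (intro SUP_least order_trans[OF add_increasing2[OF zero_le order_refl] claim])
  finally show ?thesis .
qed

end

text \<open>Boundedness confines the points at distance at least \<open>e\<close> from the
  minimizers to a compact set \<open>K\<close>. There \<phi> attains a minimum strictly above the
  global one, so a minimizing sequence must leave \<open>K\<close>.\<close>

lemma (in quadratically_bounded_convex) dist_argmin_tendsto_0:
  fixes x :: "nat \<Rightarrow> 'a"
  assumes bounded: "bounded (range x)" and z: "z \<in> argmin \<phi>" and lim: "(\<lambda>k. \<phi> (x k)) \<longlonglongrightarrow> \<phi> z"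
  shows "(\<lambda>k. dist (x k) (closest_point (argmin \<phi>) (x k))) \<longlonglongrightarrow> 0"
proof (rule tendstoI)
  fix e :: real assume e: "0 < e"
  define h where "h y = dist y (closest_point (argmin \<phi>) y)" for y
  have z_le: "\<phi> z \<le> \<phi> y" for y using z by (auto simp: argmin_def is_arg_min_def not_less)
  have ne: "argmin \<phi> \<noteq> {}" using z by auto
  have ch: "continuous_on UNIV h"
    unfolding h_def
    by (intro continuous_on_dist continuous_on_id continuous_on_closest_point convex_argmin closed_argmin ne)
  obtain R where R: "\<And>k. norm (x k) \<le> R" using bounded unfolding bounded_iff by auto
  define K where "K = cball 0 R \<inter> {y. e \<le> h y}"
  have "closed {y. e \<le> h y}"
    using ch by (intro closed_Collect_le continuous_on_const)
  then have K: "compact K" unfolding K_def by (intro compact_Int_closed compact_cball)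
  have "\<forall>\<^sub>F k in sequentially. x k \<notin> K"
  proof (cases "K = {}")
    case False
    obtain y where y: "y \<in> K" "\<And>y'. y' \<in> K \<Longrightarrow> \<phi> y \<le> \<phi> y'"
      using continuous_attains_inf[OF K False continuous] by blast
    have "\<phi> z < \<phi> y"
    proof (rule ccontr)
      assume "\<not> \<phi> z < \<phi> y"
      then have "y \<in> argmin \<phi>"
        using z_le by (auto simp: argmin_def is_arg_min_def not_less intro: order_trans)
      then have "h y = 0" using closest_point_self[of y "argmin \<phi>"] by (simp add: h_def)
      then show False using y(1) e by (simp add: K_def)
    qed
    from order_tendstoD(2)[OF lim this] show ?thesis
      by eventually_elim (use y(2) in force)
  qed simp
  then show "\<forall>\<^sub>F k in sequentially. dist (dist (x k) (closest_point (argmin \<phi>) (x k))) 0 < e"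
    by eventually_elim (use R in \<open>auto simp: K_def h_def not_le\<close>)
qed

text \<open>A Cauchy criterion in which \<open>y\<close> may depend on \<open>e\<close>, as the
  projections of late positions do. Completeness yields the limit along the integers, and
  near-constancy extends it to real times.\<close>

lemma convergent_at_top_of_almost_constant:
  fixes x :: "real \<Rightarrow> 'b::banach"
  assumes "\<And>e. 0 < e \<Longrightarrow> \<exists>T y. \<forall>t\<ge>T. dist (x t) y \<le> e"
  shows "\<exists>l. (x \<longlongrightarrow> l) at_top"
proof -
  have "Cauchy (\<lambda>n. x (real n))"
  proof (rule metric_CauchyI)
    fix e :: real assume e: "0 < e"
    then obtain T y where T: "\<And>t. T \<le> t \<Longrightarrow> dist (x t) y \<le> e / 3" using assms[of "e / 3"] by auto
    obtain N where N: "T \<le> real N" using real_arch_simple by blast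
    have "dist (x (real m)) (x (real n)) < e" if "N \<le> m" "N \<le> n" for m n
    proof -
      have "T \<le> real m" "T \<le> real n" using N that by auto
      then have "dist (x (real m)) y + dist (x (real n)) y \<le> e / 3 + e / 3"
        using T by (intro add_mono) auto
      then show ?thesis using dist_triangle2[of "x (real m)" "x (real n)" y] e by linarith
    qed
    then show "\<exists>N. \<forall>m\<ge>N. \<forall>n\<ge>N. dist (x (real m)) (x (real n)) < e" by blast
  qed
  then obtain l where l: "(\<lambda>n. x (real n)) \<longlonglongrightarrow> l"
    using convergent_def Cauchy_convergent_iff by blast
  have "(x \<longlongrightarrow> l) at_top"
  proof (rule tendstoI)
    fix e :: real assume e: "0 < e"
    then obtain T y where T: "\<And>t. T \<le> t \<Longrightarrow> dist (x t) y \<le> e / 3" using assms[of "e / 3"] by auto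
    have "\<forall>\<^sub>F n in sequentially. dist (x (real n)) y \<le> e / 3"
      using eventually_ge_at_top[of "nat \<lceil>T\<rceil>"]
      by eventually_elim (intro T, linarith)
    then have ly: "dist l y \<le> e / 3"
      by (intro tendsto_upperbound[OF tendsto_dist[OF l tendsto_const]]) auto
    show "\<forall>\<^sub>F t in at_top. dist (x t) l < e"
      using eventually_ge_at_top[of T]
    proof eventually_elim
      case (elim t)
      then show ?case using T[OF elim] ly dist_triangle2[of "x t" l y] e by linarith
    qed
  qed
  then show ?thesis by blast
qed

section \<open>Behaviour of almost every path\<close>

context gradient_sde
begin

text \<open>The discrete inequality is applied on grids of mesh \<open>1 / 2 ^ n\<close> from
  \<open>s\<close> on; the grids are nested, so the bound passes to the union of the events. A path
  that exceeds \<open>l\<close> strictly does so on a fine grid by continuity. The event over all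
  times is an uncountable union, hence the measurable superset \<open>B\<close>.\<close>

lemma maximal_inequality_process:
  assumes s: "0 \<le> s" and A: "A \<in> sets (F s)" and l: "0 < (l::real)"
    and Y: "Y \<in> borel_measurable (F s)" "\<And>\<omega>. \<omega> \<in> space M \<Longrightarrow> Y \<omega> \<in> argmin \<Phi>"
      "integrable M (\<lambda>\<omega>. (norm (Y \<omega>))\<^sup>2)"
  shows "\<exists>B\<in>sets M. {\<omega>\<in>A. \<exists>t\<ge>s. l < (norm (X t \<omega> - Y \<omega>))\<^sup>2} \<subseteq> B \<and>
    ennreal l * emeasure M B \<le> (\<integral>\<^sup>+\<omega>. indicator A \<omega> * ennreal ((norm (X s \<omega> - Y \<omega>))\<^sup>2 + tail s) \<partial>M)"
proof -
  define \<tau> where "\<tau> n i = s + real i / 2 ^ n" for n i :: nat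
  define V where "V n i \<omega> = ennreal ((norm (X (\<tau> n i) \<omega> - Y \<omega>))\<^sup>2 + tail (\<tau> n i))" for n i \<omega>
  define B where "B n = {\<omega>\<in>A. \<exists>i. ennreal l \<le> V n i \<omega>}" for n
  have \<tau>: "0 \<le> \<tau> n i" "s \<le> \<tau> n i" "\<tau> n 0 = s" "\<tau> n i \<le> \<tau> n (Suc i)" for n i
    using s by (auto simp: \<tau>_def divide_right_mono)
  have mono: "mono (\<tau> n)" for n by (rule mono_iff_le_Suc[THEN iffD2]) (use \<tau>(4) in blast)
  have AM: "A \<in> sets M" using A s sets_F_subset by blast
  have Y\<tau>: "Y \<in> borel_measurable (F (\<tau> n i))" for n i
    using Y(1) s \<tau>(2) by (rule measurable_F_mono)
  have V: "V n i \<in> borel_measurable (F (\<tau> n i))" for n i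
    unfolding V_def using X_adapted[OF \<tau>(1)] Y\<tau> by measurable
  have V_M: "V n i \<in> borel_measurable M" for n i
    using V \<tau>(1) by (rule measurable_F_M)
  have bound: "ennreal l * emeasure M (B n)
      \<le> (\<integral>\<^sup>+\<omega>. indicator A \<omega> * ennreal ((norm (X s \<omega> - Y \<omega>))\<^sup>2 + tail s) \<partial>M)" for n
  proof -
    have "ennreal l * emeasure M (B n) \<le> (\<integral>\<^sup>+\<omega>. indicator A \<omega> * V n 0 \<omega> \<partial>M)"
      unfolding B_def
    proof (rule maximal_inequality[where \<tau> = "\<tau> n" and V = "V n"])
      fix i C assume C: "C \<in> sets (F (\<tau> n i))"
      show "(\<integral>\<^sup>+\<omega>. indicator C \<omega> * V n (Suc i) \<omega> \<partial>M) \<le> (\<integral>\<^sup>+\<omega>. indicator C \<omega> * V n i \<omega> \<partial>M)"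
        unfolding V_def by (rule supermartingale[OF \<tau>(1) \<tau>(4) C Y\<tau> Y(2,3)])
    qed (simp_all add: \<tau>(3) s mono V A)
    then show ?thesis by (simp add: V_def \<tau>(3))
  qed
  have BM: "B n \<in> sets M" for n
  proof -
    have "B n = A \<inter> (\<Union>i. {\<omega>\<in>space M. ennreal l \<le> V n i \<omega>})"
      using sets.sets_into_space[OF AM] by (auto simp: B_def)
    also have "\<dots> \<in> sets M" using AM V_M by measurable
    finally show ?thesis .
  qed
  have inc: "incseq B"
  proof (rule incseq_SucI, rule subsetI)
    fix n \<omega> assume "\<omega> \<in> B n"
    then obtain i where i: "\<omega> \<in> A" "ennreal l \<le> V n i \<omega>" by (auto simp: B_def)
    \<comment> \<open>Each point of the coarser grid has twice its index in the finer one.\<close>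
    have "\<tau> (Suc n) (2 * i) = \<tau> n i" by (simp add: \<tau>_def)
    then have "V (Suc n) (2 * i) \<omega> = V n i \<omega>" by (simp add: V_def)
    with i have "ennreal l \<le> V (Suc n) (2 * i) \<omega>" by simp
    with i(1) show "\<omega> \<in> B (Suc n)" unfolding B_def by blast
  qed
  show ?thesis
  proof (intro bexI conjI)
    show "(\<Union>n. B n) \<in> sets M" using BM by auto
    have "ennreal l * emeasure M (\<Union>n. B n) = (SUP n. ennreal l * emeasure M (B n))"
      using SUP_emeasure_incseq[of B M] BM inc by (simp add: SUP_mult_left_ennreal[symmetric] image_subset_iff)
    also have "\<dots> \<le> (\<integral>\<^sup>+\<omega>. indicator A \<omega> * ennreal ((norm (X s \<omega> - Y \<omega>))\<^sup>2 + tail s) \<partial>M)"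
      using bound by (intro SUP_least)
    finally show "ennreal l * emeasure M (\<Union>n. B n)
      \<le> (\<integral>\<^sup>+\<omega>. indicator A \<omega> * ennreal ((norm (X s \<omega> - Y \<omega>))\<^sup>2 + tail s) \<partial>M)" .
    show "{\<omega>\<in>A. \<exists>t\<ge>s. l < (norm (X t \<omega> - Y \<omega>))\<^sup>2} \<subseteq> (\<Union>n. B n)"
    proof safe
      fix \<omega> t assume \<omega>: "\<omega> \<in> A" and t: "s \<le> t" and gt: "l < (norm (X t \<omega> - Y \<omega>))\<^sup>2"
      have \<omega>M: "\<omega> \<in> space M" using sets.sets_into_space[OF AM] \<omega> by blast
      \<comment> \<open>The index of the last grid point of level \<open>n\<close> not after
        \<open>t\<close>; it lies within \<open>(1 / 2) ^ n\<close> of \<open>t\<close>.\<close>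
      define i where "i n = nat \<lfloor>(t - s) * 2 ^ n\<rfloor>" for n :: nat
      have lim: "(\<lambda>n. \<tau> n (i n)) \<longlonglongrightarrow> t"
      proof (rule tendsto_sandwich)
        have i: "real (i n) \<le> (t - s) * 2 ^ n" "(t - s) * 2 ^ n - 1 \<le> real (i n)" for n
        proof -
          have "0 \<le> (t - s) * 2 ^ n" using t by simp
          then show "real (i n) \<le> (t - s) * 2 ^ n" "(t - s) * 2 ^ n - 1 \<le> real (i n)"
            unfolding i_def by linarith+
        qed
        have "\<tau> n (i n) \<le> t" for n
          using i(1)[of n] by (simp add: \<tau>_def field_simps)
        then show "\<forall>\<^sub>F n in sequentially. \<tau> n (i n) \<le> t" by simp
        have "t - (1 / 2) ^ n \<le> \<tau> n (i n)" for n
        proof -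
          have "((t - s) * 2 ^ n - 1) / 2 ^ n \<le> real (i n) / 2 ^ n"
            using i(2)[of n] by (intro divide_right_mono) auto
          then show ?thesis by (simp add: \<tau>_def diff_divide_distrib power_one_over)
        qed
        then show "\<forall>\<^sub>F n in sequentially. t - (1 / 2) ^ n \<le> \<tau> n (i n)" by simp
        show "(\<lambda>n. t - (1 / 2) ^ n) \<longlonglongrightarrow> t"
          using tendsto_diff[OF tendsto_const LIMSEQ_power_zero[of "1 / 2 :: real"], of t] by simp
      qed simp
      have "(\<lambda>n. X (\<tau> n (i n)) \<omega>) \<longlonglongrightarrow> X t \<omega>"
        by (rule continuous_on_tendsto_compose[OF X_continuous[OF \<omega>M] lim]) (use s t \<tau>(1) in auto)
      then have "(\<lambda>n. (norm (X (\<tau> n (i n)) \<omega> - Y \<omega>))\<^sup>2) \<longlonglongrightarrow> (norm (X t \<omega> - Y \<omega>))\<^sup>2"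
        by (intro tendsto_intros)
      from order_tendstoD(1)[OF this gt]
      obtain n where "l < (norm (X (\<tau> n (i n)) \<omega> - Y \<omega>))\<^sup>2"
        by (auto simp: eventually_sequentially)
      then have "ennreal l \<le> V n (i n) \<omega>"
        unfolding V_def using tail_nonneg[OF \<tau>(1)[of n "i n"]] by (intro ennreal_leI) linarith
      then show "\<omega> \<in> (\<Union>n. B n)" using \<omega> by (auto simp: B_def)
    qed
  qed
qed

text \<open>The maximal inequality from time 0 around \<open>xmin\<close> bounds the probability of
  \<open>B k\<close>, which covers the excursions beyond squared distance \<open>Suc k\<close>, by a
  multiple of \<open>1 / Suc k\<close>. An unbounded path lies in every \<open>B k\<close>, so it
  lies in a null set.\<close>

lemma AE_bounded_path: "AE \<omega> in M. \<exists>R. \<forall>t\<ge>0. norm (X t \<omega>) \<le> R"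
proof -
  define C where "C = (\<integral>\<^sup>+\<omega>. ennreal ((norm (X 0 \<omega> - xmin))\<^sup>2 + tail 0) \<partial>M)"
  have sp: "space M \<in> sets (F 0)" using space_F[of 0] sets.top[of "F 0"] by simp
  have "C = ennreal (expectation (\<lambda>\<omega>. (norm (X 0 \<omega> - xmin))\<^sup>2 + tail 0))"
    unfolding C_def using distance_square_integrable[of 0 "\<lambda>_. xmin"] tail_nonneg[of 0]
    by (intro nn_integral_eq_integral Bochner_Integration.integrable_add) auto
  then have C: "C < \<infinity>" by simp
  have ex: "\<exists>B\<in>sets M. {\<omega>\<in>space M. \<exists>t\<ge>0. real (Suc k) < (norm (X t \<omega> - xmin))\<^sup>2} \<subseteq> B \<and>
      ennreal (real (Suc k)) * emeasure M B \<le> C" for k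
  proof -
    have "(\<integral>\<^sup>+\<omega>. indicator (space M) \<omega> * ennreal ((norm (X 0 \<omega> - xmin))\<^sup>2 + tail 0) \<partial>M) = C"
      unfolding C_def by (intro nn_integral_cong) simp
    then show ?thesis
      using maximal_inequality_process[OF order_refl sp, of "real (Suc k)" "\<lambda>_. xmin"] xmin by simp
  qed
  have "\<exists>B. \<forall>k. B k \<in> sets M \<and>
      {\<omega>\<in>space M. \<exists>t\<ge>0. real (Suc k) < (norm (X t \<omega> - xmin))\<^sup>2} \<subseteq> B k \<and>
      ennreal (real (Suc k)) * emeasure M (B k) \<le> C"
    by (rule choice) (use ex in blast)
  then obtain B where B: "\<And>k. B k \<in> sets M"
    "\<And>k. {\<omega>\<in>space M. \<exists>t\<ge>0. real (Suc k) < (norm (X t \<omega> - xmin))\<^sup>2} \<subseteq> B k"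
    "\<And>k. ennreal (real (Suc k)) * emeasure M (B k) \<le> C" by blast
  obtain C' where C': "C = ennreal C'" "0 \<le> C'" using C by (cases C) auto
  have prob_le: "prob (\<Inter>k. B k) \<le> C' / real (Suc k)" for k
  proof -
    have "ennreal (real (Suc k) * prob (B k)) \<le> ennreal C'"
      using B(3)[of k] by (simp add: C' emeasure_eq_measure ennreal_mult)
    then have "real (Suc k) * prob (B k) \<le> C'" using C'(2) by simp
    then have "prob (B k) \<le> C' / real (Suc k)" by (simp add: pos_le_divide_eq mult.commute)
    moreover have "prob (\<Inter>k. B k) \<le> prob (B k)" using B(1) by (intro finite_measure_mono) auto
    ultimately show ?thesis by linarith
  qed
  have "(\<lambda>k. C' / real (Suc k)) \<longlonglongrightarrow> 0"
    using tendsto_mult_right_zero[OF LIMSEQ_inverse_real_of_nat, of C'] by (simp add: divide_inverse)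
  from LIMSEQ_le_const[OF this] prob_le have "prob (\<Inter>k. B k) \<le> 0" by blast
  then have "(\<Inter>k. B k) \<in> null_sets M"
    using B(1) by (auto simp: null_sets_def emeasure_eq_measure measure_le_0_iff)
  then have "AE \<omega> in M. \<omega> \<notin> (\<Inter>k. B k)" by (rule AE_not_in)
  then show ?thesis
    using AE_space
  proof eventually_elim
    case (elim \<omega>)
    then obtain k where "\<omega> \<notin> B k" by auto
    then have le: "(norm (X t \<omega> - xmin))\<^sup>2 \<le> real (Suc k)" if "0 \<le> t" for t
      using B(2)[of k] elim(2) that by (force simp: not_less)
    have "norm (X t \<omega>) \<le> sqrt (real (Suc k)) + norm xmin" if "0 \<le> t" for t
      using real_le_rsqrt[OF le[OF that]] norm_triangle_sub[of "X t \<omega>" xmin] by linarith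
    then show ?case by blast
  qed
qed

lemma closest_point_argmin: "closest_point (argmin \<Phi>) y \<in> argmin \<Phi>"
  using closest_point_exists[OF closed_argmin] xmin by blast

lemma closest_point_measurable: "closest_point (argmin \<Phi>) \<in> borel_measurable borel"
  using xmin by (intro borel_measurable_continuous_onI continuous_on_closest_point convex_argmin closed_argmin) auto

text \<open>Projection onto a closed convex set is nonexpansive and so grows at most linearly. This
  admits the projection of \<open>X t\<close> as the random centre in the supermartingale
  estimate.\<close>

lemma closest_point_square_integrable:
  assumes "0 \<le> t"
  shows "integrable M (\<lambda>\<omega>. (norm (closest_point (argmin \<Phi>) (X t \<omega>)))\<^sup>2)"
proof (rule Bochner_Integration.integrable_bound)
  let ?p = "closest_point (argmin \<Phi>)"
  show "integrable M (\<lambda>\<omega>. 2 * (norm (X t \<omega>))\<^sup>2 + 2 * (norm (?p 0))\<^sup>2)"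
    using X_square_integrable[OF assms] by simp
  have "(norm (?p y))\<^sup>2 \<le> 2 * (norm y)\<^sup>2 + 2 * (norm (?p 0))\<^sup>2" for y
  proof -
    have "dist (?p y) (?p 0) \<le> dist y 0"
      using xmin by (intro closest_point_lipschitz convex_argmin closed_argmin) auto
    then have "(norm (?p y - ?p 0))\<^sup>2 \<le> (norm y)\<^sup>2"
      by (intro power_mono) (auto simp: dist_norm)
    moreover have "(norm (?p y))\<^sup>2 \<le> 2 * (norm (?p y - ?p 0))\<^sup>2 + 2 * (norm (?p 0))\<^sup>2"
      using norm_diff_sq_le[of "?p y - ?p 0" "- ?p 0"] by simp
    ultimately show ?thesis by linarith
  qed
  then show "AE \<omega> in M. norm ((norm (?p (X t \<omega>)))\<^sup>2) \<le> norm (2 * (norm (X t \<omega>))\<^sup>2 + 2 * (norm (?p 0))\<^sup>2)"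
    by simp
  show "(\<lambda>\<omega>. (norm (?p (X t \<omega>)))\<^sup>2) \<in> borel_measurable M"
    using measurable_compose[OF X_measurable[OF assms] closest_point_measurable] by simp
qed

text \<open>Times with expected gap at most \<open>(1 / 2) ^ k\<close> make the expected sum of the
  gaps finite; the sum is then finite almost surely and its terms tend to zero. The times are
  deterministic, so the estimates can be restarted at them directly.\<close>

lemma AE_gap_subsequence:
  "\<exists>s. (\<forall>k. real k \<le> s k) \<and> (AE \<omega> in M. (\<lambda>k. \<Phi> (X (s k) \<omega>)) \<longlonglongrightarrow> \<Phi> xmin)"
proof -
  have "\<exists>s\<ge>real k. (\<integral>\<^sup>+\<omega>. ennreal (\<Phi> (X s \<omega>) - \<Phi> xmin) \<partial>M) \<le> ennreal ((1 / 2) ^ k)" for k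
    by (rule expected_gap_small) auto
  then have "\<exists>s. \<forall>k. real k \<le> s k \<and>
      (\<integral>\<^sup>+\<omega>. ennreal (\<Phi> (X (s k) \<omega>) - \<Phi> xmin) \<partial>M) \<le> ennreal ((1 / 2) ^ k)"
    by (intro choice allI)
  then obtain s where s: "\<And>k. real k \<le> s k"
      "\<And>k. (\<integral>\<^sup>+\<omega>. ennreal (\<Phi> (X (s k) \<omega>) - \<Phi> xmin) \<partial>M) \<le> ennreal ((1 / 2) ^ k)" by blast
  have s0: "0 \<le> s k" for k using s(1)[of k] by (meson of_nat_0_le_iff order_trans)
  have [measurable]: "\<Phi> \<in> borel_measurable borel"
    using continuous[of UNIV] by (rule borel_measurable_continuous_onI)
  have [measurable]: "X (s k) \<in> borel_measurable M" for k using s0 by simp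
  have "(\<integral>\<^sup>+\<omega>. (\<Sum>k. ennreal (\<Phi> (X (s k) \<omega>) - \<Phi> xmin)) \<partial>M)
    = (\<Sum>k. \<integral>\<^sup>+\<omega>. ennreal (\<Phi> (X (s k) \<omega>) - \<Phi> xmin) \<partial>M)"
    by (rule nn_integral_suminf) measurable
  also have "\<dots> \<le> (\<Sum>k. ennreal ((1 / 2) ^ k))" using s(2) by (intro suminf_le) auto
  also have "\<dots> = ennreal (\<Sum>k. (1 / 2) ^ k)" by (rule suminf_ennreal2) (auto intro: summable_geometric)
  finally have "(\<integral>\<^sup>+\<omega>. (\<Sum>k. ennreal (\<Phi> (X (s k) \<omega>) - \<Phi> xmin)) \<partial>M) \<noteq> \<infinity>"
    by (auto simp: top_unique)
  then have "AE \<omega> in M. (\<Sum>k. ennreal (\<Phi> (X (s k) \<omega>) - \<Phi> xmin)) \<noteq> \<infinity>"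
    by (rule nn_integral_PInf_AE[rotated]) measurable
  then have "AE \<omega> in M. (\<lambda>k. \<Phi> (X (s k) \<omega>)) \<longlonglongrightarrow> \<Phi> xmin"
  proof eventually_elim
    case (elim \<omega>)
    then have "summable (\<lambda>k. \<Phi> (X (s k) \<omega>) - \<Phi> xmin)"
      using xmin_le by (intro summable_suminf_not_top) auto
    from summable_LIMSEQ_zero[OF this] show ?case by (simp add: LIM_zero_iff)
  qed
  with s(1) show ?thesis by blast
qed

text \<open>On the event \<open>A d k\<close> that \<open>X (s k)\<close> is within squared distance
  \<open>d\<close> of its projection, the maximal inequality bounds the probability of a later
  excursion beyond \<open>l\<close> by \<open>(d + tail (real k)) / l\<close>. Almost every path
  lies in \<open>A d k\<close> for all large \<open>k\<close>, but with no rate; so \<open>k\<close>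
  is sent to infinity first and \<open>d = 1 / real (Suc j)\<close> to zero afterwards.\<close>

lemma AE_stays_close:
  assumes s: "\<And>k. real k \<le> s k" and l: "0 < l"
    and lim: "AE \<omega> in M. (\<lambda>k. dist (X (s k) \<omega>) (closest_point (argmin \<Phi>) (X (s k) \<omega>))) \<longlonglongrightarrow> 0"
  shows "AE \<omega> in M. \<exists>k. \<forall>t\<ge>s k. (norm (X t \<omega> - closest_point (argmin \<Phi>) (X (s k) \<omega>)))\<^sup>2 \<le> l"
proof -
  define Y where "Y k \<omega> = closest_point (argmin \<Phi>) (X (s k) \<omega>)" for k \<omega>
  have s0: "0 \<le> s k" for k using s[of k] by (meson of_nat_0_le_iff order_trans)
  have YF: "Y k \<in> borel_measurable (F (s k))" for k
    unfolding Y_def[abs_def] by (rule measurable_compose[OF X_adapted[OF s0] closest_point_measurable])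
  have Y_argmin: "Y k \<omega> \<in> argmin \<Phi>" for k \<omega> unfolding Y_def by (rule closest_point_argmin)
  have Y_int: "integrable M (\<lambda>\<omega>. (norm (Y k \<omega>))\<^sup>2)" for k
    unfolding Y_def by (rule closest_point_square_integrable[OF s0])
  define A where "A d k = {\<omega>\<in>space M. (norm (X (s k) \<omega> - Y k \<omega>))\<^sup>2 \<le> d}" for d k
  have AF: "A d k \<in> sets (F (s k))" for d k
  proof -
    have "A d k = {\<omega>\<in>space (F (s k)). (norm (X (s k) \<omega> - Y k \<omega>))\<^sup>2 \<le> d}"
      unfolding A_def space_F[OF s0] ..
    then show ?thesis using X_adapted[OF s0[of k]] YF[of k] by simp
  qed
  have tail_s: "tail (s k) \<le> tail (real k)" for k using tail_antimono[OF _ s[of k]] by simp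
  have "\<exists>B\<in>sets M. {\<omega>\<in>A d k. \<exists>t\<ge>s k. l < (norm (X t \<omega> - Y k \<omega>))\<^sup>2} \<subseteq> B \<and>
      l * prob B \<le> d + tail (real k)" if d: "0 \<le> d" for d k
  proof -
    obtain B where B: "B \<in> sets M" "{\<omega>\<in>A d k. \<exists>t\<ge>s k. l < (norm (X t \<omega> - Y k \<omega>))\<^sup>2} \<subseteq> B"
      "ennreal l * emeasure M B
        \<le> (\<integral>\<^sup>+\<omega>. indicator (A d k) \<omega> * ennreal ((norm (X (s k) \<omega> - Y k \<omega>))\<^sup>2 + tail (s k)) \<partial>M)"
      using maximal_inequality_process[OF s0[of k] AF[of d k] l YF[of k] Y_argmin[of k] Y_int[of k]]
      by (elim bexE conjE)
    note B(3)
    also have "(\<integral>\<^sup>+\<omega>. indicator (A d k) \<omega> * ennreal ((norm (X (s k) \<omega> - Y k \<omega>))\<^sup>2 + tail (s k)) \<partial>M)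
      \<le> (\<integral>\<^sup>+\<omega>. ennreal (d + tail (real k)) \<partial>M)"
      using tail_s[of k]
      by (intro nn_integral_mono) (auto simp: A_def split: split_indicator intro!: ennreal_leI add_mono)
    also have "\<dots> = ennreal (d + tail (real k))" by (simp add: emeasure_space_1 del: ennreal_plus)
    finally have "ennreal (l * prob B) \<le> ennreal (d + tail (real k))"
      using l by (simp add: emeasure_eq_measure ennreal_mult)
    then have "l * prob B \<le> d + tail (real k)"
      using d tail_nonneg[of "real k"] by (subst (asm) ennreal_le_iff) auto
    with B show ?thesis by blast
  qed
  then have ex: "\<exists>B\<in>sets M. {\<omega>\<in>A (1 / real (Suc j)) k. \<exists>t\<ge>s k. l < (norm (X t \<omega> - Y k \<omega>))\<^sup>2} \<subseteq> B \<and>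
      l * prob B \<le> 1 / real (Suc j) + tail (real k)" for j k :: nat by simp
  define B where "B j k = (SOME B. B \<in> sets M \<and>
      {\<omega>\<in>A (1 / real (Suc j)) k. \<exists>t\<ge>s k. l < (norm (X t \<omega> - Y k \<omega>))\<^sup>2} \<subseteq> B \<and>
      l * prob B \<le> 1 / real (Suc j) + tail (real k))" for j k :: nat
  have "B j k \<in> sets M \<and>
      {\<omega>\<in>A (1 / real (Suc j)) k. \<exists>t\<ge>s k. l < (norm (X t \<omega> - Y k \<omega>))\<^sup>2} \<subseteq> B j k \<and>
      l * prob (B j k) \<le> 1 / real (Suc j) + tail (real k)" for j k
    unfolding B_def by (rule someI_ex[OF ex[unfolded Bex_def]])
  then have B: "\<And>j k. B j k \<in> sets M"
    "\<And>j k. {\<omega>\<in>A (1 / real (Suc j)) k. \<exists>t\<ge>s k. l < (norm (X t \<omega> - Y k \<omega>))\<^sup>2} \<subseteq> B j k"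
    "\<And>j k. l * prob (B j k) \<le> 1 / real (Suc j) + tail (real k)" by auto
  \<comment> \<open>The outcomes that belong to the bad sets for all large \<open>k\<close>. Late
    \<open>k\<close> make the tail disappear from the bound, leaving
    \<open>(1 / real (Suc j)) / l\<close>.\<close>
  define G where "G j = (\<Union>K. \<Inter>k\<in>{K..}. B j k)" for j :: nat
  have GM: "G j \<in> sets M" for j
    unfolding G_def using B(1) by (intro sets.countable_UN sets.countable_INT) auto
  have G_le: "prob (G j) \<le> (1 / real (Suc j)) / l" for j
  proof -
    have "prob (\<Inter>k\<in>{K..}. B j k) \<le> (1 / real (Suc j)) / l" for K
    proof (rule LIMSEQ_le_const)
      show "(\<lambda>k. (1 / real (Suc j) + tail (real k)) / l) \<longlonglongrightarrow> (1 / real (Suc j)) / l"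
        using tendsto_divide[OF tendsto_add[OF tendsto_const tail_tendsto] tendsto_const, of l "1 / real (Suc j)"] l
        by simp
      have "prob (\<Inter>k\<in>{K..}. B j k) \<le> (1 / real (Suc j) + tail (real k)) / l" if "K \<le> k" for k
      proof -
        have "prob (\<Inter>k\<in>{K..}. B j k) \<le> prob (B j k)"
          using B(1) that by (intro finite_measure_mono) auto
        also have "\<dots> \<le> (1 / real (Suc j) + tail (real k)) / l"
          using B(3)[of j k] l by (simp add: pos_le_divide_eq mult.commute)
        finally show ?thesis .
      qed
      then show "\<exists>N. \<forall>k\<ge>N. prob (\<Inter>k\<in>{K..}. B j k) \<le> (1 / real (Suc j) + tail (real k)) / l" by blast
    qed
    moreover have "(\<lambda>K. prob (\<Inter>k\<in>{K..}. B j k)) \<longlonglongrightarrow> prob (G j)"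
      unfolding G_def using B(1)
      by (intro finite_Lim_measure_incseq) (auto simp: incseq_def)
    ultimately show ?thesis by (intro LIMSEQ_le_const2) auto
  qed
  have "prob (\<Inter>j. G j) \<le> 0"
  proof (rule LIMSEQ_le_const)
    show "(\<lambda>j. (1 / real (Suc j)) / l) \<longlonglongrightarrow> 0"
      using tendsto_mult_right_zero[OF LIMSEQ_inverse_real_of_nat, of "1 / l"]
      by (simp add: divide_inverse mult.commute)
    have "prob (\<Inter>j. G j) \<le> prob (G j)" for j using GM by (intro finite_measure_mono) auto
    then have "prob (\<Inter>j. G j) \<le> (1 / real (Suc j)) / l" for j
      by (rule order_trans[OF _ G_le])
    then show "\<exists>N. \<forall>j\<ge>N. prob (\<Inter>j. G j) \<le> (1 / real (Suc j)) / l" by blast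
  qed
  then have "(\<Inter>j. G j) \<in> null_sets M"
    using GM by (auto simp: null_sets_def emeasure_eq_measure measure_le_0_iff)
  then have "AE \<omega> in M. \<omega> \<notin> (\<Inter>j. G j)" by (rule AE_not_in)
  then show ?thesis
    using lim AE_space
  proof eventually_elim
    case (elim \<omega>)
    then obtain j where j: "\<omega> \<notin> G j" by auto
    have "(\<lambda>k. (norm (X (s k) \<omega> - Y k \<omega>))\<^sup>2) \<longlonglongrightarrow> 0"
      using tendsto_power[OF elim(2), of 2] by (simp add: Y_def dist_norm)
    from order_tendstoD(2)[OF this, of "1 / real (Suc j)"]
    have "\<forall>\<^sub>F k in sequentially. \<omega> \<in> A (1 / real (Suc j)) k"
      using elim(3) by (auto simp: A_def elim: eventually_mono)
    then obtain K where K: "\<And>k. K \<le> k \<Longrightarrow> \<omega> \<in> A (1 / real (Suc j)) k"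
      by (auto simp: eventually_sequentially)
    \<comment> \<open>Outside \<open>G j\<close> there are arbitrarily late \<open>k\<close> with
      \<omega> outside the bad set, so one of them comes after the path has entered the events
      \<open>A\<close> for good.\<close>
    have "\<exists>k\<in>{K..}. \<omega> \<notin> B j k" using j unfolding G_def by blast
    then obtain k where k: "K \<le> k" "\<omega> \<notin> B j k" by auto
    have "\<not> l < (norm (X t \<omega> - Y k \<omega>))\<^sup>2" if "s k \<le> t" for t
      using K[OF k(1)] k(2) B(2)[of j k] that by blast
    then show ?case unfolding Y_def not_less by blast
  qed
qed

lemma AE_convergence_to_minimizer:
  "\<exists>xstar. xstar \<in> borel_measurable M \<and> (\<forall>\<omega>\<in>space M. xstar \<omega> \<in> argmin \<Phi>) \<and>
    (AE \<omega> in M. ((\<lambda>t. X t \<omega>) \<longlongrightarrow> xstar \<omega>) at_top)"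
proof -
  obtain s where s: "\<And>k. real k \<le> s k" and gap: "AE \<omega> in M. (\<lambda>k. \<Phi> (X (s k) \<omega>)) \<longlonglongrightarrow> \<Phi> xmin"
    using AE_gap_subsequence by blast
  have s0: "0 \<le> s k" for k using s[of k] by (meson of_nat_0_le_iff order_trans)
  have s_top: "filterlim s at_top sequentially"
    by (rule filterlim_at_top_mono[OF filterlim_real_sequentially]) (simp add: s)
  have "AE \<omega> in M. (\<lambda>k. dist (X (s k) \<omega>) (closest_point (argmin \<Phi>) (X (s k) \<omega>))) \<longlonglongrightarrow> 0"
    using gap AE_bounded_path
  proof eventually_elim
    case (elim \<omega>)
    then obtain R where "\<And>t. 0 \<le> t \<Longrightarrow> norm (X t \<omega>) \<le> R" by blast
    then have "bounded (range (\<lambda>k. X (s k) \<omega>))" using s0 unfolding bounded_iff by blast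
    from dist_argmin_tendsto_0[OF this xmin elim(1)] show ?case .
  qed
  note close = AE_stays_close[OF s _ this]
  \<comment> \<open>Restricting the tolerance to the countably many values
    \<open>1 / real (Suc n)\<close> yields one null set for all of them; they are squared to match
    the squared distance.\<close>
  have "AE \<omega> in M. \<forall>n. \<exists>k. \<forall>t\<ge>s k.
      (norm (X t \<omega> - closest_point (argmin \<Phi>) (X (s k) \<omega>)))\<^sup>2 \<le> (1 / real (Suc n))\<^sup>2"
    unfolding AE_all_countable by (intro allI close) simp
  then have conv: "AE \<omega> in M. \<exists>x. ((\<lambda>t. X t \<omega>) \<longlongrightarrow> x) at_top"
  proof eventually_elim
    case (elim \<omega>)
    show ?case
    proof (rule convergent_at_top_of_almost_constant)
      fix e :: real assume "0 < e"
      then obtain n where n: "1 / real (Suc n) < e" by (rule nat_approx_posE)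
      obtain k where k: "\<And>t. s k \<le> t \<Longrightarrow>
          (norm (X t \<omega> - closest_point (argmin \<Phi>) (X (s k) \<omega>)))\<^sup>2 \<le> (1 / real (Suc n))\<^sup>2"
        using elim by blast
      have "dist (X t \<omega>) (closest_point (argmin \<Phi>) (X (s k) \<omega>)) \<le> e" if "s k \<le> t" for t
        using power2_le_imp_le[OF k[OF that]] n by (simp add: dist_norm)
      then show "\<exists>T y. \<forall>t\<ge>T. dist (X t \<omega>) y \<le> e" by blast
    qed
  qed
  \<comment> \<open>Projecting makes the limit measurable and a minimizer at every outcome, also
    where the path fails to converge; where it does converge, the limit is almost surely a minimizer
    already and the projection leaves it fixed.\<close>
  define xstar where "xstar \<omega> = closest_point (argmin \<Phi>) (lim (\<lambda>n. X (real n) \<omega>))" for \<omega>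
  have "(\<lambda>\<omega>. lim (\<lambda>n. X (real n) \<omega>)) \<in> borel_measurable M"
    by (rule borel_measurable_lim_metric) simp
  then have m: "xstar \<in> borel_measurable M"
    unfolding xstar_def[abs_def] by (rule measurable_compose[OF _ closest_point_measurable])
  have "AE \<omega> in M. ((\<lambda>t. X t \<omega>) \<longlongrightarrow> xstar \<omega>) at_top"
    using conv gap
  proof eventually_elim
    case (elim \<omega>)
    obtain x where x: "((\<lambda>t. X t \<omega>) \<longlongrightarrow> x) at_top" using elim(1) by blast
    have "(\<lambda>n. X (real n) \<omega>) \<longlonglongrightarrow> x"
      by (rule filterlim_compose[OF x filterlim_real_sequentially])
    then have "lim (\<lambda>n. X (real n) \<omega>) = x" by (rule limI)
    moreover have "x \<in> argmin \<Phi>"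
    proof -
      have "(\<lambda>k. X (s k) \<omega>) \<longlonglongrightarrow> x" by (rule filterlim_compose[OF x s_top])
      from continuous_on_tendsto_compose[OF continuous[of UNIV] this]
      have "(\<lambda>k. \<Phi> (X (s k) \<omega>)) \<longlonglongrightarrow> \<Phi> x" by simp
      then have "\<Phi> x = \<Phi> xmin" using elim(2) by (rule LIMSEQ_unique)
      then show ?thesis unfolding argmin_iff .
    qed
    ultimately have "xstar \<omega> = x" unfolding xstar_def by (simp add: closest_point_self)
    then show ?case using x by simp
  qed
  moreover have "\<forall>\<omega>\<in>space M. xstar \<omega> \<in> argmin \<Phi>"
    by (simp add: xstar_def closest_point_argmin)
  ultimately show ?thesis using m by blast
qed

end

section \<open>From the hypotheses of the theorem to the abstract setting\<close>

lemma continuous_on_atLeast_of_upto: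
  fixes h :: "real \<Rightarrow> 'b::topological_space"
  assumes "\<And>T. 0 \<le> T \<Longrightarrow> continuous_on {0..T} h"
  shows "continuous_on {0..} h"
  unfolding continuous_on_eq_continuous_within
proof
  fix x :: real assume x: "x \<in> {0..}"
  have "at x within {0..} = at x within {0..x + 1}"
    by (rule at_within_nhd[of _ "{..<x + 1}"]) auto
  then show "continuous (at x within {0..}) h"
    using assms[of "x + 1"] x by (simp add: continuous_on_eq_continuous_within)
qed

text \<open>A real \<open>SUP\<close> is guaranteed to be an upper bound only over a range bounded
  above; here the sum of the entrywise bounds provides one, since the Frobenius norm is at most the
  sum of the absolute entries.\<close>

lemma norm_matrix_le_sigma_inf:
  fixes \<sigma> :: "real \<Rightarrow> real ^ 'd \<Rightarrow> real ^ 'm ^ 'd"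
  assumes bdd: "\<And>i k. bdd_above {\<bar>\<sigma> t x $ i $ k\<bar> | t x. t \<ge> 0}" and t: "0 \<le> t"
  shows "norm (\<sigma> t x) \<le> sigma_inf \<sigma> t"
proof -
  have "\<exists>B. \<forall>x. \<bar>\<sigma> t x $ i $ k\<bar> \<le> B" for i k
    using bdd[of i k] t unfolding bdd_above_def by blast
  then obtain B where B: "\<And>i k x. \<bar>\<sigma> t x $ i $ k\<bar> \<le> B i k" by metis
  have "norm (\<sigma> t x) \<le> (\<Sum>i\<in>UNIV. \<Sum>k\<in>UNIV. B i k)" for x
  proof -
    have "norm (\<sigma> t x) \<le> (\<Sum>i\<in>UNIV. norm (\<sigma> t x $ i))"
      unfolding norm_vec_def by (rule L2_set_le_sum) simp
    also have "\<dots> \<le> (\<Sum>i\<in>UNIV. \<Sum>k\<in>UNIV. \<bar>\<sigma> t x $ i $ k\<bar>)"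
      by (intro sum_mono norm_le_l1_cart)
    also have "\<dots> \<le> (\<Sum>i\<in>UNIV. \<Sum>k\<in>UNIV. B i k)" by (intro sum_mono B)
    finally show ?thesis .
  qed
  then have "bdd_above (range (\<lambda>x. norm (\<sigma> t x)))" by (intro bdd_aboveI2)
  then show ?thesis unfolding sigma_inf_def by (intro cSUP_upper) auto
qed

context filtered_prob_space
begin

text \<open>The section at time \<open>t\<close> of joint measurability on \<open>{0..t}\<close>,
  taken along the map that pairs \<open>t\<close> with the outcome.\<close>

lemma S2_adapted:
  assumes X: "X \<in> S2 M F" and t: "0 \<le> t"
  shows "X t \<in> borel_measurable (F t)"
proof -
  have "(\<lambda>(s, \<omega>). X s \<omega>) \<in> borel_measurable (restrict_space borel {0..t} \<Otimes>\<^sub>M F t)"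
    using X t by (auto simp: S2_def S2_upto_def S0_upto_def progressive_on_def)
  moreover have "(\<lambda>\<omega>. (t, \<omega>)) \<in> F t \<rightarrow>\<^sub>M restrict_space borel {0..t} \<Otimes>\<^sub>M F t"
    using t by (intro measurable_Pair measurable_const measurable_ident_sets) (simp_all add: space_restrict_space)
  ultimately have "(\<lambda>\<omega>. (\<lambda>(s, \<omega>). X s \<omega>) (t, \<omega>)) \<in> borel_measurable (F t)"
    by (rule measurable_compose[rotated])
  then show ?thesis by simp
qed

lemma S2_continuous:
  assumes "X \<in> S2 M F" "\<omega> \<in> space M"
  shows "continuous_on {0..} (\<lambda>t. X t \<omega>)"
  using assms by (intro continuous_on_atLeast_of_upto) (auto simp: S2_def S2_upto_def S0_upto_def)

lemma S2_square_bounded: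
  assumes X: "X \<in> S2 M F" and T: "0 \<le> T"
  shows "\<exists>C\<ge>0. \<forall>t\<in>{0..T}. sq_integral M (X t) \<le> ennreal C"
proof -
  let ?S = "\<integral>\<^sup>+ \<omega>. (SUP t\<in>{0..T}. ennreal ((norm (X t \<omega>))\<^sup>2)) \<partial>M"
  have "?S < \<infinity>" using X T by (auto simp: S2_def S2_upto_def)
  then obtain C where C: "?S = ennreal C" "0 \<le> C" by (cases ?S) auto
  have "sq_integral M (X t) \<le> ?S" if "t \<in> {0..T}" for t
    using that by (intro nn_integral_mono SUP_upper)
  with C show ?thesis by auto
qed

end

theorem proposition5p17:
  fixes f :: "real ^ 'd \<Rightarrow> real" and g :: "real ^ 'd \<Rightarrow> ereal"
    and L l0 \<theta> :: real
    and \<sigma> :: "real \<Rightarrow> real ^ 'd \<Rightarrow> real ^ 'm ^ 'd"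
    and M :: "'a measure" and F :: "real \<Rightarrow> 'a measure" and W :: "real \<Rightarrow> 'a \<Rightarrow> real ^ 'm"
    and X0 :: "real ^ 'd" and X :: "real \<Rightarrow> 'a \<Rightarrow> real ^ 'd"
  assumes "brownian_motion M F W"
    and "convex_on UNIV f"
    and "\<And>x. f differentiable (at x)" and "continuous_on UNIV (grad f)"
    and "L-lipschitz_on UNIV (grad f)"
    and "proper_fun g" and "lsc_fun g" and "convex_fun g"
    and "argmin (\<lambda>x. ereal (f x) + g x) \<noteq> {}"
    and "(\<lambda>(t, x). \<sigma> t x) \<in> borel_measurable (restrict_space borel ({0..} \<times> UNIV))"
    and "\<And>i k. bdd_above {\<bar>\<sigma> t x $ i $ k\<bar> | t x. t \<ge> 0}"
    and "l0 > 0"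
    and "\<And>i k t x x'. t \<ge> 0 \<Longrightarrow> \<bar>\<sigma> t x' $ i $ k - \<sigma> t x $ i $ k\<bar> \<le> l0 * norm (x' - x)"
    and "set_integrable lborel {0..} (\<lambda>t. (sigma_inf \<sigma> t)\<^sup>2)"
    and "\<theta> > 0"
    and "argmin (smoothed_objective f g \<theta>) \<noteq> {}"
    and "X \<in> S2 M F"
    and "sde_solution M F W (\<lambda>x. - grad (smoothed_objective f g \<theta>) x) \<sigma> X0 X"
  shows "\<exists>xstar. xstar \<in> borel_measurable M \<and>
    (\<forall>\<omega>\<in>space M. xstar \<omega> \<in> argmin (smoothed_objective f g \<theta>)) \<and>
    (AE \<omega> in M. ((\<lambda>t. X t \<omega>) \<longlongrightarrow> xstar \<omega>) at_top)"
proof -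
  interpret brownian_motion M F W by (rule assms(1))
  let ?\<Phi> = "smoothed_objective f g \<theta>"
  interpret quadratically_bounded_convex ?\<Phi> "L + 1 / (2 * \<theta>)"
    by (rule smoothed_objective_quadratically_bounded_convex) (use assms in auto)
  obtain I where I: "ito_integral M F W (\<lambda>t \<omega>. \<sigma> t (X t \<omega>)) I"
    and eq: "AE \<omega> in M. \<forall>t\<ge>0. set_integrable lborel {0..t} (\<lambda>s. - grad ?\<Phi> (X s \<omega>)) \<and>
        X t \<omega> = X0 + (LINT s:{0..t}|lborel. - grad ?\<Phi> (X s \<omega>)) + I t \<omega>"
    using assms(18) unfolding sde_solution_def by blast
  obtain xmin where "xmin \<in> argmin ?\<Phi>" using assms(16) by blast
  interpret gradient_sde M F W ?\<Phi> "L + 1 / (2 * \<theta>)" \<sigma> X0 X I "\<lambda>t. (sigma_inf \<sigma> t)\<^sup>2" xmin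
  proof
    show "AE \<omega> in M. \<forall>t\<ge>0. X t \<omega> = X0 + (LINT s:{0..t}|lborel. - grad ?\<Phi> (X s \<omega>)) + I t \<omega>"
      using eq by eventually_elim simp
    show "(norm (\<sigma> t x))\<^sup>2 \<le> (sigma_inf \<sigma> t)\<^sup>2" if "0 \<le> t" for t x
      using norm_matrix_le_sigma_inf[OF assms(11) that] by (intro power_mono) auto
    show "set_integrable lborel {0..} (\<lambda>t. (sigma_inf \<sigma> t)\<^sup>2)" by (rule assms(14))
  qed (fact I S2_adapted[OF assms(17)] S2_continuous[OF assms(17)] S2_square_bounded[OF assms(17)]
      \<open>xmin \<in> argmin ?\<Phi>\<close>)+
  show ?thesis by (rule AE_convergence_to_minimizer)
qed

end
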